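(* Let $H$ be a finitely presented cancellative hoop, $u\in H$ a unit, and $d$ the topological dimension of $E_u$. For $0\le l\le d$ let $E_u^l$ be the set of $e\in E_u$ at which the local dimension of $E_u$ is $l$, and let $0\le l_1<\dots<l_q=d$ be the values of $l$ with $E_u^l\ne\emptyset$. For each $i$ let $e^i_1,e^i_2,\ldots$ be an enumeration without repetitions of all discrete states in $E_u^{l_i}$ by nondecreasing denominators, and let $p=(p_1,\dots,p_q)\in\mathbb{R}_{\ge0}^q$ with $\sum_ip_i=1$. Then for every $i$ and $h\in H$ the limit $$m_u^{l_i}(h)=\lim_{k\to\infty}\frac1k\sum_{t\le k}e^i_t(h)$$ exists (if $E_u^{l_i}$ contains only finitely many discrete states $e^i_1,\dots,e^i_r$, it is understood as $\frac1r\sum_{t\le r}e^i_t(h)$) and does not depend on the enumeration. The function $m_u^p(h)=\sum_ip_i\,m_u^{l_i}(h)$ is an automorphism-invariant state on $(H,u)$, and it is faithful (i.e. $h\ne0$ implies $m_u^p(h)\ne0$) iff $p_i>0$ for every $i$.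
   Context: Cancellative hoop: algebra $(H,+,\dot-,0)$ with $(H,+,0)$ a commutative monoid and $x\dot-x=0$, $(x\dot-y)\dot-z=x\dot-(y+z)$, $x+(y\dot-x)=y+(x\dot-y)$, $(x+y)\dot-y=x$; order $x\le y$ iff $x\dot-y=0$; $\mathbb{R}_{\ge0}$ is one with $x\dot-y=\max\{0,x-y\}$. Finitely presented: quotient of a finitely generated free cancellative hoop by finitely many equations. Unit: $u$ with every $h\le ku$ for some integer $k\ge1$. A state on $(H,u)$ is a monoid homomorphism $m:H\to\mathbb{R}_{\ge0}$ with $m(u)=1$; it is automorphism-invariant if $m\circ\sigma=m$ for all hoop automorphisms $\sigma$ of $H$ fixing $u$. $E_u$ is the set of states that are hoop homomorphisms (extremal states), with the topology of pointwise convergence (subspace of $\mathbb{R}^H$); it is compact Hausdorff. $e\in E_u$ is discrete if $e[H]=b^{-1}\mathbb{Z}_{\ge0}$ for a (unique) integer $b\ge1$, its denominator. Dimensions are topological (inductive) dimensions. *)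

theory Defs
  imports "HOL-Analysis.Analysis"
begin

text \<open>The operation \<open>minus\<close> of the class is the truncated difference of the hoop.\<close>

class cancellative_hoop = comm_monoid_add + minus +
  assumes hoop_diff_self: "x - x = 0"
    and hoop_diff_diff: "(x - y) - z = x - (y + z)"
    and hoop_divisible: "x + (y - x) = y + (x - y)"
    and hoop_cancel: "(x + y) - y = x"

definition hoop_le :: "'a::cancellative_hoop \<Rightarrow> 'a \<Rightarrow> bool" where
  "hoop_le x y \<longleftrightarrow> x - y = 0"

definition hoop_unit :: "'a::cancellative_hoop \<Rightarrow> bool" where
  "hoop_unit u \<longleftrightarrow> (\<forall>h. \<exists>k::nat. k \<ge> 1 \<and> hoop_le h (\<Sum>i<k. u))"

definition hoop_automorphism :: "('a::cancellative_hoop \<Rightarrow> 'a) \<Rightarrow> bool" where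
  "hoop_automorphism \<sigma> \<longleftrightarrow> bij \<sigma> \<and> \<sigma> 0 = 0 \<and>
     (\<forall>x y. \<sigma> (x + y) = \<sigma> x + \<sigma> y) \<and> (\<forall>x y. \<sigma> (x - y) = \<sigma> x - \<sigma> y)"

datatype hterm = HGen nat | HZero | HAdd hterm hterm | HSub hterm hterm

inductive_set hterms :: "nat \<Rightarrow> hterm set" for n where
  gen: "i < n \<Longrightarrow> HGen i \<in> hterms n"
| zero: "HZero \<in> hterms n"
| add: "s \<in> hterms n \<Longrightarrow> t \<in> hterms n \<Longrightarrow> HAdd s t \<in> hterms n"
| sub: "s \<in> hterms n \<Longrightarrow> t \<in> hterms n \<Longrightarrow> HSub s t \<in> hterms n"

text \<open>
  The least congruence of the term algebra on \<open>n\<close> generators that contains all instances of the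
  axioms of cancellative hoops and all pairs in \<open>E\<close>.  The quotient of \<open>hterms n\<close> by
  \<open>hoop_cong n {}\<close> is the free cancellative hoop on \<open>n\<close> generators, and its further quotient by
  the equations \<open>s = t\<close> with \<open>(s, t) \<in> E\<close> is the quotient of \<open>hterms n\<close> by \<open>hoop_cong n E\<close>.
\<close>

inductive hoop_cong :: "nat \<Rightarrow> (hterm \<times> hterm) set \<Rightarrow> hterm \<Rightarrow> hterm \<Rightarrow> bool" for n E where
  eqn: "(s, t) \<in> E \<Longrightarrow> s \<in> hterms n \<Longrightarrow> t \<in> hterms n \<Longrightarrow> hoop_cong n E s t"
| refl: "s \<in> hterms n \<Longrightarrow> hoop_cong n E s s"
| sym: "hoop_cong n E s t \<Longrightarrow> hoop_cong n E t s"
| trans: "hoop_cong n E r s \<Longrightarrow> hoop_cong n E s t \<Longrightarrow> hoop_cong n E r t"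
| add: "hoop_cong n E s s' \<Longrightarrow> hoop_cong n E t t' \<Longrightarrow> hoop_cong n E (HAdd s t) (HAdd s' t')"
| sub: "hoop_cong n E s s' \<Longrightarrow> hoop_cong n E t t' \<Longrightarrow> hoop_cong n E (HSub s t) (HSub s' t')"
| add_assoc: "r \<in> hterms n \<Longrightarrow> s \<in> hterms n \<Longrightarrow> t \<in> hterms n \<Longrightarrow>
    hoop_cong n E (HAdd (HAdd r s) t) (HAdd r (HAdd s t))"
| add_comm: "s \<in> hterms n \<Longrightarrow> t \<in> hterms n \<Longrightarrow> hoop_cong n E (HAdd s t) (HAdd t s)"
| add_zero: "s \<in> hterms n \<Longrightarrow> hoop_cong n E (HAdd HZero s) s"
| diff_self: "s \<in> hterms n \<Longrightarrow> hoop_cong n E (HSub s s) HZero"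
| diff_diff: "r \<in> hterms n \<Longrightarrow> s \<in> hterms n \<Longrightarrow> t \<in> hterms n \<Longrightarrow>
    hoop_cong n E (HSub (HSub r s) t) (HSub r (HAdd s t))"
| divisible: "s \<in> hterms n \<Longrightarrow> t \<in> hterms n \<Longrightarrow>
    hoop_cong n E (HAdd s (HSub t s)) (HAdd t (HSub s t))"
| cancel: "s \<in> hterms n \<Longrightarrow> t \<in> hterms n \<Longrightarrow> hoop_cong n E (HSub (HAdd s t) t) s"

primrec heval :: "(nat \<Rightarrow> 'a::cancellative_hoop) \<Rightarrow> hterm \<Rightarrow> 'a" where
  "heval g (HGen i) = g i"
| "heval g HZero = 0"
| "heval g (HAdd s t) = heval g s + heval g t"
| "heval g (HSub s t) = heval g s - heval g t"

text \<open>
  The type is isomorphic to the quotient of \<open>hterms n\<close> by \<open>hoop_cong n E\<close>: the homomorphism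
  \<open>heval g\<close> from \<open>hterms n\<close> is onto and its kernel is \<open>hoop_cong n E\<close>.
\<close>

definition finitely_presented :: "'a::cancellative_hoop itself \<Rightarrow> bool" where
  "finitely_presented (_ :: 'a itself) \<longleftrightarrow>
     (\<exists>n E. \<exists>g :: nat \<Rightarrow> 'a. finite E \<and> E \<subseteq> hterms n \<times> hterms n \<and>
        heval g ` hterms n = UNIV \<and>
        (\<forall>s\<in>hterms n. \<forall>t\<in>hterms n. heval g s = heval g t \<longleftrightarrow> hoop_cong n E s t))"

definition hoop_state :: "'a::cancellative_hoop \<Rightarrow> ('a \<Rightarrow> real) \<Rightarrow> bool" where
  "hoop_state u m \<longleftrightarrow> (\<forall>h. 0 \<le> m h) \<and> m 0 = 0 \<and> (\<forall>g h. m (g + h) = m g + m h) \<and> m u = 1"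

definition automorphism_invariant :: "'a::cancellative_hoop \<Rightarrow> ('a \<Rightarrow> real) \<Rightarrow> bool" where
  "automorphism_invariant u m \<longleftrightarrow> (\<forall>\<sigma>. hoop_automorphism \<sigma> \<and> \<sigma> u = u \<longrightarrow> m \<circ> \<sigma> = m)"

definition faithful :: "('a::cancellative_hoop \<Rightarrow> real) \<Rightarrow> bool" where
  "faithful m \<longleftrightarrow> (\<forall>h. h \<noteq> 0 \<longrightarrow> m h \<noteq> 0)"

text \<open>
  The target hoop is the set of nonnegative reals, whose truncated difference is \<open>max 0 (x - y)\<close>.
\<close>

definition extremal_states :: "'a::cancellative_hoop \<Rightarrow> ('a \<Rightarrow> real) set" where
  "extremal_states u = {e. hoop_state u e \<and> (\<forall>g h. e (g - h) = max 0 (e g - e h))}"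

definition extremal_space :: "'a::cancellative_hoop \<Rightarrow> ('a \<Rightarrow> real) topology" where
  "extremal_space u = subtopology (powertop_real UNIV) (extremal_states u)"

definition has_denominator :: "('a::cancellative_hoop \<Rightarrow> real) \<Rightarrow> nat \<Rightarrow> bool" where
  "has_denominator e b \<longleftrightarrow> b \<ge> 1 \<and> range e = range (\<lambda>k::nat. real k / real b)"

definition discrete_state :: "('a::cancellative_hoop \<Rightarrow> real) \<Rightarrow> bool" where
  "discrete_state e \<longleftrightarrow> (\<exists>b. has_denominator e b)"

definition denominator :: "('a::cancellative_hoop \<Rightarrow> real) \<Rightarrow> nat" where
  "denominator e = (THE b. has_denominator e b)"

text \<open>
  Both dimensions are small inductive dimensions; they are unspecified when the set over which the
  least element is taken is empty (infinite dimension).  The empty space has dimension \<open>-1\<close>.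
\<close>

definition top_dim :: "'b topology \<Rightarrow> int" where
  "top_dim X = (LEAST n. X dim_le n)"

definition local_dim :: "'b topology \<Rightarrow> 'b \<Rightarrow> int" where
  "local_dim X x = (LEAST n. \<exists>U. openin X U \<and> x \<in> U \<and> subtopology X U dim_le n)"

definition extremal_stratum :: "'a::cancellative_hoop \<Rightarrow> int \<Rightarrow> ('a \<Rightarrow> real) set" where
  "extremal_stratum u l = {e \<in> extremal_states u. local_dim (extremal_space u) e = l}"

definition discrete_stratum :: "'a::cancellative_hoop \<Rightarrow> int \<Rightarrow> ('a \<Rightarrow> real) set" where
  "discrete_stratum u l = {e \<in> extremal_stratum u l. discrete_state e}"

text \<open>Indices start at \<open>1\<close>; if \<open>D\<close> is finite, only the indices up to \<open>card D\<close> are used.\<close>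

definition denominator_enumeration ::
    "('a::cancellative_hoop \<Rightarrow> real) set \<Rightarrow> (nat \<Rightarrow> 'a \<Rightarrow> real) \<Rightarrow> bool" where
  "denominator_enumeration D e \<longleftrightarrow>
     (let I = (if finite D then {1..card D} else {1..}) in
        bij_betw e I D \<and>
        (\<forall>s\<in>I. \<forall>t\<in>I. s \<le> t \<longrightarrow> denominator (e s) \<le> denominator (e t)))"

definition cesaro_average :: "(nat \<Rightarrow> 'a::cancellative_hoop \<Rightarrow> real) \<Rightarrow> 'a \<Rightarrow> nat \<Rightarrow> real" where
  "cesaro_average e h k = 1 / real k * (\<Sum>t=1..k. e t h)"

definition has_mean ::
    "('a::cancellative_hoop \<Rightarrow> real) set \<Rightarrow> (nat \<Rightarrow> 'a \<Rightarrow> real) \<Rightarrow> 'a \<Rightarrow> real \<Rightarrow> bool" where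
  "has_mean D e h c \<longleftrightarrow>
     (if finite D then c = cesaro_average e h (card D) else cesaro_average e h \<longlonglongrightarrow> c)"

end

theory Submission
  imports Defs
begin

text \<open>
  A presentation with \<open>n\<close> generators identifies \<open>E\<^sub>u\<close> with the section \<open>u = 1\<close> of a rational
  polyhedral cone in \<open>\<real>\<^sup>n\<close>, on which the elements of the hoop act as piecewise linear functions. The
  signs of finitely many integer linear forms cut the cone into relatively open cells. The local
  dimension at a point is one less than the largest rank of a cell with this point in its closure, so
  strata are unions of cells. A discrete state of denominator \<open>b\<close> is a ray through a lattice point at
  height \<open>b\<close>, and the lattice points on this ray are those at the multiples of \<open>b\<close>. Hence a sum over
  all lattice points of height at most \<open>N\<close>, which is asymptotically an integral times \<open>N\<^sup>r\<close>, equals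
  \<open>\<Sum>k\<le>N. P(N div k)\<close>, where \<open>P(m)\<close> is the sum over discrete states of denominator at most \<open>m\<close>.
  As \<open>\<Sum>k\<ge>2. 1/k\<^sup>2 < 1\<close>, this relation can be inverted by a contraction argument, which yields the
  limits of the averages. They are positive on functions positive somewhere on the stratum, and every
  stratum contains an open subset of \<open>E\<^sub>u\<close>, which supports a nonzero element of the hoop.
\<close>

section \<open>Covering multiplicity and small inductive dimension\<close>

text \<open>Several obstacles shape the proof. A nonzero element is first seen in a totally ordered
  quotient that may be non-Archimedean; finite presentability leaves finitely many sign conditions
  on linear forms, and Fourier-Motzkin elimination solves them over the reals. The lower bound for
  the dimension of a cell needs an invariant that Brouwer's theorem controls: covering multiplicity,
  bounded above by inductive dimension and below on simplices. In the lattice sums the weight of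
  \<open>v\<close> is \<open>val v h / val v u\<close>, constant along rays, which permits grouping
  by discrete states. This grouping is inverted only for the sum of values minus the expected mean
  times the count: it suffices that a quantity with negligible divisor sum is negligible, and that
  the count is at least a multiple of \<open>N ^ r\<close>. The contraction works for
  \<open>r \<ge> 2\<close>; for \<open>r = 1\<close> the stratum is finite. Finally, an enumeration
  may stop in the middle of one denominator, so the states of a single denominator have to be few
  compared with those listed.\<close>

text \<open>For normal spaces this says that the covering dimension is less than \<open>k\<close>.\<close>

definition cover_multiplicity_le :: "'b::topological_space set \<Rightarrow> nat \<Rightarrow> bool" where
  "cover_multiplicity_le X k \<longleftrightarrow>
    (\<forall>m::nat. \<forall>U. (\<forall>i<m. openin (top_of_set X) (U i)) \<and> X \<subseteq> (\<Union>i<m. U i) \<longrightarrow>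
       (\<exists>V. (\<forall>i<m. openin (top_of_set X) (V i) \<and> V i \<subseteq> U i) \<and> X \<subseteq> (\<Union>i<m. V i) \<and>
            (\<forall>x\<in>X. card {i. i < m \<and> x \<in> V i} \<le> k)))"

lemma cover_multiplicity_leE:
  fixes U :: "nat \<Rightarrow> 'b::topological_space set"
  assumes "cover_multiplicity_le X k" "\<forall>i<m. openin (top_of_set X) (U i)" "X \<subseteq> (\<Union>i<m. U i)"
  obtains V where "\<And>i. i < m \<Longrightarrow> openin (top_of_set X) (V i) \<and> V i \<subseteq> U i" "X \<subseteq> (\<Union>i<m. V i)"
    "\<And>x. x \<in> X \<Longrightarrow> card {i. i < m \<and> x \<in> V i} \<le> k"
proof -
  have "\<exists>V. (\<forall>i<m. openin (top_of_set X) (V i) \<and> V i \<subseteq> U i) \<and> X \<subseteq> (\<Union>i<m. V i) \<and>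
            (\<forall>x\<in>X. card {i. i < m \<and> x \<in> V i} \<le> k)"
    using spec[OF spec[OF assms(1)[unfolded cover_multiplicity_le_def], of m], of U] assms(2,3) by (rule mp[OF _ conjI])
  thus ?thesis using that by blast
qed

text \<open>Removing the relatively closed set \<open>A - V i\<close> from \<open>U i\<close>
  changes nothing off \<open>A\<close> and leaves exactly \<open>V i\<close> on \<open>A\<close>,
  where the multiplicity is already small.\<close>

lemma cover_shrink_on_closed_subset:
  fixes U :: "nat \<Rightarrow> 'b::topological_space set"
  assumes A: "closedin (top_of_set X) A" and cov: "cover_multiplicity_le A k"
    and U: "\<And>i. i < m \<Longrightarrow> openin (top_of_set X) (U i)" and XU: "X \<subseteq> (\<Union>i<m. U i)"
  obtains W where "\<And>i. i < m \<Longrightarrow> openin (top_of_set X) (W i) \<and> W i \<subseteq> U i" "X \<subseteq> (\<Union>i<m. W i)"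
    "\<And>x. x \<in> A \<Longrightarrow> card {i. i < m \<and> x \<in> W i} \<le> k"
proof -
  have AX: "A \<subseteq> X" using A by (rule closedin_imp_subset)
  have "\<forall>i<m. openin (top_of_set A) (A \<inter> U i)"
    using U AX by (metis openin_subtopology_Int2 openin_subtopology_Int subtopology_subtopology inf.absorb_iff2)
  moreover have "A \<subseteq> (\<Union>i<m. A \<inter> U i)" using XU AX by auto
  ultimately obtain V where V: "\<And>i. i < m \<Longrightarrow> openin (top_of_set A) (V i) \<and> V i \<subseteq> A \<inter> U i"
      "A \<subseteq> (\<Union>i<m. V i)" "\<And>x. x \<in> A \<Longrightarrow> card {i. i < m \<and> x \<in> V i} \<le> k"
    by (rule cover_multiplicity_leE[OF cov]) (rule that; assumption)
  define W where "W i = U i - (A - V i)" for i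
  show ?thesis
  proof
    fix i assume i: "i < m"
    have "closedin (top_of_set A) (A - V i)" using V(1)[OF i] by (simp add: closedin_diff)
    hence "closedin (top_of_set X) (A - V i)" using A closedin_trans by blast
    thus "openin (top_of_set X) (W i) \<and> W i \<subseteq> U i" unfolding W_def using U[OF i] by auto
  next
    show "X \<subseteq> (\<Union>i<m. W i)"
    proof
      fix x assume x: "x \<in> X"
      show "x \<in> (\<Union>i<m. W i)"
      proof (cases "x \<in> A")
        case True
        then obtain i where "i < m" "x \<in> V i" using V(2) by auto
        thus ?thesis using V(1)[of i] by (auto simp: W_def)
      next
        case False thus ?thesis using x XU by (auto simp: W_def)
      qed
    qed
  next
    fix x assume x: "x \<in> A"
    have "{i. i < m \<and> x \<in> W i} = {i. i < m \<and> x \<in> V i}" using x V(1) by (auto simp: W_def)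
    thus "card {i. i < m \<and> x \<in> W i} \<le> k" using V(3)[OF x] by simp
  qed
qed

text \<open>The cover is shrunk for \<open>A\<close> first and then for \<open>B\<close>; the second
  shrinking can only lower the multiplicity reached on \<open>A\<close>.\<close>

lemma cover_multiplicity_le_Un:
  assumes "closed A" "closed B" "cover_multiplicity_le A k" "cover_multiplicity_le B k"
  shows "cover_multiplicity_le (A \<union> B) k"
  unfolding cover_multiplicity_le_def
proof (intro allI impI, elim conjE)
  fix m :: nat and U
  assume U: "\<forall>i<m. openin (top_of_set (A \<union> B)) (U i)" "A \<union> B \<subseteq> (\<Union>i<m. U i)"
  have A: "closedin (top_of_set (A \<union> B)) A" and B: "closedin (top_of_set (A \<union> B)) B"
    using assms by (auto intro: closed_subset)
  obtain W where W: "\<And>i. i < m \<Longrightarrow> openin (top_of_set (A \<union> B)) (W i) \<and> W i \<subseteq> U i"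
      "A \<union> B \<subseteq> (\<Union>i<m. W i)" "\<And>x. x \<in> A \<Longrightarrow> card {i. i < m \<and> x \<in> W i} \<le> k"
    by (rule cover_shrink_on_closed_subset[OF A assms(3), of m U]) (use U in blast)+
  obtain V where V: "\<And>i. i < m \<Longrightarrow> openin (top_of_set (A \<union> B)) (V i) \<and> V i \<subseteq> W i"
      "A \<union> B \<subseteq> (\<Union>i<m. V i)" "\<And>x. x \<in> B \<Longrightarrow> card {i. i < m \<and> x \<in> V i} \<le> k"
    by (rule cover_shrink_on_closed_subset[OF B assms(4), of m W]) (use W in blast)+
  have "card {i. i < m \<and> x \<in> V i} \<le> k" if "x \<in> A" for x
  proof -
    have "{i. i < m \<and> x \<in> V i} \<subseteq> {i. i < m \<and> x \<in> W i}" using V(1) by auto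
    hence "card {i. i < m \<and> x \<in> V i} \<le> card {i. i < m \<and> x \<in> W i}" by (intro card_mono) auto
    thus ?thesis using W(3)[OF that] by simp
  qed
  thus "\<exists>V. (\<forall>i<m. openin (top_of_set (A \<union> B)) (V i) \<and> V i \<subseteq> U i) \<and> A \<union> B \<subseteq> (\<Union>i<m. V i) \<and>
      (\<forall>x\<in>A \<union> B. card {i. i < m \<and> x \<in> V i} \<le> k)"
    using V W(1) by (intro exI[of _ V]) blast
qed

lemma cover_multiplicity_le_empty: "cover_multiplicity_le {} k"
  unfolding cover_multiplicity_le_def by (intro allI impI exI[of _ "\<lambda>_. {}"]) auto

lemma cover_multiplicity_le_UN:
  assumes "finite J" "\<And>j. j \<in> J \<Longrightarrow> closed (F j)" "\<And>j. j \<in> J \<Longrightarrow> cover_multiplicity_le (F j) k"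
  shows "cover_multiplicity_le (\<Union>j\<in>J. F j) k"
  using assms
proof (induction rule: finite_induct)
  case empty thus ?case by (simp add: cover_multiplicity_le_empty)
next
  case (insert x J)
  have "cover_multiplicity_le (F x \<union> (\<Union>j\<in>J. F j)) k"
    using insert by (intro cover_multiplicity_le_Un) (auto intro: closed_UN)
  thus ?case by simp
qed

text \<open>Thickening: a point joins the \<open>i\<close>-th set when it is nearer to
  \<open>F\<close> than to \<open>F - V i\<close>. Its nearest point in the compact set
  \<open>F\<close> then lies in every \<open>V i\<close> concerned, so the multiplicity at any point
  is bounded by one attained inside \<open>F\<close>.\<close>

lemma open_neighbourhood_extension:
  fixes F :: "'b::metric_space set" and U :: "nat \<Rightarrow> 'b set"
  assumes F: "compact F" and cov: "cover_multiplicity_le F k" and FX: "F \<subseteq> X"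
    and U: "\<And>i. i < m \<Longrightarrow> openin (top_of_set X) (U i)" and FU: "F \<subseteq> (\<Union>i<m. U i)"
  obtains W where "\<And>i. i < m \<Longrightarrow> openin (top_of_set X) (W i) \<and> W i \<subseteq> U i" "F \<subseteq> (\<Union>i<m. W i)"
    "\<And>x. card {i. i < m \<and> x \<in> W i} \<le> k"
proof (cases "F = {}")
  case True
  show ?thesis by (rule that[of "\<lambda>_. {}"]) (simp_all add: True)
next
  case False
  have "\<forall>i<m. openin (top_of_set F) (F \<inter> U i)"
    using U FX by (metis openin_subtopology_Int2 openin_subtopology_Int subtopology_subtopology inf.absorb_iff2)
  moreover have "F \<subseteq> (\<Union>i<m. F \<inter> U i)" using FU by auto
  ultimately obtain V where V: "\<And>i. i < m \<Longrightarrow> openin (top_of_set F) (V i) \<and> V i \<subseteq> F \<inter> U i"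
      "F \<subseteq> (\<Union>i<m. V i)" "\<And>x. x \<in> F \<Longrightarrow> card {i. i < m \<and> x \<in> V i} \<le> k"
    by (rule cover_multiplicity_leE[OF cov]) (rule that; assumption)
  \<comment> \<open>\<open>infdist\<close> to the empty set is 0, hence the separate clause for the
    case that \<open>V i\<close> exhausts \<open>F\<close>.\<close>
  define O' where "O' i = {x. F - V i = {} \<or> infdist x F < infdist x (F - V i)}" for i
  have opO: "open (O' i)" for i
  proof (cases "F - V i = {}")
    case True thus ?thesis by (simp add: O'_def)
  next
    case False
    have "open {x. infdist x F < infdist x (F - V i)}"
      by (intro open_Collect_less continuous_intros)
    thus ?thesis using False by (simp add: O'_def)
  qed
  have near: "\<exists>y\<in>F. \<forall>i<m. x \<in> O' i \<longrightarrow> y \<in> V i" for x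
  proof -
    have "continuous_on F (dist x)" by (intro continuous_intros)
    then obtain y where y: "y \<in> F" "\<And>z. z \<in> F \<Longrightarrow> dist x y \<le> dist x z"
      using continuous_attains_inf[OF F False, of "dist x"] by auto
    have "y \<in> V i" if "x \<in> O' i" for i
    proof (rule ccontr)
      assume n: "y \<notin> V i"
      have "infdist x (F - V i) \<le> dist x y" using n y by (intro infdist_le) auto
      also have "\<dots> \<le> infdist x F"
        unfolding infdist_notempty[OF False] by (rule cINF_greatest) (use False y in auto)
      finally show False using that n y(1) by (auto simp: O'_def)
    qed
    thus ?thesis using y by blast
  qed
  have FO: "x \<in> O' i" if "i < m" "x \<in> V i" for x i
  proof (cases "F - V i = {}")
    case True thus ?thesis by (simp add: O'_def)
  next
    case False
    have xF: "x \<in> F" using V(1)[OF that(1)] that by auto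
    have "closedin (top_of_set F) (F - V i)" using V(1)[OF that(1)] by (simp add: closedin_diff)
    hence "closed (F - V i)" using F closedin_closed_trans compact_imp_closed by blast
    hence "infdist x (F - V i) > 0" using False that(2) infdist_pos_not_in_closed by fastforce
    thus ?thesis using xF by (simp add: O'_def)
  qed
  define W where "W i = U i \<inter> O' i" for i
  show ?thesis
  proof (rule that[of W])
    fix i assume "i < m" thus "openin (top_of_set X) (W i) \<and> W i \<subseteq> U i"
      unfolding W_def using U opO by (auto intro: openin_Int_open)
  next
    show "F \<subseteq> (\<Union>i<m. W i)"
    proof
      fix x assume "x \<in> F"
      then obtain i where "i < m" "x \<in> V i" using V(2) by auto
      thus "x \<in> (\<Union>i<m. W i)" using V(1)[of i] FO[of i x] unfolding W_def by auto
    qed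
  next
    fix x
    obtain y where y: "y \<in> F" "\<forall>i<m. x \<in> O' i \<longrightarrow> y \<in> V i" using near by blast
    have "card {i. i < m \<and> x \<in> W i} \<le> card {i. i < m \<and> y \<in> V i}"
      using y by (intro card_mono) (auto simp: W_def)
    thus "card {i. i < m \<and> x \<in> W i} \<le> k" using V(3)[OF y(1)] by simp
  qed
qed

text \<open>Small inductive dimension bounds covering dimension: the frontiers of a finite cover by small
  sets have smaller dimension, and off the frontiers the cover can be made disjoint.\<close>

lemma dim_le_imp_cover_multiplicity_le:
  fixes X :: "'b::metric_space set"
  assumes "top_of_set X dim_le n" "compact X"
  shows "cover_multiplicity_le X (nat (n + 1))"
proof -
  have "\<And>X :: 'b set. Y = top_of_set X \<Longrightarrow> compact X \<Longrightarrow> cover_multiplicity_le X (nat (n + 1))"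
    if "Y dim_le n" for Y
    using that
  proof (induction rule: dimension_le.induct)
    case (1 n Y)
    note IH = 1(2) and YX = 1(3) and cX = 1(4)
    show ?case
    proof (cases "X = {}")
      case True thus ?thesis by (simp add: cover_multiplicity_le_empty)
    next
      case False
      have "openin Y X" using YX by auto
      then obtain U0 where "subtopology Y (Y frontier_of U0) dim_le (n - 1)"
        using IH[of X] False by (meson ex_in_conv)
      \<comment> \<open>A dimension bound is at least -1, and the frontier has the bound
        \<open>n - 1\<close>.\<close>
      hence n0: "0 \<le> n" using dimension_le_bound by fastforce
      hence nn: "nat (n + 1) = Suc (nat n)" by simp
      show ?thesis
        unfolding cover_multiplicity_le_def nn
      proof (intro allI impI, elim conjE)
        fix m :: nat and U
        assume U: "\<forall>i<m. openin (top_of_set X) (U i)" "X \<subseteq> (\<Union>i<m. U i)"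
        define C where "C = {G. openin (top_of_set X) G \<and> (\<exists>i<m. G \<subseteq> U i) \<and>
            cover_multiplicity_le (top_of_set X frontier_of G) (nat n)}"
        have sub: "top_of_set X frontier_of G \<subseteq> X" for G
          using frontier_of_subset_topspace[of "top_of_set X" G] by simp
        have cF: "compact (top_of_set X frontier_of G)" for G
          using closedin_compact[OF cX] closedin_frontier_of by blast
        have "X \<subseteq> \<Union>C"
        proof
          fix a assume "a \<in> X"
          then obtain i where i: "i < m" "a \<in> U i" using U by auto
          have "openin Y (U i)" using U i YX by blast
          from IH[OF this i(2)] obtain G where G: "a \<in> G" "G \<subseteq> U i" "openin Y G"
              and P: "\<forall>X. subtopology Y (Y frontier_of G) = top_of_set X \<longrightarrow> compact X \<longrightarrow>
                  cover_multiplicity_le X (nat (n - 1 + 1))"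
            by (elim exE conjE)
          have "subtopology Y (Y frontier_of G) = top_of_set (top_of_set X frontier_of G)"
            unfolding YX using sub[of G] by (simp add: subtopology_subtopology Int_absorb1)
          hence "cover_multiplicity_le (top_of_set X frontier_of G) (nat n)"
            using P cF by auto
          thus "a \<in> \<Union>C" using G i YX by (auto simp: C_def)
        qed
        then obtain D where D: "D \<subseteq> C" "finite D" "X \<subseteq> \<Union>D"
        proof -
          have "\<forall>c\<in>C. openin (top_of_set X) c" by (auto simp: C_def)
          thus ?thesis using cX \<open>X \<subseteq> \<Union>C\<close> that unfolding compact_eq_openin_cover by blast
        qed
        obtain G :: "nat \<Rightarrow> 'b set" and p where G: "D = G ` {..<p}"
          using D(2) by (metis finite_imp_nat_seg_image_inj_on lessThan_def)
        have GC: "G j \<in> C" if "j < p" for j using G D(1) that by auto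
        then obtain \<iota> where \<iota>: "\<And>j. j < p \<Longrightarrow> \<iota> j < m \<and> G j \<subseteq> U (\<iota> j)"
        proof -
          have "\<forall>j. \<exists>i. j < p \<longrightarrow> i < m \<and> G j \<subseteq> U i" using GC unfolding C_def by blast
          thus ?thesis using that by metis
        qed
        have Gop: "openin (top_of_set X) (G j)" if "j < p" for j using GC[OF that] by (simp add: C_def)
        \<comment> \<open>These sets are open and pairwise disjoint, and what they miss of
          \<open>X\<close> lies on the frontiers of the \<open>G j\<close>.\<close>
        define H where "H j = G j - (\<Union>j'<j. top_of_set X closure_of G j')" for j
        have Hop: "openin (top_of_set X) (H j)" if "j < p" for j
          unfolding H_def by (rule openin_diff[OF Gop[OF that]]) (auto intro: closedin_Union)
        define F where "F = (\<Union>j<p. top_of_set X frontier_of G j)"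
        have FX: "F \<subseteq> X" using sub by (auto simp: F_def)
        have "compact F" unfolding F_def using cF by (intro compact_UN) auto
        moreover have "cover_multiplicity_le F (nat n)" unfolding F_def
          using GC cF by (intro cover_multiplicity_le_UN) (auto simp: C_def compact_imp_closed)
        ultimately obtain W where W: "\<And>i. i < m \<Longrightarrow> openin (top_of_set X) (W i) \<and> W i \<subseteq> U i"
            "F \<subseteq> (\<Union>i<m. W i)" "\<And>x. card {i. i < m \<and> x \<in> W i} \<le> nat n"
          by (rule open_neighbourhood_extension[of F "nat n" X m U]) (use FX U in blast)+
        have disj: "j = j'" if "x \<in> H j" "x \<in> H j'" "j < p" "j' < p" for x j j'
        proof -
          have "x \<in> top_of_set X closure_of G j" if "x \<in> H j" "j < p" for j
            using that closure_of_subset[of "G j" "top_of_set X"] Gop[of j] openin_subset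
            by (fastforce simp: H_def)
          thus ?thesis using that unfolding H_def by (metis Diff_iff UN_I lessThan_iff linorder_cases)
        qed
        \<comment> \<open>The thickened cover of the frontiers contributes multiplicity at most
          \<open>nat n\<close>, and the disjoint sets \<open>H j\<close> add at most one
          more.\<close>
        define V where "V i = W i \<union> (\<Union>j\<in>{j. j < p \<and> \<iota> j = i}. H j)" for i
        have 1: "openin (top_of_set X) (V i) \<and> V i \<subseteq> U i" if "i < m" for i
        proof
          show "openin (top_of_set X) (V i)" unfolding V_def
            using W(1)[OF that] Hop by (intro openin_Un openin_Union) auto
          show "V i \<subseteq> U i" unfolding V_def using W(1)[OF that] \<iota> by (auto simp: H_def)
        qed
        have 2: "X \<subseteq> (\<Union>i<m. V i)"
        proof
          fix x assume x: "x \<in> X"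
          then obtain j0 where j0: "j0 < p" "x \<in> G j0" using D(3) G by auto
          hence "x \<in> top_of_set X closure_of G j0"
            using closure_of_subset[of "G j0" "top_of_set X"] Gop[of j0] openin_subset by fastforce
          hence ex: "\<exists>j. j < p \<and> x \<in> top_of_set X closure_of G j" using j0 by blast
          define j where "j = (LEAST j. j < p \<and> x \<in> top_of_set X closure_of G j)"
          have j: "j < p" "x \<in> top_of_set X closure_of G j"
            using LeastI_ex[OF ex] by (auto simp: j_def)
          have jl: "x \<notin> top_of_set X closure_of G j'" if "j' < j" for j'
            using not_less_Least[of j' "\<lambda>j. j < p \<and> x \<in> top_of_set X closure_of G j"] that j(1)
            by (auto simp: j_def)
          show "x \<in> (\<Union>i<m. V i)"
          proof (cases "x \<in> G j")
            case True
            hence "x \<in> H j" using jl by (auto simp: H_def)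
            hence "x \<in> V (\<iota> j)" using j by (auto simp: V_def)
            thus ?thesis using \<iota>[OF j(1)] by auto
          next
            case False
            hence "x \<in> top_of_set X frontier_of G j"
              using j Gop[OF j(1)] by (simp add: frontier_of_def interior_of_openin)
            hence "x \<in> F" using j by (auto simp: F_def)
            thus ?thesis using W(2) by (auto simp: V_def)
          qed
        qed
        have 3: "card {i. i < m \<and> x \<in> V i} \<le> Suc (nat n)" for x
        proof (cases "\<exists>j<p. x \<in> H j")
          case True
          then obtain j where j: "j < p" "x \<in> H j" by blast
          have "{i. i < m \<and> x \<in> V i} \<subseteq> insert (\<iota> j) {i. i < m \<and> x \<in> W i}"
            using disj j by (auto simp: V_def)
          hence "card {i. i < m \<and> x \<in> V i} \<le> card (insert (\<iota> j) {i. i < m \<and> x \<in> W i})"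
            by (intro card_mono) auto
          also have "\<dots> \<le> Suc (card {i. i < m \<and> x \<in> W i})" by (simp add: card_insert_if)
          finally show ?thesis using W(3)[of x] by simp
        next
          case False
          hence "{i. i < m \<and> x \<in> V i} = {i. i < m \<and> x \<in> W i}" by (auto simp: V_def)
          thus ?thesis using W(3)[of x] by simp
        qed
        show "\<exists>V. (\<forall>i<m. openin (top_of_set X) (V i) \<and> V i \<subseteq> U i) \<and> X \<subseteq> (\<Union>i<m. V i) \<and>
            (\<forall>x\<in>X. card {i. i < m \<and> x \<in> V i} \<le> Suc (nat n))"
          using 1 2 3 by (intro exI[of _ V]) blast
      qed
    qed
  qed
  thus ?thesis using assms by blast
qed

section \<open>Brouwer's theorem and the dimension of simplices\<close>

lemma tendsto_fun_iff:
  fixes X :: "'c \<Rightarrow> 'i \<Rightarrow> 'b::topological_space"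
  shows "(X \<longlongrightarrow> x) F \<longleftrightarrow> (\<forall>i. ((\<lambda>n. X n i) \<longlongrightarrow> x i) F)"
proof -
  have "(X \<longlongrightarrow> x) F \<longleftrightarrow> limitin (product_topology (\<lambda>i. euclidean) UNIV) X x F"
    by (simp add: limitin_canonical_iff euclidean_product_topology)
  also have "\<dots> \<longleftrightarrow> (\<forall>i. ((\<lambda>n. X n i) \<longlongrightarrow> x i) F)"
    by (simp add: limitin_componentwise limitin_canonical_iff)
  finally show ?thesis .
qed

lemma continuous_on_coordinate [continuous_intros]:
  fixes A :: "('i \<Rightarrow> 'b::topological_space) set"
  shows "continuous_on A (\<lambda>x. x i)"
  by (rule continuous_on_subset[OF continuous_on_product_coordinates]) simp

text \<open>Points are sequences that vanish from index \<open>n\<close> on, which lets cubes,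
  simplices and cones of all dimensions share one type.\<close>

definition unit_cube_of :: "nat \<Rightarrow> (nat \<Rightarrow> real) set" where
  "unit_cube_of n = {x. (\<forall>i<n. 0 \<le> x i \<and> x i \<le> 1) \<and> (\<forall>i\<ge>n. x i = 0)}"

lemma compact_unit_cube_of: "compact (unit_cube_of n)"
proof -
  have eq: "unit_cube_of n = Pi\<^sub>E UNIV (\<lambda>i. if i < n then {0..1} else {0})"
    by (auto simp: unit_cube_of_def PiE_iff split: if_splits)
  have "compactin (product_topology (\<lambda>i. euclidean) UNIV) (unit_cube_of n)"
    unfolding eq compactin_PiE by auto
  thus ?thesis by (simp add: euclidean_product_topology)
qed

text \<open>Kuhn's lemma on the grid of mesh \<open>1 / p\<close> gives, for each coordinate, two
  points within \<open>1 / p\<close> of a common point such that \<open>f\<close> does not decrease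
  the coordinate at one and does not increase it at the other. A limit of these common points is
  fixed.\<close>

lemma brouwer_unit_cube_of:
  assumes f: "continuous_on (unit_cube_of n) f" and fC: "f ` unit_cube_of n \<subseteq> unit_cube_of n"
  shows "\<exists>x\<in>unit_cube_of n. f x = x"
proof -
  let ?C = "unit_cube_of n"
  define pt where "pt p q = (\<lambda>i. if i < n then real (q i) / real p else 0)" for p :: nat and q :: "nat \<Rightarrow> nat"
  have ptC: "pt p q \<in> ?C" if "p > 0" "\<forall>i<n. q i \<le> p" for p q
    using that by (auto simp: unit_cube_of_def pt_def)
  \<comment> \<open>Label 0 means that \<open>f\<close> does not decrease the coordinate. The clause
    \<open>q i \<noteq> p\<close> forces label 1 on the top face, as Kuhn's lemma demands; on the
    bottom face label 0 is automatic.\<close>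
  define label where "label p q i = (if f (pt p q) i \<ge> pt p q i \<and> q i \<noteq> p then 0 else 1::nat)" for p q i
  have "\<exists>x\<in>?C. \<forall>i<n. \<exists>r\<in>?C. \<exists>s\<in>?C. (\<forall>j. \<bar>r j - x j\<bar> \<le> 1 / real p \<and> \<bar>s j - x j\<bar> \<le> 1 / real p) \<and>
      f r i \<ge> r i \<and> f s i \<le> s i" if p: "p > 0" for p
  proof -
    have fge: "f (pt p q) i \<ge> 0" "f (pt p q) i \<le> 1" if "\<forall>i<n. q i \<le> p" "i < n" for q i
    proof -
      have "f (pt p q) \<in> ?C" using fC ptC[OF p that(1)] by blast
      thus "f (pt p q) i \<ge> 0" "f (pt p q) i \<le> 1" using that(2) by (auto simp: unit_cube_of_def)
    qed
    obtain q where q: "\<forall>i<n. q i < p" and rs: "\<forall>i<n. \<exists>r s. (\<forall>j<n. q j \<le> r j \<and> r j \<le> q j + 1) \<and>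
        (\<forall>j<n. q j \<le> s j \<and> s j \<le> q j + 1) \<and> label p r i \<noteq> label p s i"
    proof (rule kuhn_lemma[of p n "label p"])
      show "0 < p" by (rule p)
    next
      show "\<forall>x. (\<forall>i<n. x i \<le> p) \<longrightarrow> (\<forall>i<n. label p x i = 0 \<or> label p x i = 1)"
        by (auto simp: label_def)
    next
      show "\<forall>x. (\<forall>i<n. x i \<le> p) \<longrightarrow> (\<forall>i<n. x i = 0 \<longrightarrow> label p x i = 0)"
        using fge(1) p by (auto simp: label_def pt_def)
    next
      show "\<forall>x. (\<forall>i<n. x i \<le> p) \<longrightarrow> (\<forall>i<n. x i = p \<longrightarrow> label p x i = 1)"
        by (auto simp: label_def)
    qed (use that in blast)
    have near: "\<bar>pt p r j - pt p q j\<bar> \<le> 1 / real p" if "\<forall>j<n. q j \<le> r j \<and> r j \<le> q j + 1" for r j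
    proof (cases "j < n")
      case True
      have "pt p r j - pt p q j = (real (r j) - real (q j)) / real p"
        using True by (simp add: pt_def diff_divide_distrib)
      moreover have "0 \<le> real (r j) - real (q j)" "real (r j) - real (q j) \<le> 1" using that True by auto
      ultimately show ?thesis using p by (auto simp: divide_right_mono)
    next
      case False thus ?thesis by (simp add: pt_def)
    qed
    have lab: "\<exists>r\<in>?C. \<exists>s\<in>?C. (\<forall>j. \<bar>r j - pt p q j\<bar> \<le> 1 / real p \<and> \<bar>s j - pt p q j\<bar> \<le> 1 / real p) \<and>
      f r i \<ge> r i \<and> f s i \<le> s i"
      if i: "i < n" and r: "\<forall>j<n. q j \<le> r j \<and> r j \<le> q j + 1"
        and s: "\<forall>j<n. q j \<le> s j \<and> s j \<le> q j + 1" and l: "label p r i = 0" "label p s i \<noteq> 0" for r s i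
    proof -
      have r': "\<forall>j<n. r j \<le> p" and s': "\<forall>j<n. s j \<le> p" using r s q by (metis Suc_eq_plus1 Suc_leI order_trans)+
      have "f (pt p r) i \<ge> pt p r i" using l by (auto simp: label_def split: if_splits)
      moreover have "f (pt p s) i \<le> pt p s i"
      proof (cases "s i = p")
        case True
        hence "pt p s i = 1" using i p by (simp add: pt_def)
        thus ?thesis using fge(2)[OF s' i] by simp
      next
        case False thus ?thesis using l by (auto simp: label_def split: if_splits)
      qed
      ultimately show ?thesis using ptC[OF p r'] ptC[OF p s'] near[OF r] near[OF s] by blast
    qed
    have "\<exists>r\<in>?C. \<exists>s\<in>?C. (\<forall>j. \<bar>r j - pt p q j\<bar> \<le> 1 / real p \<and> \<bar>s j - pt p q j\<bar> \<le> 1 / real p) \<and>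
      f r i \<ge> r i \<and> f s i \<le> s i" if i: "i < n" for i
    proof -
      obtain r s where rs: "\<forall>j<n. q j \<le> r j \<and> r j \<le> q j + 1" "\<forall>j<n. q j \<le> s j \<and> s j \<le> q j + 1"
          "label p r i \<noteq> label p s i" using rs i by blast
      show ?thesis
      proof (cases "label p r i = 0")
        case True thus ?thesis using lab[OF i rs(1,2)] rs(3) by simp
      next
        case False
        hence "label p s i = 0" using rs(3) by (auto simp: label_def split: if_splits)
        thus ?thesis using lab[OF i rs(2,1)] False by simp
      qed
    qed
    moreover have "pt p q \<in> ?C" using ptC[OF p] q by (simp add: less_imp_le)
    ultimately show ?thesis by blast
  qed
  hence "\<forall>p. \<exists>x\<in>?C. \<forall>i<n. \<exists>r\<in>?C. \<exists>s\<in>?C. (\<forall>j. \<bar>r j - x j\<bar> \<le> 1 / real (Suc p) \<and> \<bar>s j - x j\<bar> \<le> 1 / real (Suc p)) \<and>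
      f r i \<ge> r i \<and> f s i \<le> s i" by blast
  then obtain X where X: "\<And>p. X p \<in> ?C" and XX: "\<And>p. \<forall>i<n. \<exists>r\<in>?C. \<exists>s\<in>?C.
      (\<forall>j. \<bar>r j - X p j\<bar> \<le> 1 / real (Suc p) \<and> \<bar>s j - X p j\<bar> \<le> 1 / real (Suc p)) \<and> f r i \<ge> r i \<and> f s i \<le> s i"
    by metis
  obtain x \<sigma> where x: "x \<in> ?C" and \<sigma>: "strict_mono (\<sigma> :: nat \<Rightarrow> nat)" and lim: "(X \<circ> \<sigma>) \<longlonglongrightarrow> x"
    using compact_unit_cube_of[of n, unfolded compact_def] X by metis
  have inv0: "(\<lambda>p. 1 / real (Suc (\<sigma> p))) \<longlonglongrightarrow> 0"
    using LIMSEQ_subseq_LIMSEQ[OF LIMSEQ_inverse_real_of_nat \<sigma>] by (simp add: o_def inverse_eq_divide)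
  have limj: "(\<lambda>p. X (\<sigma> p) j) \<longlonglongrightarrow> x j" for j
    using lim unfolding tendsto_fun_iff by (simp add: o_def)
  have conv: "(\<lambda>p. R p j) \<longlonglongrightarrow> x j \<and> (\<lambda>p. f (R p) j) \<longlonglongrightarrow> f x j"
    if R: "\<And>p. R p \<in> ?C" "\<And>p j. \<bar>R p j - X (\<sigma> p) j\<bar> \<le> 1 / real (Suc (\<sigma> p))" for R :: "nat \<Rightarrow> nat \<Rightarrow> real" and j
  proof -
    have Rj: "(\<lambda>p. R p j) \<longlonglongrightarrow> x j" for j
    proof -
      have "(\<lambda>p. R p j - X (\<sigma> p) j) \<longlonglongrightarrow> 0"
        by (rule Lim_null_comparison[OF _ inv0]) (use R(2) in auto)
      from tendsto_add[OF this limj[of j]] show ?thesis by simp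
    qed
    hence "R \<longlonglongrightarrow> x" unfolding tendsto_fun_iff by blast
    hence "(\<lambda>p. f (R p)) \<longlonglongrightarrow> f x"
      using f x R(1) unfolding continuous_on_sequentially by (auto simp: o_def)
    thus ?thesis using Rj unfolding tendsto_fun_iff by blast
  qed
  have "f x i = x i" for i
  proof (cases "i < n")
    case False
    have "f x \<in> ?C" using fC x by blast
    thus ?thesis using False x by (auto simp: unit_cube_of_def)
  next
    case True
    hence "\<forall>p. \<exists>r s. r \<in> ?C \<and> s \<in> ?C \<and>
      (\<forall>j. \<bar>r j - X (\<sigma> p) j\<bar> \<le> 1 / real (Suc (\<sigma> p)) \<and> \<bar>s j - X (\<sigma> p) j\<bar> \<le> 1 / real (Suc (\<sigma> p))) \<and> f r i \<ge> r i \<and> f s i \<le> s i"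
      using XX by blast
    then obtain R S where RS: "\<And>p. R p \<in> ?C" "\<And>p. S p \<in> ?C"
      "\<And>p j. \<bar>R p j - X (\<sigma> p) j\<bar> \<le> 1 / real (Suc (\<sigma> p))" "\<And>p j. \<bar>S p j - X (\<sigma> p) j\<bar> \<le> 1 / real (Suc (\<sigma> p))"
      "\<And>p. f (R p) i \<ge> R p i" "\<And>p. f (S p) i \<le> S p i" by metis
    have "x i \<le> f x i" using conv[OF RS(1,3), of i] RS(5) by (meson LIMSEQ_le)
    moreover have "f x i \<le> x i" using conv[OF RS(2,4), of i] RS(6) by (meson LIMSEQ_le)
    ultimately show ?thesis by simp
  qed
  thus ?thesis using x by blast
qed

definition std_simplex :: "nat \<Rightarrow> (nat \<Rightarrow> real) set" where
  "std_simplex r = {x. (\<forall>i. 0 \<le> x i) \<and> (\<forall>i\<ge>r. x i = 0) \<and> (\<Sum>i<r. x i) = 1}"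

lemma std_simplex_subset_cube: "std_simplex r \<subseteq> unit_cube_of r"
proof
  fix x assume x: "x \<in> std_simplex r"
  have "x i \<le> 1" if "i < r" for i
  proof -
    have "x i \<le> (\<Sum>i<r. x i)" using x that by (intro member_le_sum) (auto simp: std_simplex_def)
    thus ?thesis using x by (simp add: std_simplex_def)
  qed
  thus "x \<in> unit_cube_of r" using x by (auto simp: std_simplex_def unit_cube_of_def)
qed

lemma compact_std_simplex: "compact (std_simplex r)"
proof -
  have "std_simplex r = unit_cube_of r \<inter> {x. (\<Sum>i<r. x i) = 1}"
    using std_simplex_subset_cube[of r]
    by (auto simp: std_simplex_def unit_cube_of_def) (metis not_less order_refl)
  moreover have "closed {x :: nat \<Rightarrow> real. (\<Sum>i<r. x i) = 1}"
    by (intro closed_Collect_eq continuous_intros continuous_on_coordinate)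
  ultimately show ?thesis using compact_unit_cube_of compact_Int_closed by metis
qed

text \<open>The simplex is a retract of the cube. A fixed point of \<open>T\<close> composed with
  the retraction lies in the simplex and is therefore fixed by \<open>T\<close>.\<close>

lemma brouwer_std_simplex:
  assumes r: "r > 0" and T: "continuous_on (std_simplex r) T" and TS: "T ` std_simplex r \<subseteq> std_simplex r"
  shows "\<exists>x\<in>std_simplex r. T x = x"
proof -
  define s where "s x = (\<Sum>i<r. x i)" for x :: "nat \<Rightarrow> real"
  \<comment> \<open>If the coordinates sum to less than 1, the deficit is spread evenly; if they sum
    to more, they are rescaled. On the simplex nothing changes.\<close>
  define \<rho> where "\<rho> x = (\<lambda>i. if i < r then (x i + max 0 (1 - s x) / real r) / max 1 (s x) else 0)" for x :: "nat \<Rightarrow> real"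
  have cs: "continuous_on A s" for A unfolding s_def
    by (intro continuous_intros continuous_on_coordinate)
  have c\<rho>: "continuous_on A \<rho>" for A
  proof (rule continuous_on_coordinatewise_then_product)
    fix i show "continuous_on A (\<lambda>x. \<rho> x i)"
    proof (cases "i < r")
      case True
      have "continuous_on A (\<lambda>x. (x i + max 0 (1 - s x) / real r) / max 1 (s x))"
        by (intro continuous_intros cs continuous_on_coordinate) (use r in auto)
      thus ?thesis using True by (simp add: \<rho>_def)
    next
      case False thus ?thesis by (simp add: \<rho>_def)
    qed
  qed
  have \<rho>S: "\<rho> x \<in> std_simplex r" if "x \<in> unit_cube_of r" for x
  proof -
    have "(\<Sum>i<r. \<rho> x i) = (\<Sum>i<r. x i + max 0 (1 - s x) / real r) / max 1 (s x)"
      by (simp add: \<rho>_def sum_divide_distrib)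
    also have "\<dots> = (s x + max 0 (1 - s x)) / max 1 (s x)" using r by (simp add: sum.distrib s_def)
    also have "\<dots> = 1" by (auto simp: max_def)
    finally show ?thesis using that by (auto simp: std_simplex_def \<rho>_def unit_cube_of_def)
  qed
  have \<rho>id: "\<rho> x = x" if "x \<in> std_simplex r" for x
    using that by (auto simp: \<rho>_def std_simplex_def s_def fun_eq_iff)
  have "continuous_on (unit_cube_of r) (T \<circ> \<rho>)"
    using \<rho>S by (intro continuous_on_compose c\<rho> continuous_on_subset[OF T]) auto
  moreover have "(T \<circ> \<rho>) ` unit_cube_of r \<subseteq> unit_cube_of r"
    using \<rho>S TS std_simplex_subset_cube[of r] by fastforce
  ultimately have "\<exists>x\<in>unit_cube_of r. (T \<circ> \<rho>) x = x" by (rule brouwer_unit_cube_of)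
  then obtain x where x: "x \<in> unit_cube_of r" "T (\<rho> x) = x" unfolding o_def by blast
  have "T (\<rho> x) \<in> std_simplex r" using \<rho>S[OF x(1)] TS by blast
  hence xS: "x \<in> std_simplex r" unfolding x(2) .
  have "T x = x" using x(2) unfolding \<rho>id[OF xS] .
  thus ?thesis using xS by blast
qed

text \<open>A cover by sets missing the opposite facets and of multiplicity below \<open>r\<close> would yield, by a
  partition of unity, a self-map \<open>f\<close> of the simplex that preserves every facet and maps into the boundary.
  Then \<open>f\<close> followed by the cyclic shift of the coordinates has no fixed point.\<close>

lemma std_simplex_not_cover_multiplicity_le:
  assumes "k < r"
  shows "\<not> cover_multiplicity_le (std_simplex r) k"
proof
  assume cov: "cover_multiplicity_le (std_simplex r) k"
  let ?S = "std_simplex r"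
  have r: "r > 0" using assms by simp
  define U where "U i = ?S \<inter> {x. x i > 0}" for i
  have "\<forall>i<r. openin (top_of_set ?S) (U i)"
    unfolding U_def by (auto intro!: openin_open_Int open_Collect_less continuous_intros continuous_on_coordinate)
  moreover have "?S \<subseteq> (\<Union>i<r. U i)"
  proof
    fix x assume x: "x \<in> ?S"
    hence "(\<Sum>i<r. x i) \<noteq> 0" by (simp add: std_simplex_def)
    then obtain i where "i < r" "x i \<noteq> 0" by (metis lessThan_iff sum.neutral)
    thus "x \<in> (\<Union>i<r. U i)" using x by (force simp: U_def std_simplex_def less_le)
  qed
  ultimately obtain V where V: "\<And>i. i < r \<Longrightarrow> openin (top_of_set ?S) (V i) \<and> V i \<subseteq> U i"
      "?S \<subseteq> (\<Union>i<r. V i)" "\<And>x. x \<in> ?S \<Longrightarrow> card {i. i < r \<and> x \<in> V i} \<le> k"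
    by (rule cover_multiplicity_leE[OF cov]) (rule that; assumption)
  have miss: "\<exists>i<r. x \<notin> V i" if "x \<in> ?S" for x
  proof (rule ccontr)
    assume "\<not> ?thesis"
    hence "{i. i < r \<and> x \<in> V i} = {..<r}" by auto
    thus False using V(3)[OF that] assms by simp
  qed
  define e where "e j = (\<lambda>i. if i = j then 1 else 0::real)" for j :: nat
  have eS: "e j \<in> ?S" if "j < r" for j using that by (auto simp: std_simplex_def e_def)
  have ne: "?S - V i \<noteq> {}" if i: "i < r" for i
  proof (cases "r = 1")
    case True
    thus ?thesis using miss[OF eS[OF r]] eS[OF r] i by auto
  next
    case False
    obtain j where j: "j < r" "j \<noteq> i" using False r by (metis less_one linorder_neqE_nat not_less_eq One_nat_def gr0_conv_Suc zero_less_Suc)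
    have "e j i = 0" using j by (simp add: e_def)
    hence "e j \<notin> V i" using V(1)[OF i] by (auto simp: U_def)
    thus ?thesis using eS[OF j(1)] by blast
  qed
  have cl: "closed (?S - V i)" if "i < r" for i
  proof -
    have "closedin (top_of_set ?S) (?S - V i)" using V(1)[OF that] by (simp add: closedin_diff)
    thus ?thesis using compact_std_simplex closedin_closed_trans compact_imp_closed by blast
  qed
  define \<phi> where "\<phi> i x = infdist x (?S - V i)" for i x
  have \<phi>0: "\<phi> i x \<ge> 0" for i x by (simp add: \<phi>_def infdist_nonneg)
  have \<phi>pos: "\<phi> i x > 0 \<longleftrightarrow> x \<in> V i" if "i < r" "x \<in> ?S" for i x
    using infdist_pos_not_in_closed[OF cl[OF that(1)] ne[OF that(1)], of x] that(2)
    by (cases "x \<in> V i") (auto simp: \<phi>_def)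
  define s where "s x = (\<Sum>i<r. \<phi> i x)" for x
  have spos: "s x > 0" if "x \<in> ?S" for x
  proof -
    obtain i where "i < r" "x \<in> V i" using V(2) \<open>x \<in> ?S\<close> by auto
    hence "0 < \<phi> i x" using \<phi>pos that by simp
    also have "\<phi> i x \<le> s x" unfolding s_def using \<open>i < r\<close> \<phi>0 by (intro member_le_sum) auto
    finally show ?thesis .
  qed
  define sh where "sh i = (if Suc i = r then 0 else Suc i)" for i
  have sh: "bij_betw sh {..<r} {..<r}"
    by (rule bij_betw_byWitness[where f' = "\<lambda>j. if j = 0 then r - 1 else j - 1"])
      (use r in \<open>auto simp: sh_def\<close>)
  \<comment> \<open>Normalised distances form a partition of unity subordinate to the
    \<open>V i\<close>; coordinate \<open>i\<close> receives the weight of the cyclically next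
    index.\<close>
  define T where "T x = (\<lambda>i. if i < r then \<phi> (sh i) x / s x else 0)" for x
  have "continuous_on ?S T"
  proof (rule continuous_on_coordinatewise_then_product)
    fix i show "continuous_on ?S (\<lambda>x. T x i)"
      unfolding T_def s_def \<phi>_def
      by (cases "i < r"; simp; intro continuous_intros; use spos in \<open>force simp: s_def \<phi>_def\<close>)
  qed
  moreover have "T ` ?S \<subseteq> ?S"
  proof clarify
    fix x assume x: "x \<in> ?S"
    have "(\<Sum>i<r. T x i) = (\<Sum>i<r. \<phi> (sh i) x) / s x" by (simp add: T_def sum_divide_distrib)
    also have "(\<Sum>i<r. \<phi> (sh i) x) = s x" unfolding s_def by (rule sum.reindex_bij_betw[OF sh])
    finally show "T x \<in> ?S" using spos[OF x] \<phi>0 by (auto simp: std_simplex_def T_def less_imp_le)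
  qed
  ultimately obtain x where x: "x \<in> ?S" "T x = x" using brouwer_std_simplex[OF r] by blast
  have zero: "x i = 0 \<longleftrightarrow> x \<notin> V (sh i)" if "i < r" for i
  proof -
    have shi: "sh i < r" using that r by (auto simp: sh_def)
    have "x i = \<phi> (sh i) x / s x" using fun_cong[OF x(2), of i] that by (simp add: T_def)
    thus ?thesis using \<phi>pos[OF shi x(1)] spos[OF x(1)] \<phi>0[of "sh i" x] by auto
  qed
  \<comment> \<open>If coordinate \<open>sh j\<close> of the fixed point vanishes, the point lies
    outside \<open>V (sh j)\<close>, so the weight stored in coordinate \<open>j\<close> vanishes
    too. Running round the cycle kills every coordinate, against the sum 1.\<close>
  have step: "x j = 0" if "j < r" "x (sh j) = 0" for j
  proof -
    have "sh j < r" using that r by (auto simp: sh_def)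
    hence "x \<notin> V (sh j)" using V(1)[of "sh j"] that(2) by (auto simp: U_def)
    thus ?thesis using zero that by blast
  qed
  obtain i0 where i0: "i0 < r" "x \<notin> V i0" using miss[OF x(1)] by blast
  hence xi0: "\<exists>i<r. x i = 0"
    using zero sh unfolding bij_betw_def by (metis imageE lessThan_iff)
  then obtain i1 where i1: "i1 < r" "x i1 = 0" by blast
  have down: "x (i - d) = 0" if "i < r" "x i = 0" for i d
  proof (induction d)
    case (Suc d)
    show ?case
    proof (cases "i - d = 0")
      case False
      have "sh (i - Suc d) = i - d" using False that by (auto simp: sh_def)
      thus ?thesis using step[of "i - Suc d"] Suc that by simp
    qed (use Suc in auto)
  qed (use that in auto)
  have "x 0 = 0" using down[OF i1, of i1] by simp
  hence "x (r - 1) = 0" using step[of "r - 1"] r by (auto simp: sh_def)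
  hence "x i = 0" if "i < r" for i using down[of "r - 1" "r - 1 - i"] that by simp
  hence "(\<Sum>i<r. x i) = 0" by simp
  thus False using x(1) by (simp add: std_simplex_def)
qed

section \<open>Dimension of finite unions of flats\<close>

text \<open>A basic open set of the product restricts finitely many coordinates, so one index bound
  and the least of finitely many radii suffice.\<close>

lemma open_fun_box:
  fixes T :: "(nat \<Rightarrow> real) set"
  assumes "open T" "a \<in> T"
  obtains N \<epsilon> where "\<epsilon> > 0" "\<And>y. (\<forall>j<N. \<bar>y j - a j\<bar> < \<epsilon>) \<Longrightarrow> y \<in> T"
proof -
  have op: "openin (product_topology (\<lambda>i::nat. euclidean :: real topology) UNIV) T"
    using assms(1) unfolding open_fun_def .
  define P where "P X \<longleftrightarrow> a \<in> Pi\<^sub>E UNIV X \<and> (\<forall>i. openin euclidean (X i)) \<and>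
    finite {i. X i \<noteq> topspace euclidean} \<and> Pi\<^sub>E UNIV X \<subseteq> T" for X :: "nat \<Rightarrow> real set"
  have ex: "\<exists>X. P X" unfolding P_def
    by (rule product_topology_open_contains_basis[where T = "\<lambda>i::nat. euclidean :: real topology", OF op assms(2)])
  then obtain X where X': "P X" by blast
  have X: "a \<in> Pi\<^sub>E UNIV X" "\<And>i. open (X i)" "finite {i. X i \<noteq> UNIV}" "Pi\<^sub>E UNIV X \<subseteq> T"
    using X' unfolding P_def by simp_all
  have "\<exists>e>0. ball (a i) e \<subseteq> X i" for i
  proof -
    have "a i \<in> X i" using X(1) by (simp add: PiE_iff)
    thus ?thesis by (rule openE[OF X(2)[of i]]) blast
  qed
  then obtain e where e: "\<And>i. e i > 0" "\<And>i. ball (a i) (e i) \<subseteq> X i" by metis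
  define J where "J = {i. X i \<noteq> UNIV}"
  obtain N where N: "\<And>i. i \<in> J \<Longrightarrow> i < N"
    using X(3) unfolding J_def[symmetric] finite_nat_set_iff_bounded by blast
  define \<epsilon> where "\<epsilon> = Min (insert 1 (e ` J))"
  have fin: "finite (insert 1 (e ` J))" using X(3) by (simp add: J_def)
  show ?thesis
  proof
    show "\<epsilon> > 0" unfolding \<epsilon>_def using fin e(1) by (subst Min_gr_iff) auto
    fix y assume y: "\<forall>j<N. \<bar>y j - a j\<bar> < \<epsilon>"
    have "y i \<in> X i" for i
    proof (cases "i \<in> J")
      case True
      have "\<epsilon> \<le> e i" unfolding \<epsilon>_def using fin True by (intro Min_le) auto
      hence "\<bar>y i - a i\<bar> < e i" using y N[OF True] by force
      hence "y i \<in> ball (a i) (e i)" by (simp add: dist_real_def abs_minus_commute)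
      thus ?thesis using e(2) by blast
    next
      case False thus ?thesis by (simp add: J_def)
    qed
    thus "y \<in> T" using X(4) by (auto simp: PiE_iff)
  qed
qed

text \<open>\<open>F\<close> lies in an affine flat of dimension at most \<open>card I\<close>. Only
  this inclusion is recorded, so the property passes to arbitrary subsets.\<close>

definition affine_coords :: "(nat \<Rightarrow> real) set \<Rightarrow> nat set \<Rightarrow> (nat \<Rightarrow> real) \<Rightarrow> (nat \<Rightarrow> nat \<Rightarrow> real) \<Rightarrow> bool" where
  "affine_coords F I c M \<longleftrightarrow> finite I \<and> (\<forall>x\<in>F. \<forall>j. x j = c j + (\<Sum>i\<in>I. M j i * x i))"

text \<open>A coordinate \<open>i\<close> with \<open>e i \<noteq> 0\<close> is solved from
  \<open>\<phi> x = t\<close> and eliminated. If there is none, \<open>\<phi>\<close> is constantly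
  \<open>\<kappa>\<close>, and \<open>t \<noteq> \<kappa>\<close> makes the cut empty.\<close>

lemma affine_coords_cut:
  assumes F: "affine_coords F I c M" and \<phi>: "\<And>x. x \<in> F \<Longrightarrow> \<phi> x = \<kappa> + (\<Sum>i\<in>I. e i * x i)" and t: "t \<noteq> \<kappa>"
  shows "{x\<in>F. \<phi> x = t} = {} \<or> (\<exists>I' c' M'. card I' < card I \<and> affine_coords {x\<in>F. \<phi> x = t} I' c' M')"
proof (cases "\<exists>i\<in>I. e i \<noteq> 0")
  case False
  hence "\<phi> x = \<kappa>" if "x \<in> F" for x using \<phi>[OF that] by simp
  thus ?thesis using t by auto
next
  case True
  then obtain i where i: "i \<in> I" "e i \<noteq> 0" by blast
  have fin: "finite I" using F by (simp add: affine_coords_def)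
  define I' where "I' = I - {i}"
  define c' where "c' j = c j + M j i * ((t - \<kappa>) / e i)" for j
  define M' where "M' j k = M j k - M j i * (e k / e i)" for j k
  have "x j = c' j + (\<Sum>k\<in>I'. M' j k * x k)" if x: "x \<in> F" "\<phi> x = t" for x j
  proof -
    have "t = \<kappa> + (e i * x i + (\<Sum>k\<in>I'. e k * x k))"
      using \<phi>[OF x(1)] x(2) sum.remove[OF fin i(1), of "\<lambda>k. e k * x k"] by (simp add: I'_def)
    hence xi: "x i = (t - \<kappa>) / e i - (\<Sum>k\<in>I'. e k * x k) / e i" using i by (simp add: field_simps)
    have "x j = c j + (\<Sum>k\<in>I. M j k * x k)" using F x(1) unfolding affine_coords_def by blast
    also have "\<dots> = c j + (M j i * x i + (\<Sum>k\<in>I'. M j k * x k))"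
      using sum.remove[OF fin i(1), of "\<lambda>k. M j k * x k"] by (simp add: I'_def)
    also have "\<dots> = c' j + ((\<Sum>k\<in>I'. M j k * x k) - M j i * ((\<Sum>k\<in>I'. e k * x k) / e i))"
      unfolding xi c'_def by (simp add: algebra_simps)
    also have "M j i * ((\<Sum>k\<in>I'. e k * x k) / e i) = (\<Sum>k\<in>I'. M j i * (e k / e i) * x k)"
      by (simp add: sum_divide_distrib sum_distrib_left mult.assoc)
    also have "(\<Sum>k\<in>I'. M j k * x k) - \<dots> = (\<Sum>k\<in>I'. M' j k * x k)"
      by (simp add: M'_def sum_subtractf left_diff_distrib)
    finally show ?thesis .
  qed
  hence "affine_coords {x\<in>F. \<phi> x = t} I' c' M'" using fin by (auto simp: affine_coords_def I'_def)
  moreover have "card I' < card I" unfolding I'_def using i fin by (metis card_Diff1_less)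
  ultimately show ?thesis by blast
qed

text \<open>Small boxes whose walls avoid finitely many constants form a neighbourhood base. Each
  wall cuts each flat in the empty set or in a flat with fewer coordinates, so the frontier falls
  under the inductive hypothesis.\<close>

lemma dim_le_finite_union_flats:
  assumes "finite \<F>" "\<And>F. F \<in> \<F> \<Longrightarrow> \<exists>I c M. affine_coords F I c M \<and> card I < k" "X \<subseteq> \<Union>\<F>"
  shows "top_of_set X dim_le (int k - 1)"
  using assms
proof (induction k arbitrary: \<F> X)
  case 0
  \<comment> \<open>\<open>card I < 0\<close> is impossible, so the union is empty and has dimension
    -1.\<close>
  hence "\<F> = {}" by fastforce
  hence "X = {}" using 0 by auto
  thus ?case by simp
next
  case (Suc k)
  from Suc.prems(2) obtain I c M where FI: "\<And>F. F \<in> \<F> \<Longrightarrow> affine_coords F (I F) (c F) (M F) \<and> card (I F) < Suc k"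
    by metis
  show ?case
  proof (rule dimension_le.intros)
    fix V a assume V: "openin (top_of_set X) V" and a: "a \<in> V"
    then obtain T where T: "open T" "V = X \<inter> T" by (auto simp: openin_open)
    obtain N \<epsilon> where e: "\<epsilon> > 0" and N: "\<And>y. (\<forall>j<N. \<bar>y j - a j\<bar> < \<epsilon>) \<Longrightarrow> y \<in> T"
      using open_fun_box[OF T(1), of a] a T by blast
    \<comment> \<open>The forbidden wall positions: the constant terms of coordinate
      \<open>j\<close> over the flats, which are the values excluded when a flat is cut.\<close>
    define B where "B j = (\<lambda>F. c F j) ` \<F>" for j
    have fB: "finite (B j)" for j using Suc.prems(1) by (simp add: B_def)
    have "\<exists>t. t \<in> {a j<..<a j + \<epsilon>} - B j" for j
      using e fB[of j] by (metis Diff_infinite_finite finite.emptyI equals0I infinite_Ioo less_add_same_cancel1)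
    then obtain \<beta> where \<beta>: "\<And>j. a j < \<beta> j \<and> \<beta> j < a j + \<epsilon> \<and> \<beta> j \<notin> B j" by (simp add: Bex_def) metis
    have "\<exists>t. t \<in> {a j - \<epsilon><..<a j} - B j" for j
      using e fB[of j] by (metis Diff_infinite_finite finite.emptyI equals0I infinite_Ioo diff_less_eq less_add_same_cancel1)
    then obtain \<alpha> where \<alpha>: "\<And>j. a j - \<epsilon> < \<alpha> j \<and> \<alpha> j < a j \<and> \<alpha> j \<notin> B j" by (simp add: Bex_def) metis
    define U where "U = X \<inter> {x. \<forall>j<N. \<alpha> j < x j \<and> x j < \<beta> j}"
    have "open {x :: nat \<Rightarrow> real. \<forall>j<N. \<alpha> j < x j \<and> x j < \<beta> j}"
    proof -
      have "{x :: nat \<Rightarrow> real. \<forall>j<N. \<alpha> j < x j \<and> x j < \<beta> j} = (\<Inter>j\<in>{..<N}. {x. \<alpha> j < x j} \<inter> {x. x j < \<beta> j})" by auto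
      moreover have "open ({x. \<alpha> j < x j} \<inter> {x. x j < \<beta> j})" for j
        by (intro open_Int open_Collect_less continuous_intros continuous_on_coordinate)
      ultimately show ?thesis by (simp add: open_INT)
    qed
    hence Uop: "openin (top_of_set X) U" unfolding U_def by blast
    define C where "C = X \<inter> {x. \<forall>j<N. \<alpha> j \<le> x j \<and> x j \<le> \<beta> j}"
    have "closed {x :: nat \<Rightarrow> real. \<forall>j<N. \<alpha> j \<le> x j \<and> x j \<le> \<beta> j}"
    proof -
      have "{x :: nat \<Rightarrow> real. \<forall>j<N. \<alpha> j \<le> x j \<and> x j \<le> \<beta> j} = (\<Inter>j\<in>{..<N}. {x. \<alpha> j \<le> x j} \<inter> {x. x j \<le> \<beta> j})" by auto
      moreover have "closed ({x. \<alpha> j \<le> x j} \<inter> {x. x j \<le> \<beta> j})" for j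
        by (intro closed_Int closed_Collect_le continuous_intros continuous_on_coordinate)
      ultimately show ?thesis by (simp add: closed_INT)
    qed
    hence "closedin (top_of_set X) C" unfolding C_def by (rule closedin_closed_Int)
    moreover have "U \<subseteq> C" by (auto simp: U_def C_def less_imp_le)
    ultimately have clU: "top_of_set X closure_of U \<subseteq> C" by (simp add: closure_of_minimal)
    let ?fr = "top_of_set X frontier_of U"
    have fr: "?fr \<subseteq> C - U" using clU Uop by (auto simp: frontier_of_def interior_of_openin)
    define cut where "cut F j t = {x\<in>F. x j = t}" for F :: "(nat \<Rightarrow> real) set" and j t
    define \<F>' where "\<F>' = ((\<lambda>(F, j). cut F j (\<alpha> j)) ` (\<F> \<times> {..<N}) \<union> (\<lambda>(F, j). cut F j (\<beta> j)) ` (\<F> \<times> {..<N})) - {{}}"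
    have "finite \<F>'" using Suc.prems(1) by (simp add: \<F>'_def)
    moreover have "\<exists>I c M. affine_coords G I c M \<and> card I < k" if G: "G \<in> \<F>'" for G
    proof -
      obtain F j t where Fj: "F \<in> \<F>" "G = {x\<in>F. x j = t}" "t \<notin> B j" "G \<noteq> {}"
      proof -
        obtain F j where "F \<in> \<F>" "G = cut F j (\<alpha> j) \<or> G = cut F j (\<beta> j)" "G \<noteq> {}"
          using G unfolding \<F>'_def by auto
        thus ?thesis using that[of F j "\<alpha> j"] that[of F j "\<beta> j"] \<alpha>[of j] \<beta>[of j] unfolding cut_def by blast
      qed
      have t: "t \<noteq> c F j" using Fj by (auto simp: B_def)
      have "x j = c F j + (\<Sum>i\<in>I F. M F j i * x i)" if "x \<in> F" for x
        using FI[OF Fj(1)] that by (simp add: affine_coords_def)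
      from affine_coords_cut[OF conjunct1[OF FI[OF Fj(1)]] this t]
      obtain I' c' M' where "card I' < card (I F)" "affine_coords G I' c' M'" using Fj by auto
      moreover have "card (I F) \<le> k" using FI[OF Fj(1)] by simp
      ultimately show ?thesis by (meson less_le_trans)
    qed
    moreover have "?fr \<subseteq> \<Union>\<F>'"
    proof
      fix x assume "x \<in> ?fr"
      hence x: "x \<in> C" "x \<notin> U" using fr by auto
      then obtain j where j: "j < N" "x j = \<alpha> j \<or> x j = \<beta> j"
        by (auto simp: C_def U_def)
      obtain F where F: "F \<in> \<F>" "x \<in> F" using x Suc.prems(3) by (auto simp: C_def)
      show "x \<in> \<Union>\<F>'"
        using j(2)
      proof
        assume "x j = \<alpha> j"
        hence "x \<in> cut F j (\<alpha> j)" using F by (simp add: cut_def)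
        moreover from this have "cut F j (\<alpha> j) \<in> \<F>'" using F j by (auto simp: \<F>'_def)
        ultimately show ?thesis by blast
      next
        assume "x j = \<beta> j"
        hence "x \<in> cut F j (\<beta> j)" using F by (simp add: cut_def)
        moreover from this have "cut F j (\<beta> j) \<in> \<F>'" using F j by (auto simp: \<F>'_def)
        ultimately show ?thesis by blast
      qed
    qed
    ultimately have "top_of_set ?fr dim_le (int k - 1)" by (rule Suc.IH)
    moreover have "subtopology (top_of_set X) ?fr = top_of_set ?fr"
      using frontier_of_subset_topspace[of "top_of_set X" U] by (simp add: subtopology_subtopology Int_absorb1)
    moreover have "a \<in> U" using a T \<alpha> \<beta> by (auto simp: U_def)
    moreover have "U \<subseteq> V"
    proof
      fix y assume y: "y \<in> U"
      have "\<bar>y j - a j\<bar> < \<epsilon>" if "j < N" for j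
      proof -
        have "\<alpha> j < y j" "y j < \<beta> j" using y that by (auto simp: U_def)
        thus ?thesis using \<alpha>[of j] \<beta>[of j] by linarith
      qed
      thus "y \<in> V" using N y T by (auto simp: U_def)
    qed
    ultimately show "\<exists>U. a \<in> U \<and> U \<subseteq> V \<and> openin (top_of_set X) U \<and>
        subtopology (top_of_set X) (top_of_set X frontier_of U) dim_le int (Suc k) - 1 - 1"
      using Uop by (intro exI[of _ U]) simp
  qed simp
qed

section \<open>Prime ideals of cancellative hoops\<close>

lemma hoop_add_right_cancel: "x + z = y + z \<longleftrightarrow> x = (y :: 'a::cancellative_hoop)"
  by (metis hoop_cancel)

lemma hoop_diff_zero [simp]: "x - 0 = (x :: 'a::cancellative_hoop)"
  using hoop_cancel[of x 0] by simp

lemma hoop_zero_diff [simp]: "0 - z = (0 :: 'a::cancellative_hoop)"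
proof -
  have "z + (0 - z) = 0 + (z - 0)" by (rule hoop_divisible)
  hence "(0 - z) + z = 0 + z" by (simp add: add.commute)
  thus ?thesis by (simp only: hoop_add_right_cancel)
qed

lemma hoop_le_refl [simp]: "hoop_le x x"
  by (simp add: hoop_le_def hoop_diff_self)

lemma hoop_le_add_diff: "hoop_le x y \<Longrightarrow> x + (y - x) = y"
  unfolding hoop_le_def by (metis hoop_divisible add.right_neutral)

lemma hoop_le_add [simp]: "hoop_le x (x + z)"
  unfolding hoop_le_def by (simp add: hoop_diff_diff[symmetric] hoop_diff_self)

lemma hoop_le_iff_add: "hoop_le x y \<longleftrightarrow> (\<exists>z. y = x + z)"
  by (metis hoop_le_add hoop_le_add_diff)

lemma hoop_diff_le_iff: "hoop_le (x - y) z \<longleftrightarrow> hoop_le x (y + z)"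
  by (simp add: hoop_le_def hoop_diff_diff)

lemma hoop_zero_le [simp]: "hoop_le 0 x"
  by (simp add: hoop_le_def)

lemma hoop_le_zero: "hoop_le x 0 \<longleftrightarrow> x = 0"
  by (simp add: hoop_le_def)

lemma hoop_le_trans: "hoop_le x y \<Longrightarrow> hoop_le y z \<Longrightarrow> hoop_le x z"
  by (metis hoop_le_iff_add add.assoc)

lemma hoop_diff_le [simp]: "hoop_le (x - y) x"
  by (simp add: hoop_diff_le_iff) (metis hoop_le_add add.commute)

lemma hoop_add_mono: "hoop_le a b \<Longrightarrow> hoop_le c d \<Longrightarrow> hoop_le (a + c) (b + d)"
  unfolding hoop_le_iff_add by (metis add.assoc add.left_commute)

lemma hoop_add_diff_add: "(x + z) - (y + z) = x - (y :: 'a::cancellative_hoop)"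
  by (metis hoop_cancel hoop_diff_diff add.commute)

definition hoop_disjoint :: "'a::cancellative_hoop \<Rightarrow> 'a \<Rightarrow> bool" where
  "hoop_disjoint p q \<longleftrightarrow> (\<forall>c. hoop_le c p \<and> hoop_le c q \<longrightarrow> c = 0)"

lemma hoop_disjoint_commute: "hoop_disjoint p q \<longleftrightarrow> hoop_disjoint q p"
  unfolding hoop_disjoint_def by blast

text \<open>For \<open>c\<close> below \<open>p\<close> and \<open>q + q'\<close>, the element
  \<open>c - q\<close> is below \<open>p\<close> and \<open>q'\<close>, hence 0; so \<open>c\<close>
  is below \<open>q\<close> as well.\<close>

lemma hoop_disjoint_add: "hoop_disjoint p q \<Longrightarrow> hoop_disjoint p q' \<Longrightarrow> hoop_disjoint p (q + q')"
  unfolding hoop_disjoint_def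
  by (metis hoop_diff_le_iff hoop_diff_le hoop_le_trans hoop_le_def)

lemma hoop_disjoint_sum: "hoop_disjoint p q \<Longrightarrow> hoop_disjoint p (\<Sum>i<k::nat. q)"
proof (induction k)
  case 0 thus ?case by (simp add: hoop_disjoint_def hoop_le_zero)
next
  case (Suc k) thus ?case by (simp add: hoop_disjoint_add)
qed

text \<open>With \<open>a - b = c + p'\<close> and \<open>b - a = c + q'\<close>, divisibility and
  cancellation give \<open>a + q' = b + p'\<close>; hence \<open>a - b\<close> is below
  \<open>p'\<close>, which forces \<open>c = 0\<close>.\<close>

lemma hoop_disjoint_diff: "hoop_disjoint (a - b) (b - a)"
  unfolding hoop_disjoint_def
proof (intro allI impI, elim conjE)
  fix c assume c: "hoop_le c (a - b)" "hoop_le c (b - a)"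
  define p' q' where "p' = (a - b) - c" and "q' = (b - a) - c"
  have p: "a - b = c + p'" and q: "b - a = c + q'"
    using c by (simp_all add: p'_def q'_def hoop_le_add_diff)
  have "a + (c + q') = b + (c + p')" using hoop_divisible[of a b] p q by simp
  hence "(a + q') + c = (b + p') + c" by (simp add: ac_simps)
  hence "a + q' = b + p'" by (simp only: hoop_add_right_cancel)
  hence "hoop_le a (b + p')" by (metis hoop_le_add)
  hence "hoop_le (c + p') p'" using p by (simp add: hoop_diff_le_iff[symmetric])
  hence "(c + p') - p' = 0" by (simp add: hoop_le_def)
  thus "c = 0" by (simp add: hoop_cancel)
qed

definition hoop_ideal :: "'a::cancellative_hoop set \<Rightarrow> bool" where
  "hoop_ideal I \<longleftrightarrow> 0 \<in> I \<and> (\<forall>x\<in>I. \<forall>y\<in>I. x + y \<in> I) \<and> (\<forall>y\<in>I. \<forall>x. hoop_le x y \<longrightarrow> x \<in> I)"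

lemma hoop_ideal_generated:
  assumes "hoop_ideal I"
  shows "hoop_ideal {x. \<exists>m\<in>I. \<exists>k::nat. hoop_le x (m + (\<Sum>i<k. p))}" (is "hoop_ideal ?J")
  unfolding hoop_ideal_def
proof (intro conjI ballI allI impI)
  show "0 \<in> ?J" using assms by (auto simp: hoop_ideal_def)
next
  fix x y assume "x \<in> ?J" "y \<in> ?J"
  then obtain m m' k k' where x: "m \<in> I" "hoop_le x (m + (\<Sum>i<(k::nat). p))"
    and y: "m' \<in> I" "hoop_le y (m' + (\<Sum>i<(k'::nat). p))" by auto
  have "(\<Sum>i<k+k'. p) = (\<Sum>i<k. p) + (\<Sum>i<k'. p)" for k k' :: nat
    by (induction k) (simp_all add: ac_simps)
  hence "hoop_le (x + y) ((m + m') + (\<Sum>i<k+k'. p))"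
    using hoop_add_mono[OF x(2) y(2)] by (simp add: ac_simps)
  moreover have "m + m' \<in> I" using x y assms by (auto simp: hoop_ideal_def)
  ultimately show "x + y \<in> ?J" by blast
next
  fix x y assume "y \<in> ?J" "hoop_le x y"
  thus "x \<in> ?J" using hoop_le_trans by blast
qed

text \<open>Zorn's lemma gives an ideal maximal among those without \<open>h\<close>. If it
  contained neither \<open>a - b\<close> nor \<open>b - a\<close>, then \<open>h\<close>, up to an
  element of the ideal, would lie below multiples of both, and multiples of disjoint elements are
  disjoint.\<close>

lemma prime_hoop_ideal_exists:
  fixes h :: "'a::cancellative_hoop"
  assumes "h \<noteq> 0"
  obtains M where "hoop_ideal M" "h \<notin> M" "\<And>a b. a - b \<in> M \<or> b - a \<in> M"
proof -
  define A where "A = {I. hoop_ideal I \<and> h \<notin> I}"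
  have "\<exists>M\<in>A. \<forall>X\<in>A. M \<subseteq> X \<longrightarrow> X = M"
  proof (rule subset_Zorn_nonempty)
    show "A \<noteq> {}" using assms by (auto simp: A_def hoop_ideal_def hoop_le_zero intro!: exI[of _ "{0}"])
  next
    fix C assume C: "C \<noteq> {}" "subset.chain A C"
    have CA: "C \<subseteq> A" and lin: "\<And>X Y. X \<in> C \<Longrightarrow> Y \<in> C \<Longrightarrow> X \<subseteq> Y \<or> Y \<subseteq> X"
      using C(2) unfolding subset_chain_def by auto
    have "hoop_ideal (\<Union>C)" unfolding hoop_ideal_def
    proof (intro conjI ballI allI impI)
      show "0 \<in> \<Union>C" using C(1) CA by (auto simp: A_def hoop_ideal_def)
    next
      fix x y assume "x \<in> \<Union>C" "y \<in> \<Union>C"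
      then obtain X Y where "x \<in> X" "y \<in> Y" "X \<in> C" "Y \<in> C" by blast
      then obtain Z where "Z \<in> C" "x \<in> Z" "y \<in> Z" using lin by blast
      moreover have "hoop_ideal Z" using CA \<open>Z \<in> C\<close> by (auto simp: A_def)
      ultimately show "x + y \<in> \<Union>C" unfolding hoop_ideal_def by blast
    next
      fix x y assume "y \<in> \<Union>C" "hoop_le x y"
      thus "x \<in> \<Union>C" using CA unfolding A_def hoop_ideal_def by blast
    qed
    thus "\<Union>C \<in> A" using CA by (auto simp: A_def)
  qed
  then obtain M where M: "M \<in> A" and max: "\<And>X. X \<in> A \<Longrightarrow> M \<subseteq> X \<Longrightarrow> X = M" by blast
  have id: "hoop_ideal M" and hM: "h \<notin> M" using M by (auto simp: A_def)
  have gen: "\<exists>m\<in>M. \<exists>k::nat. hoop_le h (m + (\<Sum>i<k. p))" if "p \<notin> M" for p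
  proof (rule ccontr)
    let ?J = "{x. \<exists>m\<in>M. \<exists>k::nat. hoop_le x (m + (\<Sum>i<k. p))}"
    assume "\<not> ?thesis"
    hence "?J \<in> A" using hoop_ideal_generated[OF id, of p] by (simp add: A_def)
    moreover have "M \<subseteq> ?J"
    proof
      fix x assume "x \<in> M"
      moreover have "hoop_le x (x + (\<Sum>i<(0::nat). p))" by simp
      ultimately show "x \<in> ?J" by blast
    qed
    ultimately have "?J = M" using max by blast
    moreover have "p \<in> ?J"
    proof -
      have "0 \<in> M" using id by (simp add: hoop_ideal_def)
      moreover have "hoop_le p (0 + (\<Sum>i<(1::nat). p))" by simp
      ultimately show ?thesis by blast
    qed
    ultimately show False using that by blast
  qed
  show ?thesis
  proof (rule that[OF id hM], rule ccontr)
    fix a b assume "\<not> (a - b \<in> M \<or> b - a \<in> M)"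
    then obtain m m' k k' where m: "m \<in> M" "hoop_le h (m + (\<Sum>i<(k::nat). a - b))"
      and m': "m' \<in> M" "hoop_le h (m' + (\<Sum>i<(k'::nat). b - a))" using gen by blast
    have "hoop_le (m + (\<Sum>i<(k::nat). a - b)) ((m + m') + (\<Sum>i<k. a - b))"
         "hoop_le (m' + (\<Sum>i<(k'::nat). b - a)) ((m + m') + (\<Sum>i<k'. b - a))"
      by (metis hoop_le_add add.commute add.left_commute)+
    hence "hoop_le (h - (m + m')) (\<Sum>i<k. a - b)" "hoop_le (h - (m + m')) (\<Sum>i<k'. b - a)"
      using m(2) m'(2) hoop_le_trans unfolding hoop_diff_le_iff by blast+
    moreover have "hoop_disjoint (\<Sum>i<k. a - b) (\<Sum>i<k'. b - a)"
      by (metis hoop_disjoint_sum hoop_disjoint_diff hoop_disjoint_commute)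
    ultimately have "h - (m + m') = 0" unfolding hoop_disjoint_def by blast
    hence "hoop_le h (m + m')" by (simp add: hoop_le_def)
    moreover have "m + m' \<in> M" using m m' id by (simp add: hoop_ideal_def)
    ultimately show False using id hM unfolding hoop_ideal_def by blast
  qed
qed

section \<open>Integer linear forms and Fourier--Motzkin elimination\<close>

definition lform :: "nat \<Rightarrow> (nat \<Rightarrow> int) \<Rightarrow> (nat \<Rightarrow> real) \<Rightarrow> real" where
  "lform n a x = (\<Sum>i<n. real_of_int (a i) * x i)"

lemma lform_add: "lform n (\<lambda>i. a i + b i) x = lform n a x + lform n b x"
  by (simp add: lform_def sum.distrib algebra_simps)

lemma lform_diff: "lform n (\<lambda>i. a i - b i) x = lform n a x - lform n b x"
  by (simp add: lform_def sum_subtractf algebra_simps)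

lemma lform_minus: "lform n (\<lambda>i. - a i) x = - lform n a x"
  by (simp add: lform_def sum_negf)

lemma lform_scale: "lform n (\<lambda>i. k * a i) x = real_of_int k * lform n a x"
  by (simp add: lform_def sum_distrib_left mult.assoc)

lemma lform_zero: "lform n (\<lambda>i. 0) x = 0"
  by (simp add: lform_def)

lemma lform_unit: "k < n \<Longrightarrow> lform n (\<lambda>i. if i = k then 1 else 0) x = x k"
proof -
  assume k: "k < n"
  have "lform n (\<lambda>i. if i = k then 1 else 0) x = (\<Sum>i<n. if i = k then x i else 0)"
    unfolding lform_def by (intro sum.cong) auto
  thus ?thesis using k by simp
qed

text \<open>The nonnegative cone of a total preorder on the group of integer linear forms.\<close>

definition total_cone :: "(nat \<Rightarrow> int) set \<Rightarrow> bool" where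
  "total_cone Q \<longleftrightarrow> (\<lambda>i. 0) \<in> Q \<and> (\<forall>a\<in>Q. \<forall>b\<in>Q. (\<lambda>i. a i + b i) \<in> Q) \<and> (\<forall>a. a \<in> Q \<or> (\<lambda>i. - a i) \<in> Q)"

lemma total_cone_scale: "total_cone Q \<Longrightarrow> a \<in> Q \<Longrightarrow> (\<lambda>i. int k * a i) \<in> Q"
proof (induction k)
  case 0 thus ?case by (simp add: total_cone_def)
next
  case (Suc k)
  hence "(\<lambda>i. int k * a i + a i) \<in> Q" by (auto simp: total_cone_def)
  thus ?case by (simp add: algebra_simps)
qed

text \<open>Otherwise the negative of \<open>a\<close> is in \<open>Q\<close>, and adding
  \<open>k - 1\<close> copies of it to the \<open>k\<close>-fold of \<open>a\<close> gives
  \<open>a\<close>.\<close>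

lemma total_cone_scaleD:
  assumes Q: "total_cone Q" and k: "k > 0" and a: "(\<lambda>i. int k * a i) \<in> Q"
  shows "a \<in> Q"
proof (rule ccontr)
  assume "a \<notin> Q"
  hence "(\<lambda>i. - a i) \<in> Q" using Q by (auto simp: total_cone_def)
  hence "(\<lambda>i. int (k - 1) * - a i) \<in> Q" by (rule total_cone_scale[OF Q])
  moreover have "(\<lambda>i. a i + b i) \<in> Q" if "a \<in> Q" "b \<in> Q" for a b
    using Q that by (auto simp: total_cone_def)
  ultimately have "(\<lambda>i. int k * a i + int (k - 1) * - a i) \<in> Q"
    using a by blast
  moreover have "(\<lambda>i. int k * a i + int (k - 1) * - a i) = a"
    using k by (auto simp: fun_eq_iff algebra_simps of_nat_diff)
  ultimately show False using \<open>a \<notin> Q\<close> by simp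
qed

text \<open>A finite system of bounds on one real unknown; the flag marks strict bounds.\<close>

lemma exists_between_bounds:
  fixes L U :: "(real \<times> bool) set"
  assumes "finite L" "finite U"
    and "\<And>l s u t. (l, s) \<in> L \<Longrightarrow> (u, t) \<in> U \<Longrightarrow> l \<le> u \<and> (s \<or> t \<longrightarrow> l < u)"
  shows "\<exists>y. (\<forall>(l, s)\<in>L. l \<le> y \<and> (s \<longrightarrow> l < y)) \<and> (\<forall>(u, t)\<in>U. y \<le> u \<and> (t \<longrightarrow> y < u))"
proof (cases "L = {}")
  case True
  show ?thesis
  proof (cases "U = {}")
    case False
    have "Min (fst ` U) \<le> u" if "(u, t) \<in> U" for u t
      using that assms(2) by (intro Min_le) (auto intro: image_eqI[of _ fst "(u, t)"])
    thus ?thesis using True by (intro exI[of _ "Min (fst ` U) - 1"]) force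
  qed (use True in auto)
next
  case LN: False
  have Lmax: "l \<le> Max (fst ` L)" if "(l, s) \<in> L" for l s
    using that assms(1) by (intro Max_ge) (auto intro: image_eqI[of _ fst "(l, s)"])
  show ?thesis
  proof (cases "U = {}")
    case True
    thus ?thesis using Lmax by (intro exI[of _ "Max (fst ` L) + 1"]) force
  next
    case False
    have Umin: "Min (fst ` U) \<le> u" if "(u, t) \<in> U" for u t
      using that assms(2) by (intro Min_le) (auto intro: image_eqI[of _ fst "(u, t)"])
    have "Max (fst ` L) \<in> fst ` L" "Min (fst ` U) \<in> fst ` U"
      using LN False assms(1,2) by auto
    then obtain s t where st: "(Max (fst ` L), s) \<in> L" "(Min (fst ` U), t) \<in> U" by auto
    define y where "y = (Max (fst ` L) + Min (fst ` U)) / 2"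
    have le: "Max (fst ` L) \<le> Min (fst ` U)" using assms(3)[OF st] by simp
    have "l \<le> y \<and> (s' \<longrightarrow> l < y)" if "(l, s') \<in> L" for l s'
      using Lmax[OF that] le assms(3)[OF that st(2)] unfolding y_def by auto
    moreover have "y \<le> u \<and> (t' \<longrightarrow> y < u)" if "(u, t') \<in> U" for u t'
      using Umin[OF that] le assms(3)[OF st(1) that] unfolding y_def by auto
    ultimately show ?thesis by (intro exI[of _ y]) auto
  qed
qed

text \<open>By Fourier--Motzkin elimination of the last variable.\<close>

lemma total_cone_realised:
  assumes Q: "total_cone Q" and A: "finite A" and supp: "\<And>a i. a \<in> A \<Longrightarrow> i \<ge> n \<Longrightarrow> a i = 0"
  shows "\<exists>x. \<forall>a\<in>A. (a \<in> Q \<longrightarrow> 0 \<le> lform n a x) \<and> (a \<in> Q \<and> (\<lambda>i. - a i) \<notin> Q \<longrightarrow> 0 < lform n a x)"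
  using A supp
proof (induction n arbitrary: A)
  case 0
  have "a = (\<lambda>i. 0)" if "a \<in> A" for a using 0(2)[OF that] by auto
  moreover have "(\<lambda>i. 0) \<in> Q" using Q by (simp add: total_cone_def)
  ultimately show ?case by (force simp: lform_def)
next
  case (Suc n)
  have Qadd: "(\<lambda>i. a i + b i) \<in> Q" if "a \<in> Q" "b \<in> Q" for a b
    using Q that by (auto simp: total_cone_def)
  define AP where "AP = {a\<in>A. a \<in> Q \<and> a n > 0}"
  define AN where "AN = {a\<in>A. a \<in> Q \<and> a n < 0}"
  \<comment> \<open>The positive combination of a lower and an upper bound in which the last
    variable cancels.\<close>
  define comb where "comb a b = (\<lambda>i. int (nat (- b n)) * a i + int (nat (a n)) * b i)" for a b :: "nat \<Rightarrow> int"
  define A' where "A' = {a\<in>A. a n = 0} \<union> (\<lambda>(a, b). comb a b) ` (AP \<times> AN)"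
  have fin: "finite AP" "finite AN" "finite A'" using Suc.prems(1) by (auto simp: AP_def AN_def A'_def)
  have supp: "a i = 0" if aA: "a \<in> A'" and "i \<ge> n" for a i
  proof (cases "i = n")
    case True thus ?thesis using that by (auto simp: A'_def comb_def AP_def AN_def)
  next
    case False
    hence "i \<ge> Suc n" using that by simp
    hence z: "b i = 0" if "b \<in> A" for b using Suc.prems(2) that by blast
    consider "a \<in> A" | b c where "b \<in> A" "c \<in> A" "a = comb b c"
      using aA by (auto simp: A'_def AP_def AN_def)
    thus ?thesis
    proof cases
      case 1 thus ?thesis by (rule z)
    next
      case 2 thus ?thesis using z[of b] z[of c] by (simp add: comb_def)
    qed
  qed
  have "\<exists>x. \<forall>a\<in>A'. (a \<in> Q \<longrightarrow> 0 \<le> lform n a x) \<and> (a \<in> Q \<and> (\<lambda>i. - a i) \<notin> Q \<longrightarrow> 0 < lform n a x)"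
    by (rule Suc.IH[OF fin(3)]) (rule supp)
  then obtain x where x: "\<And>a. a \<in> A' \<Longrightarrow> (a \<in> Q \<longrightarrow> 0 \<le> lform n a x) \<and> (a \<in> Q \<and> (\<lambda>i. - a i) \<notin> Q \<longrightarrow> 0 < lform n a x)"
    by blast
  \<comment> \<open>The value of the last coordinate at which the form \<open>a\<close> vanishes: a
    lower bound for forms in \<open>AP\<close>, an upper bound for forms in
    \<open>AN\<close>.\<close>
  define bd where "bd a = - lform n a x / real_of_int (a n)" for a
  define st where "st a \<longleftrightarrow> (\<lambda>i. - a i) \<notin> Q" for a :: "nat \<Rightarrow> int"
  have compat: "bd a \<le> bd b \<and> (st a \<or> st b \<longrightarrow> bd a < bd b)" if a: "a \<in> AP" and b: "b \<in> AN" for a b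
  proof -
    have an: "a n > 0" and bn: "b n < 0" and aQ: "a \<in> Q" and bQ: "b \<in> Q" using a b by (auto simp: AP_def AN_def)
    have cA: "comb a b \<in> A'" using a b by (auto simp: A'_def)
    have cQ: "comb a b \<in> Q" unfolding comb_def
      using Qadd[OF total_cone_scale[OF Q aQ, of "nat (- b n)"] total_cone_scale[OF Q bQ, of "nat (a n)"]] .
    \<comment> \<open>If the combination were equivalent to 0 for the preorder, so would be both of
      its nonnegative summands; hence a strict bound on either side makes the combination
      strict.\<close>
    have strict: "(\<lambda>i. - comb a b i) \<notin> Q" if "st a \<or> st b"
    proof
      assume neg: "(\<lambda>i. - comb a b i) \<in> Q"
      have "(\<lambda>i. int (nat (a n)) * - b i) \<in> Q"
        using Qadd[OF neg total_cone_scale[OF Q aQ, of "nat (- b n)"]] by (simp add: comb_def)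
      hence nb: "(\<lambda>i. - b i) \<in> Q" using total_cone_scaleD[OF Q, of "nat (a n)"] an by auto
      have "(\<lambda>i. int (nat (- b n)) * - a i) \<in> Q"
        using Qadd[OF neg total_cone_scale[OF Q bQ, of "nat (a n)"]] by (simp add: comb_def)
      hence "(\<lambda>i. - a i) \<in> Q" using total_cone_scaleD[OF Q, of "nat (- b n)"] bn by auto
      thus False using nb that by (simp add: st_def)
    qed
    have "lform n (comb a b) x = - real_of_int (b n) * lform n a x + real_of_int (a n) * lform n b x"
      unfolding comb_def lform_add lform_scale using an bn by simp
    moreover have "0 \<le> lform n (comb a b) x" "st a \<or> st b \<Longrightarrow> 0 < lform n (comb a b) x"
      using x[OF cA] cQ strict by auto
    moreover have "bd b - bd a = (- real_of_int (b n) * lform n a x + real_of_int (a n) * lform n b x) / (real_of_int (a n) * - real_of_int (b n))"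
      using an bn by (simp add: bd_def field_simps)
    moreover have "real_of_int (a n) * - real_of_int (b n) > 0" using an bn by (simp add: mult_pos_neg)
    ultimately have "0 \<le> bd b - bd a" "st a \<or> st b \<Longrightarrow> 0 < bd b - bd a"
      by (simp_all only: divide_nonneg_pos divide_pos_pos)
    thus ?thesis by auto
  qed
  have "\<exists>y. (\<forall>(l, s)\<in>(\<lambda>a. (bd a, st a)) ` AP. l \<le> y \<and> (s \<longrightarrow> l < y)) \<and>
      (\<forall>(u, t)\<in>(\<lambda>a. (bd a, st a)) ` AN. y \<le> u \<and> (t \<longrightarrow> y < u))"
    using compat fin by (intro exists_between_bounds) auto
  then obtain y where yP: "\<And>a. a \<in> AP \<Longrightarrow> bd a \<le> y \<and> (st a \<longrightarrow> bd a < y)"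
    and yN: "\<And>a. a \<in> AN \<Longrightarrow> y \<le> bd a \<and> (st a \<longrightarrow> y < bd a)" by auto
  define x' where "x' = x(n := y)"
  have lf: "lform (Suc n) a x' = lform n a x + real_of_int (a n) * y" for a
    by (simp add: lform_def x'_def)
  have "(a \<in> Q \<longrightarrow> 0 \<le> lform (Suc n) a x') \<and> (a \<in> Q \<and> (\<lambda>i. - a i) \<notin> Q \<longrightarrow> 0 < lform (Suc n) a x')" if a: "a \<in> A" for a
  proof (cases "a \<in> Q")
    case True
    consider "a n = 0" | "a n > 0" | "a n < 0" by linarith
    thus ?thesis
    proof cases
      case 1
      hence "a \<in> A'" using a by (auto simp: A'_def)
      thus ?thesis using x[of a] 1 by (simp add: lf)
    next
      case 2
      hence "a \<in> AP" using a True by (simp add: AP_def)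
      from yP[OF this] show ?thesis using 2 True by (auto simp: lf st_def bd_def field_simps)
    next
      case 3
      hence "a \<in> AN" using a True by (simp add: AN_def)
      from yN[OF this] show ?thesis using 3 True by (auto simp: lf st_def bd_def field_simps)
    qed
  qed simp
  thus ?case by blast
qed

section \<open>Evaluation of terms and extremal states\<close>

primrec reval :: "(nat \<Rightarrow> real) \<Rightarrow> hterm \<Rightarrow> real" where
  "reval x (HGen i) = x i"
| "reval x HZero = 0"
| "reval x (HAdd s t) = reval x s + reval x t"
| "reval x (HSub s t) = max 0 (reval x s - reval x t)"

text \<open>The linear form computed by a term when the comparisons inside it are decided by \<open>Q\<close>.\<close>

primrec hlin :: "(nat \<Rightarrow> int) set \<Rightarrow> hterm \<Rightarrow> nat \<Rightarrow> int" where
  "hlin Q (HGen i) = (\<lambda>j. if j = i then 1 else 0)"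
| "hlin Q HZero = (\<lambda>j. 0)"
| "hlin Q (HAdd s t) = (\<lambda>j. hlin Q s j + hlin Q t j)"
| "hlin Q (HSub s t) = (if (\<lambda>j. hlin Q s j - hlin Q t j) \<in> Q then (\<lambda>j. hlin Q s j - hlin Q t j) else (\<lambda>j. 0))"

text \<open>All forms that \<open>hlin\<close> may return, over every possible \<open>Q\<close>: a
  finite superset that does not mention \<open>Q\<close>.\<close>

primrec hforms :: "hterm \<Rightarrow> (nat \<Rightarrow> int) set" where
  "hforms (HGen i) = {\<lambda>j. if j = i then 1 else 0}"
| "hforms HZero = {\<lambda>j. 0}"
| "hforms (HAdd s t) = (\<lambda>(a, b). \<lambda>j. a j + b j) ` (hforms s \<times> hforms t)"
| "hforms (HSub s t) = insert (\<lambda>j. 0) ((\<lambda>(a, b). \<lambda>j. a j - b j) ` (hforms s \<times> hforms t))"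

text \<open>The differences of linear forms whose signs decide the truncated subtractions in a term.\<close>

primrec hcmp :: "hterm \<Rightarrow> (nat \<Rightarrow> int) set" where
  "hcmp (HGen i) = {}"
| "hcmp HZero = {}"
| "hcmp (HAdd s t) = hcmp s \<union> hcmp t"
| "hcmp (HSub s t) = hcmp s \<union> hcmp t \<union> (\<lambda>(a, b). \<lambda>j. a j - b j) ` (hforms s \<times> hforms t)"

lemma finite_hforms: "finite (hforms s)"
  by (induction s) auto

lemma finite_hcmp: "finite (hcmp s)"
  by (induction s) (auto simp: finite_hforms)

lemma hlin_in_hforms: "hlin Q s \<in> hforms s"
  by (induction s) auto

lemma hforms_support: "s \<in> hterms n \<Longrightarrow> a \<in> hforms s \<Longrightarrow> i \<ge> n \<Longrightarrow> a i = 0"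
  by (induction arbitrary: a rule: hterms.induct) fastforce+

lemma hcmp_support: "s \<in> hterms n \<Longrightarrow> a \<in> hcmp s \<Longrightarrow> i \<ge> n \<Longrightarrow> a i = 0"
  by (induction arbitrary: a rule: hterms.induct) (fastforce simp: hforms_support)+

lemma hlin_diff_in_hcmp: "(\<lambda>j. hlin Q s j - hlin Q t j) \<in> hcmp (HSub s t)"
  using hlin_in_hforms[of Q s] hlin_in_hforms[of Q t] by force

text \<open>\<open>Q\<close> has to decide each comparison only weakly correctly: where a compared
  difference vanishes, both branches of the truncated subtraction give 0. This later extends
  linearity from a cell to its closure.\<close>

lemma reval_eq_lform:
  assumes "s \<in> hterms n"
    and "\<And>a. a \<in> hcmp s \<Longrightarrow> a \<in> Q \<Longrightarrow> 0 \<le> lform n a y"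
    and "\<And>a. a \<in> hcmp s \<Longrightarrow> a \<notin> Q \<Longrightarrow> lform n a y \<le> 0"
  shows "reval y s = lform n (hlin Q s) y"
  using assms
proof (induction rule: hterms.induct)
  case (gen i) thus ?case by (simp add: lform_unit)
next
  case zero thus ?case by (simp add: lform_zero)
next
  case (add s t) thus ?case by (simp add: lform_add)
next
  case (sub s t)
  have IH: "reval y s = lform n (hlin Q s) y" "reval y t = lform n (hlin Q t) y" using sub by auto
  let ?d = "\<lambda>j. hlin Q s j - hlin Q t j"
  show ?case
  proof (cases "?d \<in> Q")
    case True
    hence "0 \<le> lform n ?d y" using sub.prems(1) hlin_diff_in_hcmp by blast
    thus ?thesis using True by (simp add: IH lform_diff)
  next
    case False
    hence "lform n ?d y \<le> 0" using sub.prems(2) hlin_diff_in_hcmp by blast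
    thus ?thesis using False by (simp add: IH lform_diff lform_zero)
  qed
qed

lemma reval_nonneg: "s \<in> hterms n \<Longrightarrow> (\<And>i. i < n \<Longrightarrow> 0 \<le> x i) \<Longrightarrow> 0 \<le> reval x s"
  by (induction rule: hterms.induct) auto

lemma reval_scale: "c \<ge> 0 \<Longrightarrow> reval (\<lambda>i. c * x i) s = c * reval x s"
  by (induction s) (auto simp: max_def algebra_simps mult_le_cancel_left)

lemma continuous_on_reval: "continuous_on A (\<lambda>x. reval x s)"
proof (induction s)
  case (HGen i)
  show ?case by simp (rule continuous_on_subset[OF continuous_on_product_coordinates], simp)
qed (simp_all, (intro continuous_intros; assumption)+)

text \<open>Nonnegative coordinates matter here: over all reals, truncated subtraction violates
  \<open>(r - s) - t = r - (s + t)\<close> and \<open>(s + t) - t = s\<close>.\<close>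

lemma reval_hoop_cong:
  assumes "hoop_cong n E s t" "\<And>i. i < n \<Longrightarrow> 0 \<le> x i" "\<And>s t. (s, t) \<in> E \<Longrightarrow> reval x s = reval x t"
  shows "reval x s = reval x t"
  using assms
proof (induction rule: hoop_cong.induct)
  case (diff_diff r s t)
  thus ?case using reval_nonneg[of t n x] by (auto simp: max_def)
next
  case (cancel s t)
  thus ?case using reval_nonneg[of s n x] by auto
qed (auto simp: max_def)

section \<open>Extremal states as points of a cone\<close>

locale presented_hoop =
  fixes n :: nat and E :: "(hterm \<times> hterm) set" and g :: "nat \<Rightarrow> 'a::cancellative_hoop" and u :: 'a and ut :: hterm
  assumes finE: "finite E" and Esub: "E \<subseteq> hterms n \<times> hterms n"
    and onto: "heval g ` hterms n = UNIV"
    and kernel: "\<And>s t. s \<in> hterms n \<Longrightarrow> t \<in> hterms n \<Longrightarrow> heval g s = heval g t \<longleftrightarrow> hoop_cong n E s t"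
    and unit: "hoop_unit u" and ut: "ut \<in> hterms n" "heval g ut = u"
begin

definition cone :: "(nat \<Rightarrow> real) set" where
  "cone = {x. (\<forall>i<n. 0 \<le> x i) \<and> (\<forall>i\<ge>n. x i = 0) \<and> (\<forall>(s, t)\<in>E. reval x s = reval x t)}"

definition polyh :: "(nat \<Rightarrow> real) set" where
  "polyh = {x\<in>cone. reval x ut = 1}"

definition tm :: "'a \<Rightarrow> hterm" where
  "tm h = (SOME s. s \<in> hterms n \<and> heval g s = h)"

definition val :: "(nat \<Rightarrow> real) \<Rightarrow> 'a \<Rightarrow> real" where
  "val x h = reval x (tm h)"

definition coords :: "('a \<Rightarrow> real) \<Rightarrow> nat \<Rightarrow> real" where
  "coords e = (\<lambda>i. if i < n then e (g i) else 0)"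

lemma tm: "tm h \<in> hterms n" "heval g (tm h) = h"
proof -
  have "\<exists>s. s \<in> hterms n \<and> heval g s = h" using onto by (metis UNIV_I imageE)
  from someI_ex[OF this] show "tm h \<in> hterms n" "heval g (tm h) = h" by (simp_all add: tm_def)
qed

lemma val_heval: "x \<in> cone \<Longrightarrow> s \<in> hterms n \<Longrightarrow> val x (heval g s) = reval x s"
  unfolding val_def
  by (rule reval_hoop_cong[where n = n and E = E])
    (use kernel[of "tm (heval g s)" s] tm in \<open>auto simp: cone_def\<close>)

lemma val_zero: "x \<in> cone \<Longrightarrow> val x 0 = 0"
  using val_heval[of x HZero] by (simp add: hterms.zero)

lemma val_add: "x \<in> cone \<Longrightarrow> val x (a + b) = val x a + val x b"
  using val_heval[of x "HAdd (tm a) (tm b)"] tm by (simp add: hterms.add val_def)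

lemma val_diff: "x \<in> cone \<Longrightarrow> val x (a - b) = max 0 (val x a - val x b)"
  using val_heval[of x "HSub (tm a) (tm b)"] tm by (simp add: hterms.sub val_def)

lemma val_gen: "x \<in> cone \<Longrightarrow> i < n \<Longrightarrow> val x (g i) = x i"
  using val_heval[of x "HGen i"] by (simp add: hterms.gen)

lemma val_nonneg: "x \<in> cone \<Longrightarrow> 0 \<le> val x h"
  unfolding val_def by (rule reval_nonneg[OF tm(1)]) (simp add: cone_def)

lemma val_unit: "x \<in> cone \<Longrightarrow> val x u = reval x ut"
  using val_heval[OF _ ut(1)] ut(2) by simp

lemma polyh_iff: "x \<in> polyh \<longleftrightarrow> x \<in> cone \<and> val x u = 1"
  using val_unit by (auto simp: polyh_def)

lemma val_sum: "x \<in> cone \<Longrightarrow> val x (\<Sum>i<k::nat. h) = real k * val x h"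
  by (induction k) (auto simp: val_zero val_add algebra_simps)

lemma val_le: "x \<in> cone \<Longrightarrow> hoop_le a b \<Longrightarrow> val x a \<le> val x b"
  unfolding hoop_le_def using val_diff[of x a b] val_zero[of x] by (auto simp: max_def split: if_splits)

text \<open>The Archimedean content of the unit, uniform over the cone; it makes the section at
  height 1 bounded.\<close>

lemma val_bound: "\<exists>k::nat. \<forall>x\<in>cone. val x h \<le> real k * val x u"
proof -
  obtain k where "hoop_le h (\<Sum>i<(k::nat). u)" using unit unfolding hoop_unit_def by blast
  hence "\<forall>x\<in>cone. val x h \<le> real k * val x u" using val_le val_sum by metis
  thus ?thesis by blast
qed

lemma scale_cone: "x \<in> cone \<Longrightarrow> c \<ge> 0 \<Longrightarrow> (\<lambda>i. c * x i) \<in> cone"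
  by (auto simp: cone_def reval_scale)

lemma val_scale: "c \<ge> 0 \<Longrightarrow> val (\<lambda>i. c * x i) h = c * val x h"
  by (simp add: val_def reval_scale)

lemma val_unit_zero: "x \<in> cone \<Longrightarrow> val x u = 0 \<Longrightarrow> val x h = 0"
  using val_bound[of h] val_nonneg[of x h] by force

lemma normalise: "x \<in> cone \<Longrightarrow> val x u > 0 \<Longrightarrow> (\<lambda>i. x i / val x u) \<in> polyh"
  using scale_cone[of x "1 / val x u"] val_scale[of "1 / val x u" x u] by (simp add: polyh_iff)

lemma val_extremal: "x \<in> polyh \<Longrightarrow> val x \<in> extremal_states u"
  by (auto simp: extremal_states_def hoop_state_def polyh_iff val_nonneg val_zero val_add val_diff)

lemma extremal_heval: "e \<in> extremal_states u \<Longrightarrow> s \<in> hterms n \<Longrightarrow> e (heval g s) = reval (coords e) s"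
proof (induction s)
  case (HGen i)
  hence "i < n" by (auto elim: hterms.cases)
  thus ?case by (simp add: coords_def)
next
  case HZero thus ?case by (simp add: extremal_states_def hoop_state_def)
next
  case (HAdd s t)
  hence "s \<in> hterms n" "t \<in> hterms n" by (auto elim: hterms.cases)
  thus ?case using HAdd by (simp add: extremal_states_def hoop_state_def)
next
  case (HSub s t)
  hence "s \<in> hterms n" "t \<in> hterms n" by (auto elim: hterms.cases)
  thus ?case using HSub by (simp add: extremal_states_def hoop_state_def)
qed

lemma coords_polyh:
  assumes e: "e \<in> extremal_states u"
  shows "coords e \<in> polyh"
proof -
  have "\<forall>h. 0 \<le> e h" using e by (simp add: extremal_states_def hoop_state_def)
  moreover have "reval (coords e) s = reval (coords e) t" if "(s, t) \<in> E" for s t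
  proof -
    have st: "s \<in> hterms n" "t \<in> hterms n" using that Esub by auto
    hence "heval g s = heval g t" using kernel that hoop_cong.eqn by blast
    thus ?thesis using extremal_heval[OF e] st by metis
  qed
  ultimately have "coords e \<in> cone" by (auto simp: cone_def coords_def)
  moreover have "reval (coords e) ut = 1"
    using extremal_heval[OF e ut(1)] ut(2) e by (simp add: extremal_states_def hoop_state_def)
  ultimately show ?thesis by (simp add: polyh_def)
qed

lemma val_coords: "e \<in> extremal_states u \<Longrightarrow> val (coords e) = e"
  unfolding val_def using extremal_heval tm by fastforce

lemma coords_val: "x \<in> cone \<Longrightarrow> coords (val x) = x"
  by (auto simp: coords_def val_gen cone_def fun_eq_iff)

end

text \<open>A nonzero element survives in a totally ordered quotient by a prime ideal. Pulling back the order
  to the integer linear forms in the generators reduces the claim to finitely many linear inequalities.\<close>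

lemma (in presented_hoop) exists_val_pos:
  assumes h: "h \<noteq> 0"
  shows "\<exists>x\<in>polyh. val x h > 0"
proof -
  obtain M where M: "hoop_ideal M" "h \<notin> M" and tot: "\<And>a b. a - b \<in> M \<or> b - a \<in> M"
    by (rule prime_hoop_ideal_exists[OF h]) blast
  have M0: "0 \<in> M" and Madd: "\<And>x y. x \<in> M \<Longrightarrow> y \<in> M \<Longrightarrow> x + y \<in> M"
    and Mdown: "\<And>x y. y \<in> M \<Longrightarrow> hoop_le x y \<Longrightarrow> x \<in> M"
    using M(1) unfolding hoop_ideal_def by blast+
  \<comment> \<open>The order of the totally ordered quotient by \<open>M\<close>, kept as a total
    preorder on the hoop itself.\<close>
  define le where "le x y \<longleftrightarrow> x - y \<in> M" for x y :: 'a
  have le_refl: "le x x" for x using M0 by (simp add: le_def hoop_diff_self)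
  have le_trans: "le x z" if "le x y" "le y z" for x y z
  proof -
    have "hoop_le x (y + (x - y))" "hoop_le y (z + (y - z))"
      using hoop_le_add hoop_divisible by metis+
    hence "hoop_le x ((z + (y - z)) + (x - y))" using hoop_add_mono hoop_le_refl hoop_le_trans by metis
    hence "hoop_le (x - z) ((y - z) + (x - y))" by (simp add: hoop_diff_le_iff add.assoc)
    thus ?thesis using that Madd Mdown unfolding le_def by blast
  qed
  have le_cancel: "le (x + z) (y + z) \<longleftrightarrow> le x y" for x y z by (simp add: le_def hoop_add_diff_add)
  have le_total: "le x y \<or> le y x" for x y using tot by (simp add: le_def)
  have le_zero: "le 0 x" for x using M0 by (simp add: le_def)
  define eqv where "eqv x y \<longleftrightarrow> le x y \<and> le y x" for x y
  have eqv_refl: "eqv x x" for x by (simp add: eqv_def le_refl)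
  have eqv_sym: "eqv x y \<Longrightarrow> eqv y x" for x y by (simp add: eqv_def)
  have eqv_trans: "eqv x y \<Longrightarrow> eqv y z \<Longrightarrow> eqv x z" for x y z using le_trans by (auto simp: eqv_def)
  have eqv_add: "eqv (x + x') (y + y')" if "eqv x y" "eqv x' y'" for x y x' y'
  proof -
    have "eqv (x + x') (y + x')" using that by (simp add: eqv_def le_cancel)
    moreover have "eqv (y + x') (y + y')" using that by (simp add: eqv_def le_cancel add.commute[of y])
    ultimately show ?thesis by (rule eqv_trans)
  qed
  have le_eqv: "le x y \<longleftrightarrow> le x' y'" if "eqv x x'" "eqv y y'" for x y x' y'
    using that le_trans unfolding eqv_def by blast
  define sp where "sp p = (\<Sum>i<n. \<Sum>j<p i. g i)" for p :: "nat \<Rightarrow> nat"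
  have nadd: "(\<Sum>j<k + l. z) = (\<Sum>j<k. z) + (\<Sum>j<l. z)" for k l :: nat and z :: 'a
    by (induction k) (simp_all add: ac_simps)
  have sp_add: "sp (\<lambda>i. p i + q i) = sp p + sp q" for p q
    by (simp add: sp_def nadd sum.distrib)
  have sp_zero: "sp (\<lambda>i. 0) = 0" by (simp add: sp_def)
  have sp_unit: "sp (\<lambda>j. if j = i then 1 else 0) = g i" if "i < n" for i
  proof -
    have "sp (\<lambda>j. if j = i then 1 else 0) = (\<Sum>j<n. if j = i then g j else 0)"
      unfolding sp_def by (intro sum.cong) auto
    thus ?thesis using that by simp
  qed
  \<comment> \<open>An integer form counts as nonnegative when the sum of generators given by its
    negative part is below the one given by its positive part. The next fact shows that any other
    splitting into \<open>p\<close> minus \<open>q\<close> decides the same.\<close>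
  define Q where "Q = {a. le (sp (\<lambda>i. nat (- a i))) (sp (\<lambda>i. nat (a i)))}"
  have Q: "a \<in> Q \<longleftrightarrow> le (sp q) (sp p)" if "\<And>i. a i = int (p i) - int (q i)" for a p q
  proof -
    have "(\<lambda>i. p i + nat (- a i)) = (\<lambda>i. q i + nat (a i))" using that by auto
    hence eq: "sp p + sp (\<lambda>i. nat (- a i)) = sp q + sp (\<lambda>i. nat (a i))"
      unfolding sp_add[symmetric] by simp
    have "le (sp q) (sp p) \<longleftrightarrow> le (sp q + sp (\<lambda>i. nat (a i))) (sp p + sp (\<lambda>i. nat (a i)))" by (simp add: le_cancel)
    also have "\<dots> \<longleftrightarrow> le (sp (\<lambda>i. nat (- a i)) + sp p) (sp (\<lambda>i. nat (a i)) + sp p)"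
      unfolding eq[symmetric] by (simp add: add.commute)
    finally show ?thesis by (simp add: le_cancel Q_def)
  qed
  have le_add: "le (x + x') (y + y')" if "le x y" "le x' y'" for x y x' y'
  proof -
    have "le (x + x') (y + x')" using that by (simp add: le_cancel)
    moreover have "le (y + x') (y + y')" using that by (simp add: le_cancel add.commute[of y])
    ultimately show ?thesis by (rule le_trans)
  qed
  have cone: "total_cone Q"
    unfolding total_cone_def
  proof (intro conjI ballI allI)
    show "(\<lambda>i. 0) \<in> Q" by (simp add: Q_def le_refl)
  next
    fix a b assume ab: "a \<in> Q" "b \<in> Q"
    have "le (sp (\<lambda>i. nat (- a i) + nat (- b i))) (sp (\<lambda>i. nat (a i) + nat (b i)))"
      using ab le_add unfolding sp_add Q_def by blast
    thus "(\<lambda>i. a i + b i) \<in> Q" by (subst Q) auto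
  next
    fix a show "a \<in> Q \<or> (\<lambda>i. - a i) \<in> Q" using le_total by (auto simp: Q_def)
  qed
  \<comment> \<open>Modulo \<open>M\<close>, \<open>x\<close> is the formal difference of two sums
    of generators; the subtrahend is moved to the other side because hoop subtraction
    truncates.\<close>
  define rel where "rel x a \<longleftrightarrow> (\<exists>p q. (\<forall>i. a i = int (p i) - int (q i)) \<and> eqv (x + sp q) (sp p))" for x a
  have relI: "rel x a" if "\<And>i. a i = int (p i) - int (q i)" "eqv (x + sp q) (sp p)" for x a p q
    using that unfolding rel_def by blast
  have cmp: "(\<lambda>i. a i - b i) \<in> Q \<longleftrightarrow> le y x" if r: "rel x a" "rel y b" for x y a b
  proof -
    obtain p q where pq: "\<forall>i. a i = int (p i) - int (q i)" "eqv (x + sp q) (sp p)" using r(1) unfolding rel_def by blast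
    obtain p' q' where pq': "\<forall>i. b i = int (p' i) - int (q' i)" "eqv (y + sp q') (sp p')" using r(2) unfolding rel_def by blast
    have "(\<lambda>i. a i - b i) \<in> Q \<longleftrightarrow> le (sp (\<lambda>i. q i + p' i)) (sp (\<lambda>i. p i + q' i))"
      by (rule Q) (simp add: pq pq')
    also have "\<dots> \<longleftrightarrow> le (sp q + (y + sp q')) ((x + sp q) + sp q')"
      unfolding sp_add by (rule le_eqv) (intro eqv_add eqv_refl eqv_sym[OF pq(2)] eqv_sym[OF pq'(2)])+
    also have "\<dots> \<longleftrightarrow> le (y + (sp q + sp q')) (x + (sp q + sp q'))" by (simp add: ac_simps)
    finally show ?thesis by (simp add: le_cancel)
  qed
  have rel: "rel (heval g s) (hlin Q s)" if "s \<in> hterms n" for s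
    using that
  proof (induction rule: hterms.induct)
    case (gen i)
    show ?case by (rule relI[of _ "\<lambda>j. if j = i then 1 else 0" "\<lambda>j. 0"]) (auto simp: sp_unit sp_zero gen eqv_refl)
  next
    case zero
    show ?case by (rule relI[of _ "\<lambda>j. 0" "\<lambda>j. 0"]) (auto simp: sp_zero eqv_refl)
  next
    case (add s t)
    obtain p q where pq: "\<forall>i. hlin Q s i = int (p i) - int (q i)" "eqv (heval g s + sp q) (sp p)" using add unfolding rel_def by blast
    obtain p' q' where pq': "\<forall>i. hlin Q t i = int (p' i) - int (q' i)" "eqv (heval g t + sp q') (sp p')" using add unfolding rel_def by blast
    have "eqv ((heval g s + sp q) + (heval g t + sp q')) (sp p + sp p')" by (rule eqv_add[OF pq(2) pq'(2)])
    thus ?case by (intro relI[of _ "\<lambda>j. p j + p' j" "\<lambda>j. q j + q' j"]) (auto simp: pq pq' sp_add ac_simps)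
  next
    case (sub s t)
    let ?d = "\<lambda>i. hlin Q s i - hlin Q t i"
    have d: "?d \<in> Q \<longleftrightarrow> le (heval g t) (heval g s)" by (rule cmp) (use sub in auto)
    show ?case
    proof (cases "?d \<in> Q")
      case True
      define x y where "x = heval g s" and "y = heval g t"
      obtain p q where pq: "\<forall>i. hlin Q s i = int (p i) - int (q i)" "eqv (x + sp q) (sp p)" using sub unfolding rel_def x_def by blast
      obtain p' q' where pq': "\<forall>i. hlin Q t i = int (p' i) - int (q' i)" "eqv (y + sp q') (sp p')" using sub unfolding rel_def y_def by blast
      have "y - x \<in> M" using True d by (simp add: le_def x_def y_def)
      hence "eqv (y - x) 0" using M0 by (simp add: eqv_def le_def)
      hence "eqv (x + (y - x)) (x + 0)" by (intro eqv_add eqv_refl)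
      \<comment> \<open>As \<open>y\<close> is below \<open>x\<close> modulo \<open>M\<close>,
        nothing is truncated and \<open>x - y\<close> is a genuine difference.\<close>
      hence e1: "eqv ((x - y) + y) x" using hoop_divisible[of x y] by (simp add: add.commute)
      have "eqv ((x - y) + (sp q + sp p')) ((x - y) + (sp q + (y + sp q')))"
        by (intro eqv_add eqv_refl eqv_sym[OF pq'(2)])
      also have "(x - y) + (sp q + (y + sp q')) = ((x - y) + y) + (sp q + sp q')" by (simp add: ac_simps)
      finally have "eqv ((x - y) + (sp q + sp p')) (((x - y) + y) + (sp q + sp q'))" .
      moreover have "eqv (((x - y) + y) + (sp q + sp q')) (x + (sp q + sp q'))" by (intro eqv_add e1 eqv_refl)
      moreover have "eqv (x + (sp q + sp q')) (sp p + sp q')"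
        using eqv_add[OF pq(2) eqv_refl[of "sp q'"]] by (simp add: ac_simps)
      ultimately have "eqv ((x - y) + (sp q + sp p')) (sp p + sp q')" using eqv_trans by blast
      hence "rel (x - y) ?d"
        by (intro relI[of _ "\<lambda>j. p j + q' j" "\<lambda>j. q j + p' j"]) (auto simp: pq pq' sp_add)
      thus ?thesis using True by (simp add: x_def y_def)
    next
      case False
      hence "le (heval g s) (heval g t)" using d le_total by blast
      hence "eqv (heval g s - heval g t) 0" using M0 by (simp add: eqv_def le_def)
      hence "rel (heval g s - heval g t) (\<lambda>i. 0)"
        by (intro relI[of _ "\<lambda>j. 0" "\<lambda>j. 0"]) (auto simp: sp_zero)
      thus ?thesis using False by simp
    qed
  qed
  define sh where "sh = tm h"
  \<comment> \<open>The finitely many forms whose signs must be reproduced: every comparison inside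
    a relation or inside the term for \<open>h\<close>, the difference of the two sides of a
    relation, the value of \<open>h\<close>, and the coordinates.\<close>
  define B where "B = (\<Union>(s, t)\<in>E. hcmp s \<union> hcmp t \<union> {\<lambda>i. hlin Q s i - hlin Q t i}) \<union> hcmp sh \<union> {hlin Q sh}
    \<union> (\<lambda>k. \<lambda>i. if i = k then 1 else 0) ` {..<n}"
  define A where "A = B \<union> (\<lambda>a. \<lambda>i. - a i) ` B"
  have "finite B" unfolding B_def using finE
    by (intro finite_UnI finite_UN_I) (auto simp: finite_hcmp split: prod.splits)
  hence finA: "finite A" by (simp add: A_def)
  have suppB: "a i = 0" if aB: "a \<in> B" and i: "i \<ge> n" for a i
  proof -
    have E1: "s \<in> hterms n" and E2: "t \<in> hterms n" if "(s, t) \<in> E" for s t using that Esub by auto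
    from aB consider s t where "(s, t) \<in> E" "a \<in> hcmp s \<or> a \<in> hcmp t \<or> a = (\<lambda>i. hlin Q s i - hlin Q t i)"
      | "a \<in> hcmp sh \<or> a = hlin Q sh" | k where "k < n" "a = (\<lambda>i. if i = k then 1 else 0)"
      unfolding B_def by blast
    thus ?thesis
    proof cases
      case (1 s t)
      thus ?thesis using E1[OF 1(1)] E2[OF 1(1)] hcmp_support hforms_support[OF _ hlin_in_hforms] i by fastforce
    next
      case 2
      thus ?thesis using tm(1)[of h] hcmp_support hforms_support[OF _ hlin_in_hforms] i unfolding sh_def by blast
    next
      case 3 thus ?thesis using i by auto
    qed
  qed
  have suppA: "a i = 0" if "a \<in> A" "i \<ge> n" for a i using that suppB by (auto simp: A_def)
  have "\<exists>x'. \<forall>a\<in>A. (a \<in> Q \<longrightarrow> 0 \<le> lform n a x') \<and> (a \<in> Q \<and> (\<lambda>i. - a i) \<notin> Q \<longrightarrow> 0 < lform n a x')"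
    by (rule total_cone_realised[OF cone finA]) (rule suppA)
  then obtain x' where x': "\<And>a. a \<in> A \<Longrightarrow> (a \<in> Q \<longrightarrow> 0 \<le> lform n a x') \<and> (a \<in> Q \<and> (\<lambda>i. - a i) \<notin> Q \<longrightarrow> 0 < lform n a x')"
    by blast
  define x where "x i = (if i < n then x' i else 0)" for i
  have lx: "lform n a x = lform n a x'" for a by (simp add: lform_def x_def)
  have pos: "0 \<le> lform n a x" if "a \<in> B" "a \<in> Q" for a using x'[of a] that by (simp add: A_def lx)
  have spos: "0 < lform n a x" if "a \<in> B" "a \<in> Q" "(\<lambda>i. - a i) \<notin> Q" for a using x'[of a] that by (simp add: A_def lx)
  \<comment> \<open>Off \<open>Q\<close> the negated form is strictly positive for the preorder, and
    it belongs to \<open>A\<close>.\<close>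
  have neg: "lform n a x < 0" if "a \<in> B" "a \<notin> Q" for a
  proof -
    have "(\<lambda>i. - a i) \<in> Q" using cone that(2) by (auto simp: total_cone_def)
    moreover have "(\<lambda>i. - a i) \<in> A" using that by (auto simp: A_def)
    moreover have "(\<lambda>i. - (\<lambda>i. - a i) i) \<notin> Q" using that by simp
    ultimately have "0 < lform n (\<lambda>i. - a i) x'" using x' by blast
    thus ?thesis by (simp add: lx lform_minus)
  qed
  have ev: "reval x s = lform n (hlin Q s) x" if "s \<in> hterms n" "hcmp s \<subseteq> B" for s
    by (rule reval_eq_lform) (use that pos neg in \<open>auto simp: less_imp_le subset_iff\<close>)
  have "x \<in> cone" unfolding cone_def
  proof (intro CollectI conjI allI impI ballI)
    fix i assume i: "i < n"
    have "(\<lambda>j. if j = i then 1 else 0) \<in> Q"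
      using Q[of _ "\<lambda>j. if j = i then 1 else 0" "\<lambda>j. 0"] le_zero by (auto simp: sp_zero)
    moreover have "(\<lambda>j. if j = i then 1 else 0) \<in> B" using i by (auto simp: B_def)
    ultimately have "0 \<le> lform n (\<lambda>j. if j = i then 1 else 0) x" using pos by blast
    thus "0 \<le> x i" using i by (simp add: lform_unit)
  next
    fix i assume "i \<ge> n" thus "x i = 0" by (simp add: x_def)
  next
    fix st assume st: "st \<in> E"
    obtain s t where [simp]: "st = (s, t)" by (cases st)
    have s: "s \<in> hterms n" and t: "t \<in> hterms n" using st Esub by auto
    have sB: "hcmp s \<subseteq> B" and tB: "hcmp t \<subseteq> B" and dB: "(\<lambda>i. hlin Q s i - hlin Q t i) \<in> B"
      using st by (auto simp: B_def)
    have eq: "heval g s = heval g t" using kernel s t st hoop_cong.eqn by auto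
    have d1: "(\<lambda>i. hlin Q s i - hlin Q t i) \<in> Q" using cmp[OF rel[OF s] rel[OF t]] eq le_refl by simp
    have d2: "(\<lambda>i. hlin Q t i - hlin Q s i) \<in> Q" using cmp[OF rel[OF t] rel[OF s]] eq le_refl by simp
    have "(\<lambda>i. - (hlin Q s i - hlin Q t i)) \<in> A" unfolding A_def by (intro UnI2 image_eqI[OF _ dB]) simp
    hence "0 \<le> lform n (\<lambda>i. - (hlin Q s i - hlin Q t i)) x'" using x' d2 by auto
    hence "lform n (\<lambda>i. hlin Q s i - hlin Q t i) x \<le> 0" using lform_minus[of n "\<lambda>i. hlin Q s i - hlin Q t i" x] lx by simp
    hence "lform n (hlin Q s) x = lform n (hlin Q t) x" using pos[OF dB d1] by (simp add: lform_diff)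
    thus "case st of (s, t) \<Rightarrow> reval x s = reval x t" using ev[OF s sB] ev[OF t tB] by simp
  qed
  moreover have "val x h > 0"
  proof -
    have shB: "hcmp sh \<subseteq> B" "hlin Q sh \<in> B" by (auto simp: B_def)
    have z: "rel 0 (\<lambda>i. 0)" by (rule relI[of _ "\<lambda>j. 0" "\<lambda>j. 0"]) (auto simp: sp_zero eqv_refl)
    have r: "rel h (hlin Q sh)" using rel[of sh] tm[of h] by (simp add: sh_def)
    have "hlin Q sh \<in> Q" using cmp[OF r z] le_zero by simp
    moreover have "(\<lambda>i. - hlin Q sh i) \<notin> Q" using cmp[OF z r] M(2) by (simp add: le_def)
    ultimately have "0 < lform n (hlin Q sh) x" using spos shB by blast
    thus ?thesis using ev[of sh] shB tm[of h] by (simp add: val_def sh_def)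
  qed
  ultimately have xc: "x \<in> cone" and xp: "val x h > 0" by auto
  have up: "val x u > 0" using val_unit_zero[OF xc, of h] val_nonneg[OF xc, of u] xp by force
  have "val (\<lambda>i. x i / val x u) h > 0" using val_scale[of "1 / val x u" x h] up xp by simp
  thus ?thesis using normalise[OF xc up] by blast
qed

section \<open>Rational subspaces and Riemann sums\<close>

text \<open>A rational subspace \<open>V\<close> is parametrised by its coordinates in
  \<open>I\<close>: the matrix \<open>c\<close> has common denominator \<open>M\<close>, and its
  rows with index in \<open>I\<close> act as the identity. Thus \<open>card I\<close> is the
  dimension of \<open>V\<close>.\<close>

definition lin_param :: "(nat \<Rightarrow> real) set \<Rightarrow> nat set \<Rightarrow> (nat \<Rightarrow> nat \<Rightarrow> real) \<Rightarrow> nat \<Rightarrow> bool" where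
  "lin_param V I c M \<longleftrightarrow> finite I \<and> M > 0 \<and> (\<forall>j i. real M * c j i \<in> \<int>) \<and>
     (\<forall>x\<in>V. \<forall>j. x j = (\<Sum>i\<in>I. c j i * x i)) \<and>
     (\<forall>y. (\<lambda>j. \<Sum>i\<in>I. c j i * y i) \<in> V \<and> (\<forall>i\<in>I. (\<Sum>k\<in>I. c i k * y k) = y i))"

lemma lform_param: "lform n a (\<lambda>j. \<Sum>i\<in>I. c j i * y i) = (\<Sum>i\<in>I. (\<Sum>j<n. real_of_int (a j) * c j i) * y i)"
proof -
  have "lform n a (\<lambda>j. \<Sum>i\<in>I. c j i * y i) = (\<Sum>j<n. \<Sum>i\<in>I. real_of_int (a j) * c j i * y i)"
    by (simp add: lform_def sum_distrib_left mult.assoc)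
  also have "\<dots> = (\<Sum>i\<in>I. \<Sum>j<n. real_of_int (a j) * c j i * y i)" by (rule sum.swap)
  finally show ?thesis by (simp add: sum_distrib_right)
qed

text \<open>Gaussian elimination, one equation at a time: the new form either vanishes on the
  subspace found so far or allows one of its coordinates to be eliminated.\<close>

lemma lin_param_exists:
  assumes "finite A"
  shows "\<exists>I c M. lin_param {x. (\<forall>j\<ge>n. x j = 0) \<and> (\<forall>a\<in>A. lform n a x = 0)} I c M"
  using assms
proof (induction rule: finite_induct)
  case empty
  define c :: "nat \<Rightarrow> nat \<Rightarrow> real" where "c j i = (if j = i then 1 else 0)" for j i
  have s: "(\<Sum>i<n. c j i * y i) = (if j < n then y j else 0)" for j and y :: "nat \<Rightarrow> real"
  proof -
    have "(\<Sum>i<n. c j i * y i) = (\<Sum>i<n. if i = j then y i else 0)" unfolding c_def by (intro sum.cong) auto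
    thus ?thesis by simp
  qed
  have ci: "c j i \<in> \<int>" for j i by (simp add: c_def)
  have "lin_param {x. (\<forall>j\<ge>n. x j = 0) \<and> (\<forall>a\<in>{}. lform n a x = 0)} {..<n} c 1"
    unfolding lin_param_def using ci by (simp add: s)
  thus ?case by blast
next
  case (insert a A)
  let ?V = "\<lambda>A. {x. (\<forall>j\<ge>n. x j = 0) \<and> (\<forall>a\<in>A. lform n a x = 0)}"
  obtain I c M where p: "lin_param (?V A) I c M" using insert.IH by blast
  have fin: "finite I" and M: "M > 0" and int: "\<And>j i. real M * c j i \<in> \<int>"
    and p1: "\<And>x j. x \<in> ?V A \<Longrightarrow> x j = (\<Sum>i\<in>I. c j i * x i)"
    and p2: "\<And>y. (\<lambda>j. \<Sum>i\<in>I. c j i * y i) \<in> ?V A" and p3: "\<And>y i. i \<in> I \<Longrightarrow> (\<Sum>k\<in>I. c i k * y k) = y i"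
    using p unfolding lin_param_def by blast+
  define e where "e i = (\<Sum>j<n. real_of_int (a j) * c j i)" for i
  have le: "lform n a (\<lambda>j. \<Sum>i\<in>I. c j i * y i) = (\<Sum>i\<in>I. e i * y i)" for y
    by (simp add: lform_param e_def)
  have lV: "lform n a x = (\<Sum>i\<in>I. e i * x i)" if "x \<in> ?V A" for x
  proof -
    have "x = (\<lambda>j. \<Sum>i\<in>I. c j i * x i)" using p1[OF that] by blast
    hence "lform n a x = lform n a (\<lambda>j. \<Sum>i\<in>I. c j i * x i)" by (rule arg_cong)
    thus ?thesis by (simp only: le)
  qed
  show ?case
  proof (cases "\<exists>i\<in>I. e i \<noteq> 0")
    case False
    hence "?V (insert a A) = ?V A" using lV by auto
    thus ?thesis using p by metis
  next
    case True
    then obtain i where i: "i \<in> I" "e i \<noteq> 0" by blast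
    define I' where "I' = I - {i}"
    define c' where "c' j k = c j k - c j i * (e k / e i)" for j k
    \<comment> \<open>\<open>real M\<close> clears \<open>c\<close> and \<open>e\<close>, while
      \<open>c'\<close> has the further denominator \<open>e i\<close>; the product of
      \<open>real M\<close> and the integer \<open>\<bar>real M * e i\<bar>\<close> clears
      everything.\<close>
    define M' where "M' = nat \<lfloor>real M * \<bar>real M * e i\<bar>\<rfloor>"
    have eint: "real M * e k \<in> \<int>" for k
    proof -
      have "real M * e k = (\<Sum>j<n. real_of_int (a j) * (real M * c j k))"
        by (simp add: e_def sum_distrib_left algebra_simps)
      also have "\<dots> \<in> \<int>" by (intro Ints_sum Ints_mult Ints_of_int int)
      finally show ?thesis .
    qed
    have "real M * \<bar>real M * e i\<bar> \<in> \<int>" using eint[of i] by (intro Ints_mult) (auto simp: Ints_abs)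
    moreover have pos: "real M * \<bar>real M * e i\<bar> > 0" using M i by simp
    ultimately have M': "real M' = real M * \<bar>real M * e i\<bar>" unfolding M'_def by (auto elim!: Ints_cases)
    hence M'pos: "M' > 0" using pos by simp
    have int': "real M' * c' j k \<in> \<int>" for j k
    proof -
      have "real M' * c' j k = sgn (e i) * ((real M * e i) * (real M * c j k) - (real M * c j i) * (real M * e k))"
        unfolding M' c'_def using i M by (simp add: abs_mult field_simps sgn_if)
      also have "\<dots> \<in> \<int>" by (intro Ints_mult[OF _ Ints_diff[OF Ints_mult[OF eint int] Ints_mult[OF int eint]]]) (auto simp: sgn_if)
      finally show ?thesis .
    qed
    have conv: "(\<Sum>k\<in>I. c j k * y k) = (\<Sum>k\<in>I'. c' j k * y k)" if "(\<Sum>k\<in>I. e k * y k) = 0" for j y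
    proof -
      have "0 = e i * y i + (\<Sum>k\<in>I'. e k * y k)"
        using that sum.remove[OF fin i(1), of "\<lambda>k. e k * y k"] by (simp add: I'_def)
      hence yi: "y i = - (\<Sum>k\<in>I'. e k * y k) / e i" using i by (simp add: field_simps)
      have "(\<Sum>k\<in>I. c j k * y k) = c j i * y i + (\<Sum>k\<in>I'. c j k * y k)"
        using sum.remove[OF fin i(1), of "\<lambda>k. c j k * y k"] by (simp add: I'_def)
      also have "c j i * y i = - (\<Sum>k\<in>I'. c j i * (e k / e i) * y k)"
        unfolding yi by (simp add: sum_divide_distrib sum_distrib_left mult.assoc)
      also have "\<dots> + (\<Sum>k\<in>I'. c j k * y k) = (\<Sum>k\<in>I'. c' j k * y k)"
        by (simp add: c'_def left_diff_distrib sum_subtractf)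
      finally show ?thesis .
    qed
    have 1: "x j = (\<Sum>k\<in>I'. c' j k * x k)" if "x \<in> ?V (insert a A)" for x j
    proof -
      have xA: "x \<in> ?V A" using that by auto
      have "(\<Sum>k\<in>I. e k * x k) = 0" using lV[OF xA] that by simp
      thus ?thesis using conv[of x j] p1[OF xA, of j] by simp
    qed
    have 2: "(\<lambda>j. \<Sum>k\<in>I'. c' j k * y k) \<in> ?V (insert a A) \<and> (\<forall>k\<in>I'. (\<Sum>l\<in>I'. c' k l * y l) = y k)" for y
    proof -
      \<comment> \<open>The eliminated coordinate is set to the value that solves the new
        equation.\<close>
      define y' where "y' = y(i := - (\<Sum>k\<in>I'. e k * y k) / e i)"
      have yy: "(\<Sum>k\<in>I'. f k * y' k) = (\<Sum>k\<in>I'. f k * y k)" for f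
        by (intro sum.cong) (auto simp: y'_def I'_def)
      have z: "(\<Sum>k\<in>I. e k * y' k) = 0"
        using sum.remove[OF fin i(1), of "\<lambda>k. e k * y' k"] i yy[of e] by (simp add: I'_def y'_def)
      have eq: "(\<lambda>j. \<Sum>k\<in>I'. c' j k * y k) = (\<lambda>j. \<Sum>k\<in>I. c j k * y' k)"
        using conv[OF z] yy by simp
      have "(\<lambda>j. \<Sum>k\<in>I'. c' j k * y k) \<in> ?V (insert a A)"
        unfolding eq using p2[of y'] le[of y'] z by simp
      moreover have "(\<Sum>l\<in>I'. c' k l * y l) = y k" if "k \<in> I'" for k
        using fun_cong[OF eq, of k] p3[of k y'] that by (auto simp: I'_def y'_def)
      ultimately show ?thesis by blast
    qed
    have "lin_param (?V (insert a A)) I' c' M'"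
      unfolding lin_param_def using fin M'pos int' 1 2 by (auto simp: I'_def)
    thus ?thesis by blast
  qed
qed

lemma product_sigma_finite_lborel: "product_sigma_finite (\<lambda>_. lborel :: real measure)"
  by (simp add: product_sigma_finite_def sigma_finite_lborel)

text \<open>By Fubini in direction \<open>i\<close>: each line in that direction meets the
  hyperplane in a single point.\<close>

lemma PiM_hyperplane_null:
  fixes I :: "nat set"
  assumes I: "finite I" and i: "i \<in> I" "e i \<noteq> (0::real)"
  shows "AE y in PiM I (\<lambda>_. lborel). (\<Sum>k\<in>I. e k * y k) \<noteq> c"
proof -
  interpret product_sigma_finite "\<lambda>_. lborel :: real measure" by (rule product_sigma_finite_lborel)
  define J where "J = I - {i}"
  have IJ: "I = insert i J" "i \<notin> J" "finite J" using i I by (auto simp: J_def)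
  let ?S = "{y \<in> space (PiM I (\<lambda>_. lborel)). (\<Sum>k\<in>I. e k * y k) = c}"
  have meas: "?S \<in> sets (PiM I (\<lambda>_. lborel))" by measurable
  have "emeasure (PiM I (\<lambda>_. lborel)) ?S = (\<integral>\<^sup>+ y. indicator ?S y \<partial>PiM (insert i J) (\<lambda>_. lborel))"
    using meas IJ(1) by simp
  also have "\<dots> = (\<integral>\<^sup>+ x. (\<integral>\<^sup>+ t. indicator ?S (x(i := t)) \<partial>lborel) \<partial>PiM J (\<lambda>_. lborel))"
    using meas IJ by (intro product_nn_integral_insert) (auto simp: borel_measurable_indicator)
  also have "\<dots> = (\<integral>\<^sup>+ x. 0 \<partial>PiM J (\<lambda>_. lborel :: real measure))"
  proof (rule nn_integral_cong)
    fix x :: "nat \<Rightarrow> real"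
    let ?t = "(c - (\<Sum>k\<in>J. e k * x k)) / e i"
    have "indicator ?S (x(i := t)) \<le> (indicator {?t} t :: ennreal)" for t
    proof -
      have "t = ?t" if "(\<Sum>k\<in>I. e k * (x(i := t)) k) = c"
      proof -
        have "(\<Sum>k\<in>J. e k * (x(i := t)) k) = (\<Sum>k\<in>J. e k * x k)" using IJ by (intro sum.cong) auto
        hence "e i * t + (\<Sum>k\<in>J. e k * x k) = c" using that IJ by simp
        thus ?thesis using i by (simp add: field_simps)
      qed
      thus ?thesis by (auto simp: indicator_def)
    qed
    hence "(\<integral>\<^sup>+ t. indicator ?S (x(i := t)) \<partial>lborel) \<le> (\<integral>\<^sup>+ t. indicator {?t} t \<partial>(lborel :: real measure))"
      by (intro nn_integral_mono) auto
    thus "(\<integral>\<^sup>+ t. indicator ?S (x(i := t)) \<partial>lborel) = 0" by simp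
  qed
  finally have "emeasure (PiM I (\<lambda>_. lborel)) ?S = 0" by simp
  hence "?S \<in> null_sets (PiM I (\<lambda>_. lborel))" using meas by (auto simp: null_sets_def)
  thus ?thesis by (rule AE_I') auto
qed

lemma measure_PiM_box:
  fixes I :: "nat set"
  assumes I: "finite I" and l: "\<And>i. i \<in> I \<Longrightarrow> l i \<le> u i"
  shows "emeasure (PiM I (\<lambda>_. lborel :: real measure)) (PiE I (\<lambda>i. {l i..<u i})) = ennreal (\<Prod>i\<in>I. u i - l i)"
proof -
  interpret product_sigma_finite "\<lambda>_. lborel :: real measure" by (rule product_sigma_finite_lborel)
  have "emeasure (PiM I (\<lambda>_. lborel)) (PiE I (\<lambda>i. {l i..<u i})) = (\<Prod>i\<in>I. emeasure lborel {l i..<u i})"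
    using I by (intro emeasure_PiM) auto
  also have "\<dots> = (\<Prod>i\<in>I. ennreal (u i - l i))" using l by (intro prod.cong) auto
  also have "\<dots> = ennreal (\<Prod>i\<in>I. u i - l i)" using l by (intro prod_ennreal) auto
  finally show ?thesis .
qed

text \<open>Continuity in the finitely many coordinates \<open>I\<close>. The test points range over
  \<open>extensional I\<close>, where the product measure lives.\<close>

definition box_continuous_at :: "nat set \<Rightarrow> ((nat \<Rightarrow> real) \<Rightarrow> real) \<Rightarrow> (nat \<Rightarrow> real) \<Rightarrow> bool" where
  "box_continuous_at I \<phi> y \<longleftrightarrow>
     (\<forall>\<eta>>0. \<exists>\<delta>>0. \<forall>z\<in>extensional I. (\<forall>i\<in>I. \<bar>z i - y i\<bar> < \<delta>) \<longrightarrow> \<bar>\<phi> z - \<phi> y\<bar> < \<eta>)"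

lemma riemann_sum_integrable:
  fixes \<phi> :: "(nat \<Rightarrow> real) \<Rightarrow> real"
  assumes I: "finite I" and \<phi>: "\<phi> \<in> borel_measurable (PiM I (\<lambda>_. lborel :: real measure))"
    and bd: "\<And>y. \<bar>\<phi> y\<bar> \<le> m" and supp: "\<And>y i. \<phi> y \<noteq> 0 \<Longrightarrow> i \<in> I \<Longrightarrow> \<bar>y i\<bar> \<le> b" and b: "b \<ge> 0"
  shows "integrable (PiM I (\<lambda>_. lborel)) \<phi>"
    "integrable (PiM I (\<lambda>_. lborel)) (\<lambda>x. m * indicator (PiE I (\<lambda>i. {- b..<b + 1})) x)"
proof -
  have m: "m \<ge> 0" using bd[of undefined] abs_ge_zero[of "\<phi> undefined"] by linarith
  have "emeasure (PiM I (\<lambda>_. lborel)) (PiE I (\<lambda>i. {- b..<b + 1})) = ennreal (\<Prod>i\<in>I. b + 1 - (- b))"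
    using b by (intro measure_PiM_box[OF I]) auto
  hence fin: "emeasure (PiM I (\<lambda>_. lborel)) (PiE I (\<lambda>i. {- b..<b + 1})) < \<infinity>" by simp
  have "PiE I (\<lambda>i. {- b..<b + 1}) \<in> sets (PiM I (\<lambda>_. lborel))" using I by (intro sets_PiM_I_finite) auto
  thus int: "integrable (PiM I (\<lambda>_. lborel)) (\<lambda>x. m * indicator (PiE I (\<lambda>i. {- b..<b + 1})) x)"
    using fin by (intro integrable_mult_right integrable_real_indicator) auto
  show "integrable (PiM I (\<lambda>_. lborel)) \<phi>"
  proof (rule Bochner_Integration.integrable_bound[OF int \<phi>], rule AE_I2)
    fix x assume x: "x \<in> space (PiM I (\<lambda>_. lborel :: real measure))"
    show "norm (\<phi> x) \<le> norm (m * indicator (PiE I (\<lambda>i. {- b..<b + 1})) x :: real)"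
    proof (cases "\<phi> x = 0")
      case False
      hence "x \<in> PiE I (\<lambda>i. {- b..<b + 1})" using supp[OF False] x by (force simp: space_PiM PiE_iff)
      thus ?thesis using bd[of x] m by simp
    qed simp
  qed
qed

text \<open>The normalised sum is the integral of a step function, constant on grid boxes of side
  \<open>\<epsilon> k\<close>, which converges at every continuity point; dominated convergence does
  the rest. The offset \<open>\<rho>\<close> serves the cosets of a sublattice.\<close>

lemma riemann_sums_converge:
  fixes \<phi> :: "(nat \<Rightarrow> real) \<Rightarrow> real" and \<epsilon> :: "nat \<Rightarrow> real" and Z :: "nat \<Rightarrow> (nat \<Rightarrow> int) set"
  assumes I: "finite I" and \<phi>: "\<phi> \<in> borel_measurable (PiM I (\<lambda>_. lborel :: real measure))"
    and bd: "\<And>y. \<bar>\<phi> y\<bar> \<le> m" and supp: "\<And>y i. \<phi> y \<noteq> 0 \<Longrightarrow> i \<in> I \<Longrightarrow> \<bar>y i\<bar> \<le> b" and b: "b \<ge> 0"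
    and cont: "AE y in PiM I (\<lambda>_. lborel). box_continuous_at I \<phi> y"
    and \<epsilon>: "\<And>k. \<epsilon> k > 0" "\<epsilon> \<longlonglongrightarrow> 0" and \<rho>: "\<And>i. \<bar>\<rho> i\<bar> \<le> 1"
    and Z: "\<And>k. finite (Z k)" "\<And>k. Z k \<subseteq> PiE I (\<lambda>_. UNIV)"
      "\<And>k z. z \<in> PiE I (\<lambda>_. UNIV) \<Longrightarrow> \<phi> (\<lambda>i\<in>I. \<epsilon> k * (real_of_int (z i) + \<rho> i)) \<noteq> 0 \<Longrightarrow> z \<in> Z k"
  shows "(\<lambda>k. \<epsilon> k ^ card I * (\<Sum>z\<in>Z k. \<phi> (\<lambda>i\<in>I. \<epsilon> k * (real_of_int (z i) + \<rho> i))))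
            \<longlonglongrightarrow> integral\<^sup>L (PiM I (\<lambda>_. lborel)) \<phi>"
proof -
  let ?P = "PiM I (\<lambda>_. lborel :: real measure)"
  define pt where "pt k z = (\<lambda>i\<in>I. \<epsilon> k * (real_of_int (z i) + \<rho> i))" for k z
  define fl where "fl k x = (\<lambda>i\<in>I. \<lfloor>x i / \<epsilon> k\<rfloor>)" for k and x :: "nat \<Rightarrow> real"
  define S where "S k x = \<phi> (pt k (fl k x))" for k x
  define box where "box k z = PiE I (\<lambda>i. {\<epsilon> k * real_of_int (z i)..<\<epsilon> k * (real_of_int (z i) + 1)})" for k and z :: "nat \<Rightarrow> int"
  have boxI: "x \<in> box k z \<longleftrightarrow> z = fl k x" if "x \<in> space ?P" "z \<in> PiE I (\<lambda>_. UNIV)" for x k z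
  proof -
    have e: "\<epsilon> k > 0" by (rule \<epsilon>(1))
    have "x i \<in> {\<epsilon> k * real_of_int (z i)..<\<epsilon> k * (real_of_int (z i) + 1)} \<longleftrightarrow> z i = \<lfloor>x i / \<epsilon> k\<rfloor>" for i
    proof -
      have "z i = \<lfloor>x i / \<epsilon> k\<rfloor> \<longleftrightarrow> real_of_int (z i) \<le> x i / \<epsilon> k \<and> x i / \<epsilon> k < real_of_int (z i) + 1"
        by (metis floor_eq_iff)
      thus ?thesis using e by (auto simp: field_simps)
    qed
    hence "x \<in> box k z \<longleftrightarrow> (\<forall>i\<in>I. z i = \<lfloor>x i / \<epsilon> k\<rfloor>)" using that(1) by (auto simp: box_def PiE_iff space_PiM)
    also have "\<dots> \<longleftrightarrow> z = fl k x" using that(2) by (auto simp: fl_def PiE_iff extensional_def fun_eq_iff)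
    finally show ?thesis .
  qed
  have boxm: "box k z \<in> sets ?P" for k z unfolding box_def using I by (intro sets_PiM_I_finite) auto
  have boxe: "emeasure ?P (box k z) = ennreal (\<epsilon> k ^ card I)" for k z
  proof -
    have "emeasure ?P (box k z) = ennreal (\<Prod>i\<in>I. \<epsilon> k * (real_of_int (z i) + 1) - \<epsilon> k * real_of_int (z i))"
      unfolding box_def using \<epsilon>(1)[of k] by (intro measure_PiM_box[OF I]) (auto simp: algebra_simps)
    also have "(\<Prod>i\<in>I. \<epsilon> k * (real_of_int (z i) + 1) - \<epsilon> k * real_of_int (z i)) = \<epsilon> k ^ card I"
      by (simp add: algebra_simps)
    finally show ?thesis .
  qed
  have Ssum: "S k x = (\<Sum>z\<in>Z k. \<phi> (pt k z) * indicator (box k z) x)" if x: "x \<in> space ?P" for k x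
  proof -
    have "(\<Sum>z\<in>Z k. \<phi> (pt k z) * indicator (box k z) x) = (\<Sum>z\<in>Z k. if z = fl k x then \<phi> (pt k z) else 0)"
    proof (intro sum.cong HOL.refl)
      fix z assume "z \<in> Z k"
      hence "x \<in> box k z \<longleftrightarrow> z = fl k x" using boxI[OF x] Z(2) by blast
      thus "\<phi> (pt k z) * indicator (box k z) x = (if z = fl k x then \<phi> (pt k z) else 0)" by (simp add: indicator_def)
    qed
    also have "\<dots> = (if fl k x \<in> Z k then \<phi> (pt k (fl k x)) else 0)" using Z(1) by simp
    also have "\<dots> = S k x"
    proof -
      have "fl k x \<in> PiE I (\<lambda>_. UNIV)" by (auto simp: fl_def)
      thus ?thesis using Z(3)[of "fl k x" k] by (auto simp: S_def pt_def)
    qed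
    finally show ?thesis by simp
  qed
  have Sm: "S k \<in> borel_measurable ?P" for k
  proof -
    have "(\<lambda>x. \<Sum>z\<in>Z k. \<phi> (pt k z) * indicator (box k z) x) \<in> borel_measurable ?P"
      using boxm by (intro borel_measurable_sum borel_measurable_times borel_measurable_indicator) auto
    thus ?thesis using measurable_cong[of ?P "S k" "\<lambda>x. \<Sum>z\<in>Z k. \<phi> (pt k z) * indicator (box k z) x" borel] Ssum by blast
  qed
  have Sint: "integral\<^sup>L ?P (S k) = \<epsilon> k ^ card I * (\<Sum>z\<in>Z k. \<phi> (pt k z))" for k
  proof -
    have "integral\<^sup>L ?P (S k) = integral\<^sup>L ?P (\<lambda>x. \<Sum>z\<in>Z k. \<phi> (pt k z) * indicator (box k z) x)"
      by (intro Bochner_Integration.integral_cong HOL.refl Ssum)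
    also have "\<dots> = (\<Sum>z\<in>Z k. integral\<^sup>L ?P (\<lambda>x. \<phi> (pt k z) * indicator (box k z) x))"
      using boxm boxe by (intro Bochner_Integration.integral_sum integrable_mult_right integrable_real_indicator) auto
    also have "\<dots> = (\<Sum>z\<in>Z k. \<phi> (pt k z) * \<epsilon> k ^ card I)"
    proof (intro sum.cong HOL.refl)
      fix z
      have "measure ?P (box k z) = \<epsilon> k ^ card I" unfolding measure_def boxe using \<epsilon>(1)[of k] by simp
      thus "integral\<^sup>L ?P (\<lambda>x. \<phi> (pt k z) * indicator (box k z) x) = \<phi> (pt k z) * \<epsilon> k ^ card I"
        using boxm[of k z] by (simp add: sets.sets_into_space Int_absorb2)
    qed
    finally show ?thesis by (simp add: sum_distrib_left mult.commute)
  qed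
  obtain e0 where e0: "e0 > 0" "\<And>k. \<epsilon> k \<le> e0"
  proof -
    have "Bseq \<epsilon>" using \<epsilon>(2) convergent_imp_Bseq convergentI by blast
    then obtain K where "K > 0" "\<And>k. norm (\<epsilon> k) \<le> K" by (auto simp: Bseq_def)
    thus ?thesis using that[of K] by (metis abs_le_D1 real_norm_def)
  qed
  \<comment> \<open>Rounding down costs at most \<open>\<epsilon> k\<close>, and the offset at most
    another \<open>\<epsilon> k\<close>.\<close>
  have near: "\<bar>pt k (fl k x) i - x i\<bar> \<le> 2 * \<epsilon> k" if "i \<in> I" for k x i
  proof -
    have e: "\<epsilon> k > 0" by (rule \<epsilon>(1))
    have "pt k (fl k x) i - x i = \<epsilon> k * ((real_of_int \<lfloor>x i / \<epsilon> k\<rfloor> - x i / \<epsilon> k) + \<rho> i)"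
      using that e by (simp add: pt_def fl_def algebra_simps)
    moreover have "\<bar>(real_of_int \<lfloor>x i / \<epsilon> k\<rfloor> - x i / \<epsilon> k) + \<rho> i\<bar> \<le> 2" using \<rho>[of i] by linarith
    ultimately show ?thesis using e by (simp add: abs_mult mult.commute)
  qed
  have m: "m \<ge> 0" using bd[of undefined] abs_ge_zero[of "\<phi> undefined"] by linarith
  have "(\<lambda>k. integral\<^sup>L ?P (S k)) \<longlonglongrightarrow> integral\<^sup>L ?P \<phi>"
  \<comment> \<open>The support is enlarged by \<open>2 * e0\<close>, since a sample point may be
    that far from the point at which the step function is evaluated.\<close>
  proof (rule integral_dominated_convergence[where w = "\<lambda>x. m * indicator (PiE I (\<lambda>i. {- (b + 2 * e0)..<b + 2 * e0 + 1})) x"])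
    show "\<phi> \<in> borel_measurable ?P" by (rule \<phi>)
    show "S k \<in> borel_measurable ?P" for k by (rule Sm)
    show "integrable ?P (\<lambda>x. m * indicator (PiE I (\<lambda>i. {- (b + 2 * e0)..<b + 2 * e0 + 1})) x)"
      by (rule riemann_sum_integrable(2)[OF I \<phi> bd]) (use supp b e0 in \<open>force+\<close>)
  next
    show "AE x in ?P. (\<lambda>k. S k x) \<longlonglongrightarrow> \<phi> x"
      using cont
    proof eventually_elim
      case (elim x)
      show ?case
      proof (rule LIMSEQ_I)
        fix \<eta> :: real assume "\<eta> > 0"
        then obtain \<delta> where d: "\<delta> > 0" "\<And>z. z \<in> extensional I \<Longrightarrow> (\<forall>i\<in>I. \<bar>z i - x i\<bar> < \<delta>) \<Longrightarrow> \<bar>\<phi> z - \<phi> x\<bar> < \<eta>"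
          using elim unfolding box_continuous_at_def by blast
        obtain K where K: "\<And>k. k \<ge> K \<Longrightarrow> \<bar>\<epsilon> k\<bar> < \<delta> / 2"
          using LIMSEQ_D[OF \<epsilon>(2), of "\<delta> / 2"] d(1) by auto
        have "norm (S k x - \<phi> x) < \<eta>" if "k \<ge> K" for k
        proof -
          have "\<bar>pt k (fl k x) i - x i\<bar> < \<delta>" if "i \<in> I" for i
            using near[OF that, of k x] K[OF \<open>k \<ge> K\<close>] by linarith
          thus ?thesis using d(2)[of "pt k (fl k x)"] by (simp add: S_def pt_def)
        qed
        thus "\<exists>K. \<forall>k\<ge>K. norm (S k x - \<phi> x) < \<eta>" by blast
      qed
    qed
  next
    fix k
    show "AE x in ?P. norm (S k x) \<le> m * indicator (PiE I (\<lambda>i. {- (b + 2 * e0)..<b + 2 * e0 + 1})) x"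
    proof (rule AE_I2)
      fix x assume x: "x \<in> space ?P"
      show "norm (S k x) \<le> m * indicator (PiE I (\<lambda>i. {- (b + 2 * e0)..<b + 2 * e0 + 1})) x"
      proof (cases "S k x = 0")
        case True thus ?thesis using m by (simp add: indicator_def)
      next
        case False
        have "x i \<in> {- (b + 2 * e0)..<b + 2 * e0 + 1}" if i: "i \<in> I" for i
        proof -
          have "\<bar>pt k (fl k x) i\<bar> \<le> b" using supp[OF _ i] False by (auto simp: S_def)
          hence "\<bar>x i\<bar> \<le> b + 2 * e0" using near[OF i, of k x] e0(2)[of k] by linarith
          thus ?thesis by auto
        qed
        hence "x \<in> PiE I (\<lambda>i. {- (b + 2 * e0)..<b + 2 * e0 + 1})" using x by (auto simp: space_PiM PiE_iff)
        thus ?thesis using bd by (simp add: S_def)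
      qed
    qed
  qed
  thus ?thesis unfolding Sint pt_def .
qed

text \<open>On some box at \<open>y\<close> of positive measure the function is at least
  \<open>\<phi> y / 2\<close>.\<close>

lemma integral_pos_of_continuity_point:
  fixes \<phi> :: "(nat \<Rightarrow> real) \<Rightarrow> real"
  assumes I: "finite I" and \<phi>: "\<phi> \<in> borel_measurable (PiM I (\<lambda>_. lborel :: real measure))"
    and bd: "\<And>y. \<bar>\<phi> y\<bar> \<le> m" and supp: "\<And>y i. \<phi> y \<noteq> 0 \<Longrightarrow> i \<in> I \<Longrightarrow> \<bar>y i\<bar> \<le> b" and b: "b \<ge> 0"
    and nn: "\<And>y. 0 \<le> \<phi> y" and y: "box_continuous_at I \<phi> y" "\<phi> y > 0"
  shows "0 < integral\<^sup>L (PiM I (\<lambda>_. lborel)) \<phi>"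
proof -
  let ?P = "PiM I (\<lambda>_. lborel :: real measure)"
  obtain \<delta> where d: "\<delta> > 0" "\<And>z. z \<in> extensional I \<Longrightarrow> (\<forall>i\<in>I. \<bar>z i - y i\<bar> < \<delta>) \<Longrightarrow> \<bar>\<phi> z - \<phi> y\<bar> < \<phi> y / 2"
    using y unfolding box_continuous_at_def by (metis half_gt_zero)
  let ?B = "PiE I (\<lambda>i. {y i..<y i + \<delta>})"
  have Bm: "?B \<in> sets ?P" using I by (intro sets_PiM_I_finite) auto
  have Be: "emeasure ?P ?B = ennreal (\<delta> ^ card I)"
    using measure_PiM_box[OF I, of y "\<lambda>i. y i + \<delta>"] d by simp
  have int: "integrable ?P (\<lambda>x. \<phi> y / 2 * indicator ?B x)"
    using Bm Be by (intro integrable_mult_right integrable_real_indicator) auto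
  have "measure ?P ?B = \<delta> ^ card I" unfolding measure_def Be using d by simp
  hence "integral\<^sup>L ?P (\<lambda>x. \<phi> y / 2 * indicator ?B x) = \<phi> y / 2 * \<delta> ^ card I"
    using Bm by (simp add: sets.sets_into_space Int_absorb2)
  moreover have "integral\<^sup>L ?P (\<lambda>x. \<phi> y / 2 * indicator ?B x) \<le> integral\<^sup>L ?P \<phi>"
  proof (rule integral_mono[OF int])
    show "integrable ?P \<phi>"
      by (rule riemann_sum_integrable(1)[OF I \<phi>, where m = m and b = b]) (use bd supp b in auto)
  next
    fix x
    show "\<phi> y / 2 * indicator ?B x \<le> \<phi> x"
    proof (cases "x \<in> ?B")
      case True
      hence "\<bar>\<phi> x - \<phi> y\<bar> < \<phi> y / 2" by (intro d(2)) (auto simp: PiE_iff abs_if)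
      thus ?thesis using True by (simp add: abs_if split: if_splits)
    next
      case False thus ?thesis using nn by simp
    qed
  qed
  moreover have "\<phi> y / 2 * \<delta> ^ card I > 0" using y d by simp
  ultimately show ?thesis by linarith
qed

text \<open>An integral parameter vector need not give an integral point of \<open>V\<close>,
  because \<open>c\<close> is only rational. It does so for finitely many residues modulo
  \<open>M\<close>, so the integral points form finitely many cosets of the image of
  \<open>M\<close> times the integer grid, and each coset gives a Riemann sum with an
  offset.\<close>

lemma lattice_sums_converge:
  fixes \<Phi> :: "(nat \<Rightarrow> real) \<Rightarrow> real" and V :: "(nat \<Rightarrow> real) set"
  assumes p: "lin_param V I c M"
  defines "\<psi> \<equiv> \<lambda>y j. \<Sum>i\<in>I. c j i * y i"
  assumes \<phi>: "(\<lambda>y. \<Phi> (\<psi> y)) \<in> borel_measurable (PiM I (\<lambda>_. lborel :: real measure))"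
    and bd: "\<And>y. \<bar>\<Phi> (\<psi> y)\<bar> \<le> m" and supp: "\<And>y i. \<Phi> (\<psi> y) \<noteq> 0 \<Longrightarrow> i \<in> I \<Longrightarrow> \<bar>y i\<bar> \<le> b" and b: "b \<ge> 0"
    and cont: "AE y in PiM I (\<lambda>_. lborel). box_continuous_at I (\<lambda>y. \<Phi> (\<psi> y)) y"
  defines "T \<equiv> \<lambda>N::nat. {v\<in>V. (\<forall>j. v j \<in> \<int>) \<and> \<Phi> (\<lambda>j. v j / real N) \<noteq> 0}"
  shows "\<And>N. N \<ge> 1 \<Longrightarrow> finite (T N)"
    "\<exists>d>0. (\<lambda>N. (\<Sum>v\<in>T N. \<Phi> (\<lambda>j. v j / real N)) / real N ^ card I)
        \<longlonglongrightarrow> d * integral\<^sup>L (PiM I (\<lambda>_. lborel)) (\<lambda>y. \<Phi> (\<psi> y))"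
proof -
  have fin: "finite I" and M: "M > 0" and int: "\<And>j i. real M * c j i \<in> \<int>"
    and p1: "\<And>x j. x \<in> V \<Longrightarrow> x j = (\<Sum>i\<in>I. c j i * x i)"
    and p2: "\<And>y. \<psi> y \<in> V" and p3: "\<And>y i. i \<in> I \<Longrightarrow> \<psi> y i = y i"
    using p unfolding lin_param_def \<psi>_def by blast+
  define L where "L = {\<rho> \<in> PiE I (\<lambda>_. {0..<int M}). \<forall>j. \<psi> (\<lambda>i. real_of_int (\<rho> i)) j \<in> \<int>}"
  have finL: "finite L" unfolding L_def using fin by (intro finite_subset[OF _ finite_PiE[of I "\<lambda>_. {0..<int M}"]]) auto
  have L0: "(\<lambda>i\<in>I. 0) \<in> L"
  proof -
    have "\<psi> (\<lambda>i. real_of_int ((\<lambda>i\<in>I. 0) i)) j = 0" for j unfolding \<psi>_def by (rule sum.neutral) auto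
    thus ?thesis using M by (auto simp: L_def)
  qed
  hence cL: "card L > 0" using finL card_gt_0_iff by blast
  define pt where "pt N \<rho> w = (\<lambda>i\<in>I. real M / real N * (real_of_int (w i) + real_of_int (\<rho> i) / real M))"
    for N :: nat and \<rho> w :: "nat \<Rightarrow> int"
  define Z where "Z N \<rho> = {w \<in> PiE I (\<lambda>_. UNIV). \<Phi> (\<psi> (pt N \<rho> w)) \<noteq> 0}" for N \<rho>
  define G where "G = (\<lambda>(\<rho>, w). \<psi> (\<lambda>i. real_of_int (\<rho> i + int M * w i)))"
  have \<psi>cong: "\<psi> y = \<psi> y'" if "\<And>i. i \<in> I \<Longrightarrow> y i = y' i" for y y'
    unfolding \<psi>_def by (intro ext sum.cong) (auto simp: that)
  have pt: "\<psi> (pt N \<rho> w) = (\<lambda>j. G (\<rho>, w) j / real N)" for N \<rho> w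
  proof -
    have "\<psi> (pt N \<rho> w) = \<psi> (\<lambda>i. real_of_int (\<rho> i + int M * w i) / real N)"
      using M by (intro \<psi>cong) (cases "N = 0"; auto simp: pt_def field_simps)
    thus ?thesis by (simp add: \<psi>_def G_def sum_divide_distrib)
  qed
  have Gint: "G (\<rho>, w) j = \<psi> (\<lambda>i. real_of_int (\<rho> i)) j + (\<Sum>i\<in>I. (real M * c j i) * real_of_int (w i))" for \<rho> w j
    by (simp add: G_def \<psi>_def sum.distrib algebra_simps)
  have Zfin: "finite (Z N \<rho>)" if "N \<ge> 1" "\<rho> \<in> L" for N \<rho>
  proof -
    define K where "K = \<lceil>b * real N + 1\<rceil>"
    have "Z N \<rho> \<subseteq> PiE I (\<lambda>_. {- K..K})"
    proof
      fix w assume w: "w \<in> Z N \<rho>"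
      have "w i \<in> {- K..K}" if i: "i \<in> I" for i
      proof -
        have rh: "0 \<le> real_of_int (\<rho> i)" "real_of_int (\<rho> i) \<le> real M"
          using \<open>\<rho> \<in> L\<close> i by (auto simp: L_def PiE_iff less_imp_le)
        have "\<bar>pt N \<rho> w i\<bar> \<le> b" using supp[OF _ i] w by (auto simp: Z_def)
        hence "\<bar>real M / real N * (real_of_int (w i) + real_of_int (\<rho> i) / real M)\<bar> \<le> b" using i by (simp add: pt_def)
        hence "real M / real N * \<bar>real_of_int (w i) + real_of_int (\<rho> i) / real M\<bar> \<le> b" by (simp add: abs_mult)
        hence "\<bar>real_of_int (w i) + real_of_int (\<rho> i) / real M\<bar> \<le> b * real N / real M"
          using M \<open>N \<ge> 1\<close> by (simp add: field_simps)
        also have "\<dots> \<le> b * real N / 1" using M b by (intro divide_left_mono) auto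
        finally have "\<bar>real_of_int (w i) + real_of_int (\<rho> i) / real M\<bar> \<le> b * real N" by simp
        moreover have "0 \<le> real_of_int (\<rho> i) / real M" "real_of_int (\<rho> i) / real M \<le> 1" using rh M by auto
        ultimately have "\<bar>real_of_int (w i)\<bar> \<le> b * real N + 1" by linarith
        hence "\<bar>real_of_int (w i)\<bar> \<le> real_of_int K" unfolding K_def by linarith
        thus ?thesis by auto
      qed
      thus "w \<in> PiE I (\<lambda>_. {- K..K})" using w by (auto simp: Z_def PiE_iff)
    qed
    thus ?thesis using fin finite_PiE[of I "\<lambda>_. {- K..K}"] finite_subset by auto
  qed
  have bij: "bij_betw G (SIGMA \<rho>:L. Z N \<rho>) (T N)" if N: "N \<ge> 1" for N
    unfolding bij_betw_def
  proof
    show "inj_on G (SIGMA \<rho>:L. Z N \<rho>)"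
    proof (rule inj_onI, clarify)
      fix \<rho> w \<rho>' w' assume h: "\<rho> \<in> L" "w \<in> Z N \<rho>" "\<rho>' \<in> L" "w' \<in> Z N \<rho>'" and eq: "G (\<rho>, w) = G (\<rho>', w')"
      have key: "\<rho> i = \<rho>' i \<and> w i = w' i" if i: "i \<in> I" for i
      proof -
        have "real_of_int (\<rho> i + int M * w i) = real_of_int (\<rho>' i + int M * w' i)"
          using fun_cong[OF eq, of i] p3[OF i] by (simp only: G_def prod.case)
        hence e: "\<rho> i + int M * w i = \<rho>' i + int M * w' i" by (simp only: of_int_eq_iff)
        have r: "0 \<le> \<rho> i" "\<rho> i < int M" "0 \<le> \<rho>' i" "\<rho>' i < int M" using h i by (auto simp: L_def PiE_iff)
        have "(\<rho> i + int M * w i) mod int M = \<rho> i" "(\<rho>' i + int M * w' i) mod int M = \<rho>' i" using r by auto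
        hence "\<rho> i = \<rho>' i" using e by simp
        thus ?thesis using e M by simp
      qed
      have "\<rho> = \<rho>'" using h key by (intro PiE_ext[of \<rho> I "\<lambda>_. {0..<int M}"]) (auto simp: L_def)
      moreover have "w = w'" using h key by (intro PiE_ext[of w I "\<lambda>_. UNIV"]) (auto simp: Z_def)
      ultimately show "\<rho> = \<rho>' \<and> w = w'" by simp
    qed
  next
    show "G ` (SIGMA \<rho>:L. Z N \<rho>) = T N"
    proof (intro equalityI subsetI)
      fix v assume "v \<in> G ` (SIGMA \<rho>:L. Z N \<rho>)"
      then obtain \<rho> w where h: "\<rho> \<in> L" "w \<in> Z N \<rho>" "v = G (\<rho>, w)" by auto
      have "v \<in> V" unfolding h(3) G_def using p2 by simp
      moreover have "v j \<in> \<int>" for j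
        unfolding h(3) Gint using h(1) int by (intro Ints_add Ints_sum Ints_mult[OF int]) (auto simp: L_def)
      moreover have "\<Phi> (\<lambda>j. v j / real N) \<noteq> 0" using h(2) by (simp add: Z_def pt h(3))
      ultimately show "v \<in> T N" by (simp add: T_def)
    next
      fix v assume v: "v \<in> T N"
      have vV: "v \<in> V" and vint: "\<And>j. v j \<in> \<int>" and vn: "\<Phi> (\<lambda>j. v j / real N) \<noteq> 0" using v by (auto simp: T_def)
      define \<rho> where "\<rho> = (\<lambda>i\<in>I. \<lfloor>v i\<rfloor> mod int M)"
      define w where "w = (\<lambda>i\<in>I. \<lfloor>v i\<rfloor> div int M)"
      have "G (\<rho>, w) = \<psi> v"
      proof -
        have "real_of_int (\<rho> i + int M * w i) = v i" if "i \<in> I" for i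
        proof -
          have "\<rho> i + int M * w i = \<lfloor>v i\<rfloor>" using that by (simp add: \<rho>_def w_def)
          moreover have "real_of_int \<lfloor>v i\<rfloor> = v i" using vint[of i] by (auto elim: Ints_cases)
          ultimately show ?thesis by simp
        qed
        thus ?thesis unfolding G_def by (simp only: prod.case) (rule \<psi>cong)
      qed
      also have "\<psi> v = v" by (rule ext) (simp only: \<psi>_def p1[OF vV, symmetric])
      finally have Gv: "G (\<rho>, w) = v" .
      have "\<psi> (\<lambda>i. real_of_int (\<rho> i)) j \<in> \<int>" for j
      proof -
        have "\<psi> (\<lambda>i. real_of_int (\<rho> i)) j = v j - (\<Sum>i\<in>I. (real M * c j i) * real_of_int (w i))"
          using Gint[of \<rho> w j] Gv by simp
        also have "\<dots> \<in> \<int>" using vint by (intro Ints_diff Ints_sum Ints_mult[OF int]) auto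
        finally show ?thesis .
      qed
      hence "\<rho> \<in> L" using M by (auto simp: L_def \<rho>_def)
      moreover have "w \<in> Z N \<rho>" using vn by (auto simp: Z_def pt Gv) (auto simp: w_def)
      ultimately show "v \<in> G ` (SIGMA \<rho>:L. Z N \<rho>)" using Gv by (force intro!: image_eqI[of _ _ "(\<rho>, w)"])
    qed
  qed
  show finT: "finite (T N)" if N: "N \<ge> 1" for N
  proof -
    have "finite (SIGMA \<rho>:L. Z N \<rho>)" by (rule finite_SigmaI[OF finL]) (rule Zfin[OF N])
    thus ?thesis using bij_betw_finite[OF bij[OF N]] by blast
  qed
  have sumT: "(\<Sum>v\<in>T N. \<Phi> (\<lambda>j. v j / real N)) = (\<Sum>\<rho>\<in>L. \<Sum>w\<in>Z N \<rho>. \<Phi> (\<psi> (pt N \<rho> w)))" if N: "N \<ge> 1" for N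
  proof -
    have "(\<Sum>v\<in>T N. \<Phi> (\<lambda>j. v j / real N)) = (\<Sum>x\<in>(SIGMA \<rho>:L. Z N \<rho>). \<Phi> (\<lambda>j. G x j / real N))"
      using sum.reindex_bij_betw[OF bij[OF N], of "\<lambda>v. \<Phi> (\<lambda>j. v j / real N)"] by simp
    also have "\<dots> = (\<Sum>(\<rho>, w)\<in>(SIGMA \<rho>:L. Z N \<rho>). \<Phi> (\<psi> (pt N \<rho> w)))"
      by (intro sum.cong) (auto simp: pt)
    also have "\<dots> = (\<Sum>\<rho>\<in>L. \<Sum>w\<in>Z N \<rho>. \<Phi> (\<psi> (pt N \<rho> w)))"
      using finL Zfin[OF N] by (subst sum.Sigma) auto
    finally show ?thesis .
  qed
  let ?int = "integral\<^sup>L (PiM I (\<lambda>_. lborel)) (\<lambda>y. \<Phi> (\<psi> y))"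
  have lim: "(\<lambda>k. (real M / real (Suc k)) ^ card I * (\<Sum>w\<in>Z (Suc k) \<rho>. \<Phi> (\<psi> (pt (Suc k) \<rho> w)))) \<longlonglongrightarrow> ?int"
    if \<rho>: "\<rho> \<in> L" for \<rho>
  proof -
    define \<rho>' where "\<rho>' i = (if i \<in> I then real_of_int (\<rho> i) / real M else 0)" for i
    have pt': "pt (Suc k) \<rho> w = (\<lambda>i\<in>I. real M / real (Suc k) * (real_of_int (w i) + \<rho>' i))" for k w
      by (auto simp: pt_def \<rho>'_def)
    have "(\<lambda>k. (real M / real (Suc k)) ^ card I * (\<Sum>w\<in>Z (Suc k) \<rho>.
        (\<lambda>y. \<Phi> (\<psi> y)) (\<lambda>i\<in>I. real M / real (Suc k) * (real_of_int (w i) + \<rho>' i)))) \<longlonglongrightarrow> ?int"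
    proof (rule riemann_sums_converge[OF fin \<phi>, where m = m and b = b])
      show "\<bar>\<Phi> (\<psi> y)\<bar> \<le> m" for y by (rule bd)
      show "\<bar>y i\<bar> \<le> b" if "\<Phi> (\<psi> y) \<noteq> 0" "i \<in> I" for y i using supp that by blast
      show "real M / real (Suc k) > 0" for k using M by simp
      show "(\<lambda>k. real M / real (Suc k)) \<longlonglongrightarrow> 0"
        using tendsto_mult_right_zero[OF LIMSEQ_inverse_real_of_nat, of "real M"] by (simp add: divide_inverse)
      show "\<bar>\<rho>' i\<bar> \<le> 1" for i using \<rho> M by (auto simp: \<rho>'_def L_def PiE_iff less_imp_le divide_le_eq_1)
      show "finite (Z (Suc k) \<rho>)" for k using Zfin[of "Suc k" \<rho>] \<rho> by simp
      show "Z (Suc k) \<rho> \<subseteq> PiE I (\<lambda>_. UNIV)" for k by (auto simp: Z_def)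
      show "z \<in> Z (Suc k) \<rho>" if "z \<in> PiE I (\<lambda>_. UNIV)"
        "\<Phi> (\<psi> (\<lambda>i\<in>I. real M / real (Suc k) * (real_of_int (z i) + \<rho>' i))) \<noteq> 0" for k z
        using that by (simp add: Z_def pt')
    qed (use b cont in auto)
    thus ?thesis unfolding pt' .
  qed
  \<comment> \<open>The density of the integral points in parameter space: \<open>card L\<close>
    residues out of \<open>M ^ card I\<close>.\<close>
  define d where "d = real (card L) / real M ^ card I"
  have "(\<lambda>k. \<Sum>\<rho>\<in>L. 1 / real M ^ card I * ((real M / real (Suc k)) ^ card I * (\<Sum>w\<in>Z (Suc k) \<rho>. \<Phi> (\<psi> (pt (Suc k) \<rho> w)))))
      \<longlonglongrightarrow> (\<Sum>\<rho>\<in>L. 1 / real M ^ card I * ?int)"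
    by (intro tendsto_sum tendsto_mult_left lim)
  moreover have "(\<Sum>\<rho>\<in>L. 1 / real M ^ card I * ?int) = d * ?int" by (simp add: d_def)
  moreover have "(\<Sum>\<rho>\<in>L. 1 / real M ^ card I * ((real M / real (Suc k)) ^ card I * (\<Sum>w\<in>Z (Suc k) \<rho>. \<Phi> (\<psi> (pt (Suc k) \<rho> w)))))
      = (\<Sum>v\<in>T (Suc k). \<Phi> (\<lambda>j. v j / real (Suc k))) / real (Suc k) ^ card I" for k
  proof -
    have "(\<Sum>v\<in>T (Suc k). \<Phi> (\<lambda>j. v j / real (Suc k))) / real (Suc k) ^ card I =
        (\<Sum>\<rho>\<in>L. (\<Sum>w\<in>Z (Suc k) \<rho>. \<Phi> (\<psi> (pt (Suc k) \<rho> w))) / real (Suc k) ^ card I)"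
      using sumT[of "Suc k"] by (simp add: sum_divide_distrib)
    also have "\<dots> = (\<Sum>\<rho>\<in>L. 1 / real M ^ card I * ((real M / real (Suc k)) ^ card I * (\<Sum>w\<in>Z (Suc k) \<rho>. \<Phi> (\<psi> (pt (Suc k) \<rho> w)))))"
      using M by (intro sum.cong) (auto simp: power_divide)
    finally show ?thesis by simp
  qed
  ultimately have "(\<lambda>k. (\<Sum>v\<in>T (Suc k). \<Phi> (\<lambda>j. v j / real (Suc k))) / real (Suc k) ^ card I) \<longlonglongrightarrow> d * ?int" by simp
  hence "(\<lambda>N. (\<Sum>v\<in>T N. \<Phi> (\<lambda>j. v j / real N)) / real N ^ card I) \<longlonglongrightarrow> d * ?int"
    by (rule filterlim_sequentially_Suc[THEN iffD1])
  moreover have "d > 0" using cL M by (simp add: d_def)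
  ultimately show "\<exists>d>0. (\<lambda>N. (\<Sum>v\<in>T N. \<Phi> (\<lambda>j. v j / real N)) / real N ^ card I) \<longlonglongrightarrow> d * ?int" by blast
qed

section \<open>Sums over divisors\<close>

text \<open>The term \<open>- 1 / real N\<close> makes the induction work: \<open>1 / k ^ 2\<close>
  is at most \<open>1 / (k - 1) - 1 / k\<close>, so the sum telescopes. The constant is
  \<open>3 / 4 = 1 / 4 + 1 / 2\<close>, with equality at \<open>N = 2\<close>.\<close>

lemma sum_inverse_square_le: "N \<ge> 2 \<Longrightarrow> (\<Sum>k=2..N. 1 / real k ^ 2) \<le> 3 / 4 - 1 / real N"
proof (induction N rule: dec_induct)
  case base thus ?case by simp
next
  case (step N)
  have "1 / real (Suc N) ^ 2 \<le> 1 / (real N * real (Suc N))"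
    using step by (intro divide_left_mono) (auto simp: power2_eq_square)
  also have "\<dots> = 1 / real N - 1 / real (Suc N)" using step by (simp add: field_simps)
  finally show ?case using step by simp
qed

lemma sum_inverse_power_le:
  assumes "r \<ge> 2"
  shows "(\<Sum>k=2..N. 1 / real k ^ r) \<le> 3 / 4"
proof (cases "N \<ge> 2")
  case True
  have "(\<Sum>k=2..N. 1 / real k ^ r) \<le> (\<Sum>k=2..N. 1 / real k ^ 2)"
    using assms by (intro sum_mono divide_left_mono power_increasing) auto
  also have "\<dots> \<le> 3 / 4" using sum_inverse_square_le[OF True] by (smt (verit) divide_nonneg_nonneg of_nat_0_le_iff)
  finally show ?thesis .
qed simp

lemma div_power_le: "k \<ge> 1 \<Longrightarrow> real (N div k) ^ r \<le> real N ^ r * (1 / real k ^ r)"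
proof -
  assume k: "k \<ge> 1"
  have "real (N div k * k) \<le> real N" by (subst of_nat_le_iff) simp
  hence "real (N div k) \<le> real N / real k" using k by (simp add: field_simps)
  hence "real (N div k) ^ r \<le> (real N / real k) ^ r" by (rule power_mono) simp
  thus ?thesis by (simp add: power_divide)
qed

text \<open>A bound \<open>\<bar>Q m\<bar> \<le> \<kappa> m\<^sup>r + A\<close> is improved by the factor \<open>3/4\<close>, because
  \<open>\<Sum>k\<ge>2. 1/k\<^sup>2 \<le> 3/4\<close>.\<close>

lemma divisor_sum_contraction:
  fixes Q :: "nat \<Rightarrow> real"
  assumes r: "r \<ge> 2" and bd: "\<And>m. \<bar>Q m\<bar> \<le> \<kappa> * real m ^ r + A" and \<kappa>: "\<kappa> \<ge> 0" and A: "A \<ge> 0" and N: "N \<ge> 1"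
  shows "\<bar>Q N - (\<Sum>k=1..N. Q (N div k))\<bar> \<le> 3 / 4 * \<kappa> * real N ^ r + A * real N"
proof -
  have "(\<Sum>k=1..N. Q (N div k)) = Q N + (\<Sum>k=2..N. Q (N div k))"
    using N sum.atLeast_Suc_atMost[of 1 N "\<lambda>k. Q (N div k)"] by (simp add: numeral_2_eq_2)
  hence "\<bar>Q N - (\<Sum>k=1..N. Q (N div k))\<bar> = \<bar>\<Sum>k=2..N. Q (N div k)\<bar>" by simp
  also have "\<dots> \<le> (\<Sum>k=2..N. \<bar>Q (N div k)\<bar>)" by (rule sum_abs)
  also have "\<dots> \<le> (\<Sum>k=2..N. \<kappa> * (real N ^ r * (1 / real k ^ r)) + A)"
  proof (rule sum_mono)
    fix k assume "k \<in> {2..N}"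
    hence "\<kappa> * real (N div k) ^ r \<le> \<kappa> * (real N ^ r * (1 / real k ^ r))"
      using \<kappa> by (intro mult_left_mono div_power_le) auto
    thus "\<bar>Q (N div k)\<bar> \<le> \<kappa> * (real N ^ r * (1 / real k ^ r)) + A" using bd[of "N div k"] by linarith
  qed
  also have "\<dots> = \<kappa> * real N ^ r * (\<Sum>k=2..N. 1 / real k ^ r) + A * real (card {2..N})"
    by (simp add: sum.distrib sum_distrib_left mult.assoc)
  also have "\<dots> \<le> \<kappa> * real N ^ r * (3 / 4) + A * real N"
    using sum_inverse_power_le[OF r] \<kappa> A by (intro add_mono mult_left_mono) auto
  finally show ?thesis by (simp add: mult_ac)
qed

lemma linear_over_power_tendsto_0:
  assumes r: "r \<ge> 2"
  shows "(\<lambda>N. A * real N / real N ^ r) \<longlonglongrightarrow> 0"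
proof (rule Lim_null_comparison)
  show "\<forall>\<^sub>F N in sequentially. norm (A * real N / real N ^ r) \<le> \<bar>A\<bar> * (1 / real N)"
  proof (rule eventually_sequentiallyI[of 1])
    fix N :: nat assume N: "N \<ge> 1"
    have "real N ^ 2 \<le> real N ^ r" using N r by (intro power_increasing) auto
    hence "real N / real N ^ r \<le> real N / real N ^ 2" using N by (intro divide_left_mono) auto
    also have "\<dots> = 1 / real N" by (simp add: power2_eq_square)
    finally have "\<bar>A\<bar> * (real N / real N ^ r) \<le> \<bar>A\<bar> * (1 / real N)" by (intro mult_left_mono) auto
    thus "norm (A * real N / real N ^ r) \<le> \<bar>A\<bar> * (1 / real N)" by (simp add: abs_mult)
  qed
  show "(\<lambda>N. \<bar>A\<bar> * (1 / real N)) \<longlonglongrightarrow> 0" using tendsto_mult_right_zero[OF lim_1_over_n] by simp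
qed

text \<open>A bound with leading constant \<open>\<kappa>\<close> improves to
  \<open>7 / 8 * \<kappa> + \<eta>\<close> at the price of another additive constant, because the
  divisor sum itself is negligible. Iteration drives the leading constant to 0.\<close>

lemma divisor_sum_negligible:
  fixes Q :: "nat \<Rightarrow> real"
  assumes r: "r \<ge> 2" and K: "\<And>m. \<bar>Q m\<bar> \<le> K * real m ^ r"
    and G: "(\<lambda>N. (\<Sum>k=1..N. Q (N div k)) / real N ^ r) \<longlonglongrightarrow> 0"
  shows "(\<lambda>N. Q N / real N ^ r) \<longlonglongrightarrow> 0"
proof -
  have K0: "K \<ge> 0" using K[of 1] by simp
  have step: "\<exists>A\<ge>0. \<forall>m. \<bar>Q m\<bar> \<le> (7 / 8 * \<kappa> + \<eta>) * real m ^ r + A"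
    if "\<kappa> \<ge> 0" "A \<ge> 0" "\<forall>m. \<bar>Q m\<bar> \<le> \<kappa> * real m ^ r + A" "\<eta> > 0" for \<kappa> A \<eta>
  proof -
    have "(\<lambda>N. \<bar>(\<Sum>k=1..N. Q (N div k)) / real N ^ r\<bar> + A * real N / real N ^ r) \<longlonglongrightarrow> \<bar>0\<bar> + 0"
      by (intro tendsto_add tendsto_rabs G linear_over_power_tendsto_0[OF r])
    hence "\<forall>\<^sub>F N in sequentially. \<bar>(\<Sum>k=1..N. Q (N div k)) / real N ^ r\<bar> + A * real N / real N ^ r < \<eta>"
      using that(4) by (intro order_tendstoD(2)) auto
    then obtain N0 where N0: "\<And>N. N \<ge> N0 \<Longrightarrow> \<bar>(\<Sum>k=1..N. Q (N div k)) / real N ^ r\<bar> + A * real N / real N ^ r < \<eta>"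
      by (auto simp: eventually_sequentially)
    \<comment> \<open>Absorbs the finitely many \<open>m\<close> at which the asymptotic estimates
      do not apply yet.\<close>
    define B where "B = (\<Sum>m<Suc N0. \<bar>Q m\<bar>)"
    have "\<bar>Q m\<bar> \<le> (7 / 8 * \<kappa> + \<eta>) * real m ^ r + B" for m
    proof (cases "m \<ge> Suc N0")
      case True
      have m: "real m ^ r > 0" using True by simp
      have "\<bar>Q m - (\<Sum>k=1..m. Q (m div k))\<bar> \<le> 3 / 4 * \<kappa> * real m ^ r + A * real m"
        using that True by (intro divisor_sum_contraction[OF r]) auto
      hence "\<bar>Q m\<bar> \<le> 3 / 4 * \<kappa> * real m ^ r + (\<bar>\<Sum>k=1..m. Q (m div k)\<bar> + A * real m)" by linarith
      also have "\<bar>\<Sum>k=1..m. Q (m div k)\<bar> + A * real m \<le> \<eta> * real m ^ r"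
        using N0[of m] True m by (simp add: abs_div field_simps)
      finally have "\<bar>Q m\<bar> \<le> (3 / 4 * \<kappa> + \<eta>) * real m ^ r" by (simp add: algebra_simps)
      also have "\<dots> \<le> (7 / 8 * \<kappa> + \<eta>) * real m ^ r" using that m by (intro mult_right_mono) auto
      also have "\<dots> \<le> \<dots> + B" unfolding B_def by (simp add: sum_nonneg)
      finally show ?thesis .
    next
      case False
      hence "\<bar>Q m\<bar> \<le> B" unfolding B_def by (intro member_le_sum) auto
      moreover have "(7 / 8 * \<kappa> + \<eta>) * real m ^ r \<ge> 0" using that by simp
      ultimately show ?thesis by linarith
    qed
    moreover have "B \<ge> 0" unfolding B_def by (simp add: sum_nonneg)
    ultimately show ?thesis by blast
  qed
  \<comment> \<open>With \<open>\<eta> = \<kappa> / 16\<close> each round multiplies by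
    \<open>15 / 16\<close>; starting from \<open>K + 1\<close> keeps \<open>\<kappa>\<close>
    positive.\<close>
  have iter: "\<exists>A\<ge>0. \<forall>m. \<bar>Q m\<bar> \<le> ((15 / 16) ^ j * (K + 1)) * real m ^ r + A" for j :: nat
  proof (induction j)
    case 0
    have "\<bar>Q m\<bar> \<le> (K + 1) * real m ^ r + 0" for m
    proof -
      have "K * real m ^ r \<le> (K + 1) * real m ^ r" by (intro mult_right_mono) auto
      thus ?thesis using K[of m] by linarith
    qed
    thus ?case by (intro exI[of _ 0]) simp
  next
    case (Suc j)
    let ?\<kappa> = "(15 / 16) ^ j * (K + 1)"
    have pos: "?\<kappa> > 0" using K0 by (intro mult_pos_pos) auto
    obtain A where "A \<ge> 0" "\<forall>m. \<bar>Q m\<bar> \<le> ?\<kappa> * real m ^ r + A" using Suc by blast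
    from step[of ?\<kappa> A "?\<kappa> / 16"] this pos
    obtain A' where "A' \<ge> 0" "\<forall>m. \<bar>Q m\<bar> \<le> (7 / 8 * ?\<kappa> + ?\<kappa> / 16) * real m ^ r + A'" by auto
    moreover have "7 / 8 * ?\<kappa> + ?\<kappa> / 16 = (15 / 16) ^ Suc j * (K + 1)" by (simp add: algebra_simps)
    ultimately show ?case by metis
  qed
  show ?thesis
  proof (rule LIMSEQ_I)
    fix \<eta> :: real assume \<eta>: "\<eta> > 0"
    have "(\<lambda>j. (15 / 16) ^ j * (K + 1)) \<longlonglongrightarrow> 0"
      by (intro tendsto_mult_left_zero LIMSEQ_power_zero) simp
    hence "\<forall>\<^sub>F j in sequentially. (15 / 16) ^ j * (K + 1) < \<eta> / 2" using \<eta> by (intro order_tendstoD(2)) auto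
    then obtain j where j: "(15 / 16 :: real) ^ j * (K + 1) < \<eta> / 2" by (auto simp: eventually_sequentially)
    obtain A where A: "A \<ge> 0" "\<forall>m. \<bar>Q m\<bar> \<le> ((15 / 16) ^ j * (K + 1)) * real m ^ r + A" using iter by blast
    have "\<forall>\<^sub>F N in sequentially. A * real N / real N ^ r < \<eta> / 2"
      using linear_over_power_tendsto_0[OF r, of A] \<eta> by (intro order_tendstoD(2)) auto
    then obtain N0 where N0: "\<And>N. N \<ge> N0 \<Longrightarrow> A * real N / real N ^ r < \<eta> / 2" by (auto simp: eventually_sequentially)
    have "norm (Q N / real N ^ r - 0) < \<eta>" if N: "N \<ge> Suc N0" for N
    proof -
      have p: "real N ^ r > 0" using N by simp
      have "A \<le> A * real N" using A N by (simp add: mult_le_cancel_left1)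
      hence "\<bar>Q N\<bar> \<le> ((15 / 16) ^ j * (K + 1)) * real N ^ r + A * real N" using A(2) by (meson add_left_mono order_trans)
      hence "\<bar>Q N\<bar> / real N ^ r \<le> (((15 / 16) ^ j * (K + 1)) * real N ^ r + A * real N) / real N ^ r"
        using p by (intro divide_right_mono) auto
      also have "\<dots> = (15 / 16) ^ j * (K + 1) + A * real N / real N ^ r" using p by (simp add: add_divide_distrib)
      also have "\<dots> < \<eta>" using j N0[OF Suc_leD[OF N]] by linarith
      finally show ?thesis using p by (simp add: abs_div)
    qed
    thus "\<exists>N0. \<forall>N\<ge>N0. norm (Q N / real N ^ r - 0) < \<eta>" by blast
  qed
qed

text \<open>\<open>P N\<close> is its divisor sum minus the terms with \<open>k \<ge> 2\<close>.
  Once the divisor sum lies between \<open>19 / 20\<close> and \<open>21 / 20\<close> of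
  \<open>C * N ^ r\<close>, the contraction leaves the factor
  \<open>19 / 20 - 63 / 80 - 1 / 80 = 3 / 20\<close>, where \<open>63 / 80\<close> is
  \<open>3 / 4\<close> of \<open>21 / 20\<close>.\<close>

lemma divisor_sum_lower_bound:
  fixes P :: "nat \<Rightarrow> real"
  assumes r: "r \<ge> 2" and P0: "\<And>m. 0 \<le> P m" and C: "C > 0"
    and G: "(\<lambda>N. (\<Sum>k=1..N. P (N div k)) / real N ^ r) \<longlonglongrightarrow> C"
  shows "\<exists>c>0. \<forall>\<^sub>F N in sequentially. c * real N ^ r \<le> P N"
proof -
  let ?G = "\<lambda>N. \<Sum>k=1..N. P (N div k)"
  have "\<forall>\<^sub>F N in sequentially. ?G N / real N ^ r < 21 / 20 * C" using G C by (intro order_tendstoD(2)) auto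
  moreover have "\<forall>\<^sub>F N in sequentially. ?G N / real N ^ r > 19 / 20 * C" using G C by (intro order_tendstoD(1)) auto
  ultimately have "\<forall>\<^sub>F N in sequentially. ?G N / real N ^ r < 21 / 20 * C \<and> ?G N / real N ^ r > 19 / 20 * C"
    by (rule eventually_conj)
  then obtain N0 where N0: "\<And>N. N \<ge> N0 \<Longrightarrow> ?G N / real N ^ r < 21 / 20 * C \<and> ?G N / real N ^ r > 19 / 20 * C"
    by (auto simp: eventually_sequentially)
  have Gb: "?G N < 21 / 20 * C * real N ^ r" "?G N > 19 / 20 * C * real N ^ r" if "N \<ge> Suc N0" for N
    using N0[of N] that by (auto simp: field_simps)
  define A where "A = (\<Sum>m<Suc N0. P m)"
  have A0: "A \<ge> 0" unfolding A_def using P0 by (simp add: sum_nonneg)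
  have up: "\<bar>P m\<bar> \<le> 21 / 20 * C * real m ^ r + A" for m
  proof (cases "m \<ge> Suc N0")
    case True
    have "P m = P (m div 1)" by simp
    also have "\<dots> \<le> ?G m" by (rule member_le_sum) (use True P0 in auto)
    finally show ?thesis using Gb(1)[OF True] P0[of m] A0 by linarith
  next
    case False
    hence "P m \<le> A" unfolding A_def using P0 by (intro member_le_sum) auto
    moreover have "21 / 20 * C * real m ^ r \<ge> 0" using C by simp
    ultimately show ?thesis using P0[of m] by linarith
  qed
  have "\<forall>\<^sub>F N in sequentially. A * real N / real N ^ r < C / 80"
    using linear_over_power_tendsto_0[OF r, of A] C by (intro order_tendstoD(2)) auto
  moreover have "\<forall>\<^sub>F N in sequentially. N \<ge> Suc N0" by (rule eventually_ge_at_top)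
  ultimately have "\<forall>\<^sub>F N in sequentially. 3 / 20 * C * real N ^ r \<le> P N"
  proof eventually_elim
    case (elim N)
    have p: "real N ^ r > 0" using elim by simp
    have "A * real N \<le> C / 80 * real N ^ r" using elim(1) p by (simp add: field_simps)
    moreover have "\<bar>P N - ?G N\<bar> \<le> 3 / 4 * (21 / 20 * C) * real N ^ r + A * real N"
      using up C A0 elim by (intro divisor_sum_contraction[OF r]) auto
    moreover have "?G N > 19 / 20 * C * real N ^ r" using Gb(2) elim by blast
    ultimately show ?case by linarith
  qed
  thus ?thesis using C by (intro exI[of _ "3 / 20 * C"]) simp
qed

section \<open>Cells of the cone of a presentation\<close>

lemma box_continuous_atI:
  fixes \<phi> :: "(nat \<Rightarrow> real) \<Rightarrow> real"
  assumes y: "y \<in> extensional I" "y \<in> O'" "open O'" and \<phi>: "\<And>z. z \<in> O' \<Longrightarrow> \<phi> z = f z" and f: "continuous_on O' f"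
  shows "box_continuous_at I \<phi> y"
  unfolding box_continuous_at_def
proof (intro allI impI)
  fix \<eta> :: real assume \<eta>: "\<eta> > 0"
  define T where "T = O' \<inter> f -` ball (f y) \<eta>"
  have "open T" unfolding T_def using f y(3) by (intro continuous_open_preimage) auto
  moreover have "y \<in> T" using y \<eta> by (simp add: T_def)
  ultimately obtain N \<epsilon> where e: "\<epsilon> > 0" "\<And>z. (\<forall>j<N. \<bar>z j - y j\<bar> < \<epsilon>) \<Longrightarrow> z \<in> T"
    by (rule open_fun_box) blast
  have "\<bar>\<phi> z - \<phi> y\<bar> < \<eta>" if z: "z \<in> extensional I" "\<forall>i\<in>I. \<bar>z i - y i\<bar> < \<epsilon>" for z
  proof -
    \<comment> \<open>Outside \<open>I\<close> both points take the value \<open>undefined\<close>,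
      so their difference is 0.\<close>
    have "\<bar>z j - y j\<bar> < \<epsilon>" for j using z y(1) e(1) by (cases "j \<in> I") (auto simp: extensional_def)
    hence "z \<in> T" using e(2) by blast
    thus ?thesis using \<phi>[of z] \<phi>[OF y(2)] by (auto simp: T_def dist_real_def abs_minus_commute)
  qed
  thus "\<exists>\<delta>>0. \<forall>z\<in>extensional I. (\<forall>i\<in>I. \<bar>z i - y i\<bar> < \<delta>) \<longrightarrow> \<bar>\<phi> z - \<phi> y\<bar> < \<eta>" using e(1) by blast
qed

lemma measurable_reval:
  assumes "\<And>i. i < n \<Longrightarrow> (\<lambda>y. f y i) \<in> borel_measurable M" "s \<in> hterms n"
  shows "(\<lambda>y. reval (f y) s) \<in> borel_measurable M"
  using assms(2,1) by (induction rule: hterms.induct) (auto intro!: borel_measurable_max)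

lemma continuous_on_lform: "continuous_on A (lform n a)"
  unfolding lform_def by (intro continuous_intros)

lemma lform_scale_arg: "lform n a (\<lambda>i. c * x i) = c * lform n a x"
  by (simp add: lform_def sum_distrib_left algebra_simps)

lemma reval_divide: "c > 0 \<Longrightarrow> reval (\<lambda>i. x i / c) s = reval x s / c"
  using reval_scale[of "1 / c" x s] by simp

lemma lform_divide: "lform n a (\<lambda>i. x i / c) = lform n a x / c"
  using lform_scale_arg[of n a "1 / c" x] by simp

context presented_hoop
begin

text \<open>The coordinate forms make nonnegativity visible in signs. For each relation all
  differences of candidate forms are included, so that its two sides are compared whichever branches
  apply.\<close>

definition base_forms :: "(nat \<Rightarrow> int) set" where
  "base_forms = (\<Union>(s, t)\<in>E. hcmp s \<union> hcmp t \<union> (\<lambda>(a, b). \<lambda>i. a i - b i) ` (hforms s \<times> hforms t)) \<union> hcmp ut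
     \<union> (\<lambda>k. \<lambda>i. if i = k then 1 else 0) ` {..<n}"

text \<open>Closing under negation lets the set of nonnegative forms determine the full sign
  vector.\<close>

definition forms :: "(nat \<Rightarrow> int) set" where
  "forms = base_forms \<union> (\<lambda>a. \<lambda>i. - a i) ` base_forms"

definition sig :: "(nat \<Rightarrow> real) \<Rightarrow> (nat \<Rightarrow> int) set" where
  "sig x = {a\<in>forms. 0 \<le> lform n a x}"

text \<open>For points of the cone, \<open>sig x \<subseteq> sig y\<close> says that \<open>y\<close> lies in the closure of the cell of \<open>x\<close>.\<close>

abbreviation hpos :: "(nat \<Rightarrow> real) \<Rightarrow> (nat \<Rightarrow> int) set" where
  "hpos x \<equiv> {a. 0 \<le> lform n a x}"

lemma finite_forms: "finite forms"
proof -
  have "finite base_forms" unfolding base_forms_def using finE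
    by (intro finite_UnI finite_UN_I) (auto simp: finite_hcmp finite_hforms split: prod.splits)
  thus ?thesis by (simp add: forms_def)
qed

lemma finite_sigs: "finite (range sig)"
  by (rule finite_subset[of _ "Pow forms"]) (auto simp: sig_def finite_forms)

lemma forms_uminus: "a \<in> forms \<Longrightarrow> (\<lambda>i. - a i) \<in> forms"
  unfolding forms_def by (auto intro!: image_eqI)

lemma sig_closure_nonneg: "sig x \<subseteq> sig y \<Longrightarrow> a \<in> forms \<Longrightarrow> 0 \<le> lform n a x \<Longrightarrow> 0 \<le> lform n a y"
  unfolding sig_def by blast

lemma sig_closure_nonpos: "sig x \<subseteq> sig y \<Longrightarrow> a \<in> forms \<Longrightarrow> lform n a x \<le> 0 \<Longrightarrow> lform n a y \<le> 0"
  using sig_closure_nonneg[of x y "\<lambda>i. - a i"] forms_uminus[of a] by (simp add: lform_minus)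

lemma sig_closure_zero: "sig x \<subseteq> sig y \<Longrightarrow> a \<in> forms \<Longrightarrow> lform n a x = 0 \<Longrightarrow> lform n a y = 0"
  using sig_closure_nonneg[of x y a] sig_closure_nonpos[of x y a] by simp

text \<open>The branches chosen at \<open>x\<close> stay weakly correct on the closure of its cell,
  so a single linear form computes the term there.\<close>

lemma reval_on_closure:
  assumes "s \<in> hterms n" "hcmp s \<subseteq> forms" "sig x \<subseteq> sig y"
  shows "reval y s = lform n (hlin (hpos x) s) y"
  by (rule reval_eq_lform[OF assms(1)])
    (use assms(2) sig_closure_nonneg[OF assms(3)] sig_closure_nonpos[OF assms(3)] in auto)

lemma hcmp_ut: "hcmp ut \<subseteq> forms"
  by (auto simp: forms_def base_forms_def)

definition uform :: "(nat \<Rightarrow> real) \<Rightarrow> nat \<Rightarrow> int" where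
  "uform x = hlin (hpos x) ut"

lemma val_u_on_closure: "sig x \<subseteq> sig y \<Longrightarrow> reval y ut = lform n (uform x) y"
  unfolding uform_def by (rule reval_on_closure[OF ut(1) hcmp_ut])

text \<open>On the closure of a cell each relation says that one member of \<open>forms\<close>
  vanishes, and members vanishing at \<open>x\<close> vanish at \<open>y\<close>.\<close>

lemma cone_closed_under_closure:
  assumes x: "x \<in> cone" and xy: "sig x \<subseteq> sig y" and y: "\<And>i. i \<ge> n \<Longrightarrow> y i = 0"
  shows "y \<in> cone"
  unfolding cone_def
proof (intro CollectI conjI allI impI ballI)
  fix i assume i: "i < n"
  have "(\<lambda>j. if j = i then 1 else 0) \<in> forms" using i by (auto simp: forms_def base_forms_def)
  from sig_closure_nonneg[OF xy this] show "0 \<le> y i" using x i by (simp add: lform_unit cone_def)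
next
  fix st assume st: "st \<in> E"
  obtain s t where [simp]: "st = (s, t)" by (cases st)
  have s: "s \<in> hterms n" and t: "t \<in> hterms n" using st Esub by auto
  have cs: "hcmp s \<subseteq> forms" and ct: "hcmp t \<subseteq> forms" using st by (auto simp: forms_def base_forms_def)
  let ?d = "\<lambda>i. hlin (hpos x) s i - hlin (hpos x) t i"
  have "?d \<in> (\<lambda>(a, b). \<lambda>i. a i - b i) ` (hforms s \<times> hforms t)"
    by (rule image_eqI[of _ _ "(hlin (hpos x) s, hlin (hpos x) t)"]) (auto simp: hlin_in_hforms)
  hence d: "?d \<in> forms" unfolding forms_def base_forms_def using st by fastforce
  have "reval x s = reval x t" using x st by (auto simp: cone_def)
  hence "lform n ?d x = 0"
    using reval_on_closure[OF s cs subset_refl] reval_on_closure[OF t ct subset_refl] by (simp add: lform_diff)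
  hence "lform n ?d y = 0" by (rule sig_closure_zero[OF xy d])
  thus "case st of (s, t) \<Rightarrow> reval y s = reval y t"
    using reval_on_closure[OF s cs xy] reval_on_closure[OF t ct xy] by (simp add: lform_diff)
qed (use y in auto)

definition cell :: "(nat \<Rightarrow> real) \<Rightarrow> (nat \<Rightarrow> real) set" where
  "cell x = {y. (\<forall>j\<ge>n. y j = 0) \<and> sig y = sig x}"

text \<open>For \<open>x\<close> in the cone this is the linear span of its cell.\<close>

definition cspan :: "(nat \<Rightarrow> real) \<Rightarrow> (nat \<Rightarrow> real) set" where
  "cspan x = {y. (\<forall>j\<ge>n. y j = 0) \<and> (\<forall>a\<in>{a\<in>forms. lform n a x = 0}. lform n a y = 0)}"

text \<open>Chosen from \<open>cspan x\<close> alone, so that it takes one value on each cell; it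
  stands for the dimension of the span.\<close>

definition crk :: "(nat \<Rightarrow> real) \<Rightarrow> nat" where
  "crk x = (SOME r. \<exists>I c M. lin_param (cspan x) I c M \<and> card I = r)"

lemma cspan_param:
  obtains I c M where "lin_param (cspan x) I c M" "card I = crk x"
proof -
  have "\<exists>r I c M. lin_param (cspan x) I c M \<and> card I = r"
    unfolding cspan_def using lin_param_exists[of "{a\<in>forms. lform n a x = 0}" n] finite_forms by auto
  from someI_ex[OF this] show ?thesis using that unfolding crk_def by blast
qed

lemma cspan_cong: "sig x = sig y \<Longrightarrow> cspan x = cspan y"
proof -
  assume "sig x = sig y"
  hence "{a\<in>forms. lform n a x = 0} = {a\<in>forms. lform n a y = 0}"
    using sig_closure_zero[of x y] sig_closure_zero[of y x] by blast
  thus ?thesis by (simp add: cspan_def)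
qed

lemma crk_cong: "sig x = sig y \<Longrightarrow> crk x = crk y"
  unfolding crk_def using cspan_cong[of x y] by simp

lemma cell_cone: "x \<in> cone \<Longrightarrow> cell x \<subseteq> cone"
  using cone_closed_under_closure[of x] by (auto simp: cell_def)

lemma sig_closure_cspan: "sig x \<subseteq> sig y \<Longrightarrow> (\<forall>j\<ge>n. y j = 0) \<Longrightarrow> y \<in> cspan x"
  using sig_closure_zero[of x y] by (auto simp: cspan_def)

text \<open>Forms vanishing at \<open>x\<close> are handled by the span and negative ones by closure
  under negation; so a cell is relatively open in its span.\<close>

lemma cell_iff: "y \<in> cell x \<longleftrightarrow> y \<in> cspan x \<and> (\<forall>a\<in>{a\<in>forms. 0 < lform n a x}. 0 < lform n a y)"
proof
  assume y: "y \<in> cell x"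
  hence s: "sig y = sig x" by (simp add: cell_def)
  have "0 < lform n a y" if "a \<in> forms" "0 < lform n a x" for a
    using sig_closure_nonpos[of y x a] s that by force
  thus "y \<in> cspan x \<and> (\<forall>a\<in>{a\<in>forms. 0 < lform n a x}. 0 < lform n a y)"
    using sig_closure_cspan[of x y] y s by (auto simp: cell_def)
next
  assume y: "y \<in> cspan x \<and> (\<forall>a\<in>{a\<in>forms. 0 < lform n a x}. 0 < lform n a y)"
  have "0 \<le> lform n a y \<longleftrightarrow> 0 \<le> lform n a x" if a: "a \<in> forms" for a
  proof -
    consider "lform n a x = 0" | "0 < lform n a x" | "lform n a x < 0" by linarith
    thus ?thesis
    proof cases
      case 1 thus ?thesis using y a by (simp add: cspan_def)
    next
      case 2 thus ?thesis using y a by (auto simp: less_imp_le)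
    next
      case 3
      hence "0 < lform n (\<lambda>i. - a i) x" by (simp add: lform_minus)
      hence "0 < lform n (\<lambda>i. - a i) y" using y forms_uminus[OF a] by blast
      thus ?thesis using 3 by (simp add: lform_minus)
    qed
  qed
  thus "y \<in> cell x" using y unfolding cell_def sig_def cspan_def by auto
qed

lemma cell_scale: "c > 0 \<Longrightarrow> (\<lambda>i. c * y i) \<in> cell x \<longleftrightarrow> y \<in> cell x"
proof -
  assume c: "c > 0"
  have "sig (\<lambda>i. c * y i) = sig y" using c by (simp add: sig_def lform_scale_arg zero_le_mult_iff)
  thus ?thesis using c by (simp add: cell_def)
qed

lemma cell_divide: "c > 0 \<Longrightarrow> (\<lambda>i. y i / c) \<in> cell x \<longleftrightarrow> y \<in> cell x"
  using cell_scale[of "1 / c" y x] by simp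

text \<open>A point of height 0 is the origin, where all forms vanish; then they vanish at
  \<open>x\<close> as well, including the coordinates.\<close>

lemma cell_val_pos:
  assumes x: "x \<in> cone" "val x u > 0" and y: "y \<in> cell x"
  shows "y \<in> cone" "val y u > 0"
proof -
  show yc: "y \<in> cone" using cell_cone[OF x(1)] y by blast
  show "val y u > 0"
  proof (rule ccontr)
    assume "\<not> val y u > 0"
    hence "val y u = 0" using val_nonneg[OF yc, of u] by simp
    hence "y i = 0" if "i < n" for i using val_unit_zero[OF yc, of "g i"] val_gen[OF yc that] by simp
    hence "y i = 0" for i using yc by (cases "i < n") (auto simp: cone_def)
    hence "lform n a y = 0" for a by (simp add: lform_def)
    hence z: "lform n a x = 0" if "a \<in> forms" for a
      using sig_closure_zero[of y x a] y that by (simp add: cell_def)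
    have "x i = 0" if "i < n" for i
      using z[of "\<lambda>j. if j = i then 1 else 0"] that by (simp add: forms_def base_forms_def lform_unit)
    hence "x = (\<lambda>i. 0 * x i)" using x(1) by (auto simp: cone_def fun_eq_iff) (metis not_less)
    hence "val x u = 0 * val x u" using val_scale[of 0 x u] by simp
    thus False using x(2) by simp
  qed
qed

lemma cone_bounded: "\<exists>b\<ge>0. \<forall>x\<in>cone. \<forall>i. \<bar>x i\<bar> \<le> b * val x u"
proof -
  have "\<forall>i. \<exists>k::nat. \<forall>x\<in>cone. val x (g i) \<le> real k * val x u" using val_bound by blast
  then obtain k where k: "\<And>i x. x \<in> cone \<Longrightarrow> val x (g i) \<le> real (k i :: nat) * val x u" by metis
  define b where "b = (\<Sum>i<n. real (k i))"
  have "\<bar>x i\<bar> \<le> b * val x u" if x: "x \<in> cone" for x i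
  proof (cases "i < n")
    case True
    have "\<bar>x i\<bar> = val x (g i)" using val_gen[OF x True] val_nonneg[OF x, of "g i"] by simp
    also have "\<dots> \<le> real (k i) * val x u" by (rule k[OF x])
    also have "\<dots> \<le> b * val x u" unfolding b_def using True val_nonneg[OF x]
      by (intro mult_right_mono member_le_sum) auto
    finally show ?thesis .
  next
    case False
    thus ?thesis using x val_nonneg[OF x, of u] by (simp add: cone_def b_def sum_nonneg)
  qed
  moreover have "b \<ge> 0" by (simp add: b_def sum_nonneg)
  ultimately show ?thesis by blast
qed

definition cell_lattice :: "(nat \<Rightarrow> real) \<Rightarrow> nat \<Rightarrow> (nat \<Rightarrow> real) set" where
  "cell_lattice x N = {v \<in> cell x. (\<forall>j. v j \<in> \<int>) \<and> val v u \<le> real N}"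

text \<open>Scaling by \<open>1 / N\<close> turns the bound on the height into a cutoff at height 1,
  and the summand is homogeneous of degree 0. Its discontinuities lie on finitely many hyperplanes
  of parameter space, so the lattice sums converge like Riemann sums.\<close>

lemma cell_lattice_asymptotics:
  assumes x: "x \<in> cone" and ux: "val x u > 0"
  shows "\<And>N. N \<ge> 1 \<Longrightarrow> finite (cell_lattice x N)"
    "\<exists>C\<ge>0. (\<lambda>N. (\<Sum>v\<in>cell_lattice x N. val v h / val v u) / real N ^ crk x) \<longlonglongrightarrow> C \<and> (val x h > 0 \<longrightarrow> C > 0)"
proof -
  obtain I c M where p: "lin_param (cspan x) I c M" and cI: "card I = crk x" by (rule cspan_param)
  have fin: "finite I"
    and p1: "\<And>y j. y \<in> cspan x \<Longrightarrow> y j = (\<Sum>i\<in>I. c j i * y i)"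
    and p2: "\<And>y. (\<lambda>j. \<Sum>i\<in>I. c j i * y i) \<in> cspan x" and p3: "\<And>y i. i \<in> I \<Longrightarrow> (\<Sum>k\<in>I. c i k * y k) = y i"
    using p unfolding lin_param_def by blast+
  define \<psi> where "\<psi> = (\<lambda>y j. \<Sum>i\<in>I. c j i * y i)"
  have xc: "x \<in> cspan x" using sig_closure_cspan[of x x] x by (simp add: cone_def)
  have \<psi>x: "\<psi> x = x" unfolding \<psi>_def by (intro ext) (simp only: p1[OF xc, symmetric])
  have \<psi>V: "\<psi> y \<in> cspan x" for y using p2 by (simp add: \<psi>_def)
  define S where "S = {a\<in>forms. 0 < lform n a x}"
  have finS: "finite S" using finite_forms by (simp add: S_def)
  define w where "w = uform x"
  have cellu: "val y u = lform n w y" "reval y ut = lform n w y" "y \<in> cone" "val y u > 0" if "y \<in> cell x" for y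
  proof -
    show yc: "y \<in> cone" "val y u > 0" using cell_val_pos[OF x ux that] by simp_all
    show "reval y ut = lform n w y" unfolding w_def using that by (intro val_u_on_closure) (simp add: cell_def)
    thus "val y u = lform n w y" using val_unit[OF yc(1)] by simp
  qed
  have cellS: "\<psi> y \<in> cell x \<longleftrightarrow> (\<forall>a\<in>S. 0 < lform n a (\<psi> y))" for y
    using cell_iff[of "\<psi> y" x] \<psi>V by (simp add: S_def)
  have \<psi>cont: "continuous_on A \<psi>" for A
    unfolding \<psi>_def by (rule continuous_on_coordinatewise_then_product) (intro continuous_intros)
  have lcont: "continuous_on A (\<lambda>y. lform n a (\<psi> y))" for A a
    using continuous_on_compose2[OF continuous_on_lform \<psi>cont subset_UNIV] .
  have rcont: "continuous_on A (\<lambda>y. reval (\<psi> y) s)" for A s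
    using continuous_on_compose2[OF continuous_on_reval \<psi>cont subset_UNIV] .
  have \<psi>meas: "(\<lambda>y. \<psi> y j) \<in> borel_measurable (PiM I (\<lambda>_. lborel :: real measure))" for j
    unfolding \<psi>_def by (intro borel_measurable_sum borel_measurable_times) (auto intro: measurable_component_singleton[THEN measurable_compose])
  have lmeas: "(\<lambda>y. lform n a (\<psi> y)) \<in> borel_measurable (PiM I (\<lambda>_. lborel :: real measure))" for a
    unfolding lform_def by (intro borel_measurable_sum borel_measurable_times \<psi>meas) auto
  have rmeas: "(\<lambda>y. reval (\<psi> y) s) \<in> borel_measurable (PiM I (\<lambda>_. lborel :: real measure))" if "s \<in> hterms n" for s
    by (rule measurable_reval[OF \<psi>meas that])
  \<comment> \<open>A form that is nonzero at the point \<open>x\<close> of the span does not vanish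
    on the span, so its level sets are null sets.\<close>
  have nonconst: "\<exists>i\<in>I. (\<Sum>j<n. real_of_int (a j) * c j i) \<noteq> 0" if "lform n a x \<noteq> 0" for a
  proof (rule ccontr)
    assume "\<not> ?thesis"
    hence "lform n a (\<psi> x) = 0" unfolding \<psi>_def lform_param by simp
    thus False using that \<psi>x by simp
  qed
  have AEl: "AE y in PiM I (\<lambda>_. lborel). lform n a (\<psi> y) \<noteq> t" if ne: "lform n a x \<noteq> 0" for a t
  proof -
    obtain i where "i \<in> I" "(\<Sum>j<n. real_of_int (a j) * c j i) \<noteq> 0" using nonconst[OF ne] by blast
    thus ?thesis unfolding \<psi>_def lform_param by (rule PiM_hyperplane_null[OF fin])
  qed
  have wx: "lform n w x > 0" using cellu(1)[of x] ux x by (simp add: cell_def cone_def)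
  have AEall: "AE y in PiM I (\<lambda>_. lborel). y \<in> extensional I \<and> (\<forall>a\<in>S. lform n a (\<psi> y) \<noteq> 0) \<and> lform n w (\<psi> y) \<noteq> 1"
  proof -
    have "AE y in PiM I (\<lambda>_. lborel). \<forall>a\<in>S. lform n a (\<psi> y) \<noteq> 0"
      by (rule AE_finite_allI[OF finS]) (rule AEl, auto simp: S_def)
    moreover have "AE y in PiM I (\<lambda>_. lborel). lform n w (\<psi> y) \<noteq> 1" using wx by (intro AEl) auto
    moreover have "AE y in PiM I (\<lambda>_. lborel :: real measure). y \<in> extensional I"
      by (rule AE_I2) (auto simp: space_PiM PiE_def)
    ultimately show ?thesis by eventually_elim auto
  qed
  obtain b where b: "b \<ge> 0" "\<And>x i. x \<in> cone \<Longrightarrow> \<bar>x i\<bar> \<le> b * val x u" using cone_bounded by blast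
  define \<Phi> where "\<Phi> h v = (if v \<in> cell x \<and> reval v ut \<le> 1 then reval v (tm h) / reval v ut else 0)" for h v
  have main: "(\<forall>N\<ge>1. finite {v\<in>cspan x. (\<forall>j. v j \<in> \<int>) \<and> \<Phi> h (\<lambda>j. v j / real N) \<noteq> 0}) \<and>
      (\<exists>d>0. (\<lambda>N. (\<Sum>v\<in>{v\<in>cspan x. (\<forall>j. v j \<in> \<int>) \<and> \<Phi> h (\<lambda>j. v j / real N) \<noteq> 0}. \<Phi> h (\<lambda>j. v j / real N)) / real N ^ card I)
        \<longlonglongrightarrow> d * integral\<^sup>L (PiM I (\<lambda>_. lborel)) (\<lambda>y. \<Phi> h (\<psi> y))) \<and>
      0 \<le> integral\<^sup>L (PiM I (\<lambda>_. lborel)) (\<lambda>y. \<Phi> h (\<psi> y)) \<and>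
      (val x h > 0 \<longrightarrow> 0 < integral\<^sup>L (PiM I (\<lambda>_. lborel)) (\<lambda>y. \<Phi> h (\<psi> y)))" for h
  proof -
    let ?\<phi> = "\<lambda>y. \<Phi> h (\<psi> y)"
    obtain k where k: "\<And>y. y \<in> cone \<Longrightarrow> val y h \<le> real (k :: nat) * val y u" using val_bound[of h] by blast
    have nn: "0 \<le> ?\<phi> y" for y
      using reval_nonneg[OF tm(1)] reval_nonneg[OF ut(1)] cellu(3)[of "\<psi> y"] by (auto simp: \<Phi>_def cone_def)
    have bd: "\<bar>?\<phi> y\<bar> \<le> real k" for y
    proof (cases "\<psi> y \<in> cell x")
      case True
      have "reval (\<psi> y) (tm h) \<le> real k * reval (\<psi> y) ut"
        using k[OF cellu(3)[OF True]] val_unit[OF cellu(3)[OF True]] by (simp add: val_def)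
      moreover have "reval (\<psi> y) ut > 0" using cellu(4)[OF True] val_unit[OF cellu(3)[OF True]] by simp
      ultimately have "reval (\<psi> y) (tm h) / reval (\<psi> y) ut \<le> real k" by (simp add: divide_le_eq)
      thus ?thesis using nn[of y] by (auto simp: \<Phi>_def)
    qed (simp add: \<Phi>_def)
    have supp: "\<bar>y i\<bar> \<le> b" if "?\<phi> y \<noteq> 0" "i \<in> I" for y i
    proof -
      have c: "\<psi> y \<in> cell x" and l: "reval (\<psi> y) ut \<le> 1" using that(1) by (auto simp: \<Phi>_def split: if_splits)
      have "y i = \<psi> y i" using p3[OF that(2)] by (simp add: \<psi>_def)
      hence "\<bar>y i\<bar> \<le> b * val (\<psi> y) u" using b(2)[OF cellu(3)[OF c], of i] by simp
      also have "\<dots> \<le> b * 1" using l b val_unit[OF cellu(3)[OF c]] by (intro mult_left_mono) auto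
      finally show ?thesis by simp
    qed
    have meas: "?\<phi> \<in> borel_measurable (PiM I (\<lambda>_. lborel :: real measure))"
    proof -
      have [measurable]: "(\<lambda>y. lform n a (\<psi> y)) \<in> borel_measurable (PiM I (\<lambda>_. lborel :: real measure))" for a by (rule lmeas)
      have [measurable]: "(\<lambda>y. reval (\<psi> y) ut) \<in> borel_measurable (PiM I (\<lambda>_. lborel :: real measure))"
        "(\<lambda>y. reval (\<psi> y) (tm h)) \<in> borel_measurable (PiM I (\<lambda>_. lborel :: real measure))"
        using rmeas ut(1) tm(1) by auto
      have "countable S" using finS by (rule countable_finite)
      thus ?thesis unfolding \<Phi>_def cellS by measurable
    qed
    have contO: "box_continuous_at I ?\<phi> y"
      if "y \<in> extensional I" "\<forall>a\<in>S. 0 < lform n a (\<psi> y)" "lform n w (\<psi> y) < 1" for y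
    proof (rule box_continuous_atI[OF that(1), where O' = "{y. \<forall>a\<in>S. 0 < lform n a (\<psi> y)} \<inter> {y. lform n w (\<psi> y) < 1}"
          and f = "\<lambda>y. reval (\<psi> y) (tm h) / reval (\<psi> y) ut"])
      let ?O = "{y. \<forall>a\<in>S. 0 < lform n a (\<psi> y)} \<inter> {y. lform n w (\<psi> y) < 1}"
      have "{y. \<forall>a\<in>S. 0 < lform n a (\<psi> y)} = (\<Inter>a\<in>S. {y. 0 < lform n a (\<psi> y)})" by auto
      moreover have "open \<dots>" using finS by (intro open_INT ballI open_Collect_less lcont continuous_intros)
      ultimately show "open ?O" by (auto intro!: open_Int open_Collect_less lcont continuous_intros)
      show "?\<phi> z = reval (\<psi> z) (tm h) / reval (\<psi> z) ut" if "z \<in> ?O" for z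
        using that cellS[of z] cellu(2)[of "\<psi> z"] by (auto simp: \<Phi>_def)
      have "reval (\<psi> z) ut \<noteq> 0" if "z \<in> ?O" for z
        using that cellS[of z] cellu(3,4)[of "\<psi> z"] val_unit[of "\<psi> z"] by auto
      thus "continuous_on ?O (\<lambda>y. reval (\<psi> y) (tm h) / reval (\<psi> y) ut)"
        by (intro continuous_on_divide rcont) auto
    qed (use that in auto)
    have cont: "AE y in PiM I (\<lambda>_. lborel). box_continuous_at I ?\<phi> y"
      using AEall
    proof eventually_elim
      case (elim y)
      \<comment> \<open>Near almost every point the function is either the continuous quotient or
        identically 0.\<close>
      consider "\<forall>a\<in>S. 0 < lform n a (\<psi> y)" "lform n w (\<psi> y) < 1" | a where "a \<in> S" "lform n a (\<psi> y) < 0"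
        | "lform n w (\<psi> y) > 1" using elim by (metis linorder_neqE_linordered_idom)
      thus ?case
      proof cases
        case 1 thus ?thesis using contO elim by blast
      next
        case (2 a)
        show ?thesis
        proof (rule box_continuous_atI[where O' = "{y. lform n a (\<psi> y) < 0}" and f = "\<lambda>_. 0"])
          show "open {y. lform n a (\<psi> y) < 0}" by (intro open_Collect_less lcont continuous_intros)
          show "?\<phi> z = 0" if "z \<in> {y. lform n a (\<psi> y) < 0}" for z
            using that 2 cellS[of z] by (force simp: \<Phi>_def)
        qed (use elim 2 in auto)
      next
        case 3
        show ?thesis
        proof (rule box_continuous_atI[where O' = "{y. 1 < lform n w (\<psi> y)}" and f = "\<lambda>_. 0"])
          show "open {y. 1 < lform n w (\<psi> y)}" by (intro open_Collect_less lcont continuous_intros)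
          show "?\<phi> z = 0" if "z \<in> {y. 1 < lform n w (\<psi> y)}" for z
            using that cellu(2)[of "\<psi> z"] by (auto simp: \<Phi>_def)
        qed (use elim 3 in auto)
      qed
    qed
    have int0: "0 \<le> integral\<^sup>L (PiM I (\<lambda>_. lborel)) ?\<phi>" using nn by simp
    have intpos: "0 < integral\<^sup>L (PiM I (\<lambda>_. lborel)) ?\<phi>" if h: "val x h > 0"
    proof -
      \<comment> \<open>Places the point on the ray of \<open>x\<close> at height 1/2, well inside
        the cutoff.\<close>
      define t where "t = 1 / (2 * val x u)"
      have t: "t > 0" using ux by (simp add: t_def)
      define y where "y = restrict (\<lambda>i. t * x i) I"
      have "\<psi> y = (\<lambda>j. t * \<psi> x j)" unfolding \<psi>_def y_def
        by (auto simp: sum_distrib_left fun_eq_iff intro!: sum.cong)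
      hence \<psi>y: "\<psi> y = (\<lambda>j. t * x j)" using \<psi>x by simp
      have pos: "\<forall>a\<in>S. 0 < lform n a (\<psi> y)" using t by (simp add: \<psi>y lform_scale_arg S_def)
      have "lform n w (\<psi> y) = t * val x u" using cellu(1)[of x] x by (simp add: \<psi>y lform_scale_arg cell_def cone_def)
      hence half: "lform n w (\<psi> y) = 1 / 2" using ux by (simp add: t_def)
      have yc: "\<psi> y \<in> cell x" using pos cellS by simp
      have "reval (\<psi> y) (tm h) = t * val x h" unfolding \<psi>y val_def using t by (simp add: reval_scale)
      hence "?\<phi> y > 0" using yc cellu(2)[OF yc] half h t by (simp add: \<Phi>_def)
      moreover have "box_continuous_at I ?\<phi> y" using pos half by (intro contO) (auto simp: y_def)
      ultimately show ?thesis
        by (intro integral_pos_of_continuity_point[OF fin meas, where m = "real k" and b = b and y = y]) (use bd supp b nn in auto)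
    qed
    have supp': "\<And>y i. \<Phi> h (\<lambda>j. \<Sum>i\<in>I. c j i * y i) \<noteq> 0 \<Longrightarrow> i \<in> I \<Longrightarrow> \<bar>y i\<bar> \<le> b" using supp by (simp add: \<psi>_def)
    have bd': "\<And>y. \<bar>\<Phi> h (\<lambda>j. \<Sum>i\<in>I. c j i * y i)\<bar> \<le> real k" using bd by (simp add: \<psi>_def)
    note meas' = meas[unfolded \<psi>_def] and cont' = cont[unfolded \<psi>_def]
    have L1: "\<forall>N\<ge>1. finite {v\<in>cspan x. (\<forall>j. v j \<in> \<int>) \<and> \<Phi> h (\<lambda>j. v j / real N) \<noteq> 0}"
      by (intro allI impI, rule lattice_sums_converge(1)[OF p meas', where m = "real k" and b = b])
        (rule bd' | rule b(1) | (rule supp'; assumption) | rule cont' | assumption)+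
    have L2: "\<exists>d>0. (\<lambda>N. (\<Sum>v\<in>{v\<in>cspan x. (\<forall>j. v j \<in> \<int>) \<and> \<Phi> h (\<lambda>j. v j / real N) \<noteq> 0}. \<Phi> h (\<lambda>j. v j / real N)) / real N ^ card I)
        \<longlonglongrightarrow> d * integral\<^sup>L (PiM I (\<lambda>_. lborel)) (\<lambda>y. \<Phi> h (\<lambda>j. \<Sum>i\<in>I. c j i * y i))"
      by (rule lattice_sums_converge(2)[OF p meas', where m = "real k" and b = b])
        (rule bd' | rule b(1) | (rule supp'; assumption) | rule cont')+
    show ?thesis using L1 L2 int0 intpos unfolding \<psi>_def by (intro conjI impI)
  qed
  have scaled: "\<Phi> h (\<lambda>j. v j / real N) = (if v \<in> cell x \<and> val v u \<le> real N then val v h / val v u else 0)" if N: "N \<ge> 1" for h v N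
  proof (cases "v \<in> cell x")
    case True
    have "reval v ut = val v u" using val_unit[OF cellu(3)[OF True]] by simp
    thus ?thesis using N True by (simp add: \<Phi>_def cell_divide reval_divide val_def)
  next
    case False thus ?thesis using N by (simp add: \<Phi>_def cell_divide)
  qed
  have subs: "{v\<in>cspan x. (\<forall>j. v j \<in> \<int>) \<and> \<Phi> h (\<lambda>j. v j / real N) \<noteq> 0} = {v\<in>cell_lattice x N. val v h \<noteq> 0}" if N: "N \<ge> 1" for h N
    unfolding cell_lattice_def using scaled[OF N] cellu(4) cell_iff by (auto split: if_splits) force+
  show finl: "finite (cell_lattice x N)" if N: "N \<ge> 1" for N
  proof -
    \<comment> \<open>For \<open>h = u\<close> the summand is 1 on the whole cell, so its support
      contains every lattice point that is counted.\<close>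
    have "{v\<in>cell_lattice x N. val v u \<noteq> 0} = cell_lattice x N"
      using cellu(4) by (force simp: cell_lattice_def)
    thus ?thesis using main[of u] subs[OF N, of u] N by auto
  qed
  have sums: "(\<Sum>v\<in>{v\<in>cspan x. (\<forall>j. v j \<in> \<int>) \<and> \<Phi> h (\<lambda>j. v j / real N) \<noteq> 0}. \<Phi> h (\<lambda>j. v j / real N))
      = (\<Sum>v\<in>cell_lattice x N. val v h / val v u)" if N: "N \<ge> 1" for N
    unfolding subs[OF N]
    by (rule sum.mono_neutral_cong_left[OF finl[OF N]]) (auto simp: scaled[OF N] cell_lattice_def)
  obtain d where d: "d > 0" and lim: "(\<lambda>N. (\<Sum>v\<in>{v\<in>cspan x. (\<forall>j. v j \<in> \<int>) \<and> \<Phi> h (\<lambda>j. v j / real N) \<noteq> 0}. \<Phi> h (\<lambda>j. v j / real N)) / real N ^ card I)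
        \<longlonglongrightarrow> d * integral\<^sup>L (PiM I (\<lambda>_. lborel)) (\<lambda>y. \<Phi> h (\<psi> y))" using main[of h] by blast
  have "(\<lambda>N. (\<Sum>v\<in>cell_lattice x N. val v h / val v u) / real N ^ crk x) \<longlonglongrightarrow> d * integral\<^sup>L (PiM I (\<lambda>_. lborel)) (\<lambda>y. \<Phi> h (\<psi> y))"
    by (rule Lim_transform_eventually[OF lim]) (use sums cI in \<open>auto simp: eventually_sequentially intro!: exI[of _ 1]\<close>)
  thus "\<exists>C\<ge>0. (\<lambda>N. (\<Sum>v\<in>cell_lattice x N. val v h / val v u) / real N ^ crk x) \<longlonglongrightarrow> C \<and> (val x h > 0 \<longrightarrow> C > 0)"
    using d main[of h] by (intro exI[of _ "d * integral\<^sup>L (PiM I (\<lambda>_. lborel)) (\<lambda>y. \<Phi> h (\<psi> y))"]) auto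
qed

end

section \<open>Local dimension\<close>

lemma local_dim_homeomorphic:
  assumes f: "homeomorphic_map X Y f" and x: "x \<in> topspace X"
  shows "local_dim Y (f x) = local_dim X x"
proof -
  have one: "\<exists>V. openin Y V \<and> f x \<in> V \<and> subtopology Y V dim_le n"
    if f: "homeomorphic_map X Y f" and U: "openin X U" "x \<in> U" "subtopology X U dim_le n"
    for X :: "'x topology" and Y :: "'y topology" and f x U n
  proof (intro exI conjI)
    show "openin Y (f ` U)" using f U(1) homeomorphic_map_openness_eq by blast
    show "f x \<in> f ` U" using U(2) by blast
    have "U \<subseteq> topspace X" using U(1) by (rule openin_subset)
    moreover have "f ` U \<subseteq> topspace Y" using \<open>openin Y (f ` U)\<close> by (rule openin_subset)
    ultimately have "f ` (topspace X \<inter> U) = topspace Y \<inter> f ` U" by (simp add: Int_absorb1)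
    hence "homeomorphic_map (subtopology X U) (subtopology Y (f ` U)) f"
      using f homeomorphic_map_subtopologies by blast
    hence "subtopology X U homeomorphic_space subtopology Y (f ` U)"
      by (rule homeomorphic_map_imp_homeomorphic_space)
    thus "subtopology Y (f ` U) dim_le n" using U(3) homeomorphic_space_dimension_le by blast
  qed
  obtain g where fg: "homeomorphic_maps X Y f g" using f homeomorphic_map_maps by blast
  have g: "homeomorphic_map Y X g" using fg homeomorphic_maps_map by blast
  have gf: "g (f x) = x" using fg x by (auto simp: homeomorphic_maps_def)
  have "(\<exists>V. openin Y V \<and> f x \<in> V \<and> subtopology Y V dim_le n) \<longleftrightarrow> (\<exists>U. openin X U \<and> x \<in> U \<and> subtopology X U dim_le n)" for n
    using one[OF f] one[OF g, of _ "f x"] gf by metis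
  thus ?thesis unfolding local_dim_def by simp
qed

lemma top_dim_homeomorphic: "X homeomorphic_space Y \<Longrightarrow> top_dim X = top_dim Y"
  unfolding top_dim_def using homeomorphic_space_dimension_le by metis

context presented_hoop
begin

lemma homeomorphic_maps_coords_val:
  "homeomorphic_maps (extremal_space u) (top_of_set polyh) coords val"
  unfolding homeomorphic_maps_def
proof (intro conjI)
  have ts: "topspace (extremal_space u) = extremal_states u" by (simp add: extremal_space_def)
  have "continuous_map (extremal_space u) euclidean coords"
  proof -
    have "continuous_map (extremal_space u) euclidean (\<lambda>e. coords e i)" for i
    proof (cases "i < n")
      case True
      have "continuous_map (powertop_real UNIV) euclidean (\<lambda>e. e (g i))"
        by (rule continuous_map_product_projection) simp
      thus ?thesis using True unfolding coords_def extremal_space_def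
        by (simp add: continuous_map_from_subtopology)
    next
      case False thus ?thesis by (simp add: coords_def)
    qed
    thus ?thesis unfolding euclidean_product_topology[symmetric] continuous_map_componentwise_UNIV by blast
  qed
  thus "continuous_map (extremal_space u) (top_of_set polyh) coords"
    using coords_polyh by (auto simp: continuous_map_in_subtopology ts)
  have "continuous_map (top_of_set polyh) (powertop_real UNIV) val"
    unfolding continuous_map_componentwise_UNIV
  proof
    fix h show "continuous_map (top_of_set polyh) euclideanreal (\<lambda>x. val x h)"
      unfolding val_def using continuous_on_reval by simp
  qed
  thus "continuous_map (top_of_set polyh) (extremal_space u) val"
    using val_extremal by (auto simp: extremal_space_def continuous_map_in_subtopology)
  show "\<forall>e\<in>topspace (extremal_space u). val (coords e) = e" using val_coords by (simp add: ts)
  show "\<forall>x\<in>topspace (top_of_set polyh). coords (val x) = x" using coords_val by (simp add: polyh_def)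
qed

text \<open>The largest rank of a cell with \<open>p\<close> in its closure; ranks are those of cones, so they exceed
  the dimension of the section \<open>polyh\<close> by one.\<close>

definition mrk :: "(nat \<Rightarrow> real) \<Rightarrow> nat" where
  "mrk p = Max (crk ` {y\<in>polyh. sig y \<subseteq> sig p})"

text \<open>There are finitely many sign patterns, and \<open>crk\<close> depends on the pattern
  only.\<close>

lemma finite_crk_image: "finite (crk ` A)"
proof -
  have "crk ` A \<subseteq> (\<lambda>S. crk (SOME y. sig y = S)) ` range sig"
  proof
    fix r assume "r \<in> crk ` A"
    then obtain y where r: "r = crk y" by blast
    have "sig (SOME z. sig z = sig y) = sig y" by (rule someI[of "\<lambda>z. sig z = sig y" y]) simp
    hence "r = crk (SOME z. sig z = sig y)" using r crk_cong by metis
    thus "r \<in> (\<lambda>S. crk (SOME y. sig y = S)) ` range sig" by blast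
  qed
  thus ?thesis using finite_sigs finite_subset by blast
qed

lemma mrk_ge: "y \<in> polyh \<Longrightarrow> sig y \<subseteq> sig p \<Longrightarrow> crk y \<le> mrk p"
  unfolding mrk_def using finite_crk_image by (intro Max_ge) auto

lemma mrk_attained:
  assumes "p \<in> polyh"
  obtains y where "y \<in> polyh" "sig y \<subseteq> sig p" "crk y = mrk p"
proof -
  have "mrk p \<in> crk ` {y\<in>polyh. sig y \<subseteq> sig p}"
    unfolding mrk_def using assms finite_crk_image by (intro Max_in) auto
  thus ?thesis using that by auto
qed

lemma mrk_cong: "sig p = sig q \<Longrightarrow> mrk p = mrk q"
  by (simp add: mrk_def)

text \<open>Cells with \<open>y\<close> in their closure also have \<open>p\<close> there, so none
  of them has rank above \<open>mrk p\<close>.\<close>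

lemma mrk_eq: "y \<in> polyh \<Longrightarrow> sig y \<subseteq> sig p \<Longrightarrow> p \<in> polyh \<Longrightarrow> crk y = mrk p \<Longrightarrow> mrk y = mrk p"
proof (rule antisym)
  assume a: "y \<in> polyh" "sig y \<subseteq> sig p" "p \<in> polyh" "crk y = mrk p"
  obtain z where "z \<in> polyh" "sig z \<subseteq> sig y" "crk z = mrk y" using mrk_attained[OF a(1)] by blast
  thus "mrk y \<le> mrk p" using mrk_ge[of z p] a(2) by auto
  show "mrk p \<le> mrk y" using mrk_ge[OF a(1) subset_refl] a(4) by simp
qed

text \<open>On the closed cell the unit is a linear form with constant value 1. A linear form has
  constant term 0, so this equation eliminates one of the \<open>crk y\<close> coordinates of the
  span.\<close>

lemma closed_cell_flat:
  assumes y: "y \<in> polyh"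
  shows "\<exists>I c M. affine_coords {w\<in>polyh. sig y \<subseteq> sig w} I c M \<and> card I < crk y"
proof -
  obtain I c M where p: "lin_param (cspan y) I c M" and cI: "card I = crk y" by (rule cspan_param)
  let ?F = "{w\<in>polyh. sig y \<subseteq> sig w}"
  have FV: "w \<in> cspan y" if "w \<in> ?F" for w
    using that sig_closure_cspan[of y w] by (auto simp: polyh_def cone_def)
  have p1: "w j = (\<Sum>i\<in>I. c j i * w i)" if "w \<in> ?F" for w j
    using p FV[OF that] unfolding lin_param_def by blast
  have F: "affine_coords ?F I (\<lambda>_. 0) c"
    unfolding affine_coords_def using p p1 by (auto simp: lin_param_def)
  have u1: "lform n (uform y) w = 1" if "w \<in> ?F" for w
    using that val_u_on_closure[of y w] by (auto simp: polyh_def)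
  have "lform n (uform y) w = 0 + (\<Sum>i\<in>I. (\<Sum>j<n. real_of_int (uform y j) * c j i) * w i)" if "w \<in> ?F" for w
  proof -
    have "w = (\<lambda>j. \<Sum>i\<in>I. c j i * w i)" using p1[OF that] by blast
    hence "lform n (uform y) w = lform n (uform y) (\<lambda>j. \<Sum>i\<in>I. c j i * w i)" by (rule arg_cong)
    thus ?thesis by (simp only: lform_param add_0)
  qed
  from affine_coords_cut[OF F this, of 1]
  have cut: "{w\<in>?F. lform n (uform y) w = 1} = {} \<or> (\<exists>I' c' M'. card I' < card I \<and> affine_coords {w\<in>?F. lform n (uform y) w = 1} I' c' M')"
    by simp
  have eq: "{w\<in>?F. lform n (uform y) w = 1} = ?F" using u1 by blast
  have "?F \<noteq> {}" using y by auto
  then obtain I' c' M' where "card I' < card I" "affine_coords ?F I' c' M'" using cut unfolding eq by (elim disjE exE conjE) simp_all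
  thus ?thesis unfolding cI by (intro exI conjI)
qed

lemma crk_pos: "y \<in> polyh \<Longrightarrow> crk y > 0"
  using closed_cell_flat[of y] by auto

lemma dim_le_of_crk_bound:
  assumes "X \<subseteq> polyh" "\<And>x. x \<in> X \<Longrightarrow> crk x \<le> r"
  shows "top_of_set X dim_le (int r - 1)"
proof (rule dim_le_finite_union_flats[where \<F> = "(\<lambda>S. {w\<in>polyh. S \<subseteq> sig w}) ` (sig ` X)"])
  have "finite (sig ` X)" by (rule finite_subset[OF _ finite_sigs]) auto
  thus "finite ((\<lambda>S. {w\<in>polyh. S \<subseteq> sig w}) ` (sig ` X))" by simp
  show "X \<subseteq> \<Union> ((\<lambda>S. {w\<in>polyh. S \<subseteq> sig w}) ` (sig ` X))" using assms(1) by blast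
  fix F assume "F \<in> (\<lambda>S. {w\<in>polyh. S \<subseteq> sig w}) ` (sig ` X)"
  then obtain y where y: "y \<in> X" "F = {w\<in>polyh. sig y \<subseteq> sig w}" by blast
  obtain I c M where "affine_coords F I c M" "card I < crk y" using closed_cell_flat[of y] y assms(1) by auto
  thus "\<exists>I c M. affine_coords F I c M \<and> card I < r" using assms(2)[OF y(1)] by (meson less_le_trans)
qed

text \<open>Central projection to the hyperplane where the unit is \<open>1\<close> embeds a small simplex,
  transversal to the rays of the cell, into the cell.\<close>

lemma simplex_in_cell:
  assumes z: "z \<in> polyh" and T: "open T" "z \<in> T"
  obtains D where "D \<subseteq> polyh \<inter> T" "\<And>w. w \<in> D \<Longrightarrow> sig w = sig z"
    "\<And>m. top_of_set D dim_le m \<Longrightarrow> int (crk z) - 1 \<le> m"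
proof -
  obtain I c M where p: "lin_param (cspan z) I c M" and cI: "card I = crk z" by (rule cspan_param)
  have fin: "finite I"
    and p1: "\<And>y j. y \<in> cspan z \<Longrightarrow> y j = (\<Sum>i\<in>I. c j i * y i)"
    and p2: "\<And>y. (\<lambda>j. \<Sum>i\<in>I. c j i * y i) \<in> cspan z" and p3: "\<And>y i. i \<in> I \<Longrightarrow> (\<Sum>k\<in>I. c i k * y k) = y i"
    using p unfolding lin_param_def by blast+
  have zc: "z \<in> cone" and z1: "reval z ut = 1" using z by (auto simp: polyh_def)
  define \<psi> where "\<psi> = (\<lambda>y j. \<Sum>i\<in>I. c j i * y i)"
  have zV: "z \<in> cspan z" using sig_closure_cspan[of z z] zc by (simp add: cone_def)
  have \<psi>z: "\<psi> z = z" unfolding \<psi>_def by (intro ext) (simp only: p1[OF zV, symmetric])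
  have \<psi>cont: "continuous_on A \<psi>" for A
    unfolding \<psi>_def by (rule continuous_on_coordinatewise_then_product) (intro continuous_intros)
  have lcont: "continuous_on A (\<lambda>y. lform n a (\<psi> y))" for A a
    using continuous_on_compose2[OF continuous_on_lform \<psi>cont subset_UNIV] .
  define S where "S = {a\<in>forms. 0 < lform n a z}"
  have finS: "finite S" using finite_forms by (simp add: S_def)
  define w where "w = uform z"
  have wz: "lform n w z = 1" using val_u_on_closure[of z z] z1 by (simp add: w_def)
  define nr where "nr y = (\<lambda>j. \<psi> y j / lform n w (\<psi> y))" for y
  define O1 where "O1 = {y. 0 < lform n w (\<psi> y)}"
  define O2 where "O2 = {y. \<forall>a\<in>S. 0 < lform n a (\<psi> y)}"
  have nrc: "continuous_on O1 nr" unfolding nr_def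
  proof (rule continuous_on_coordinatewise_then_product)
    fix j show "continuous_on O1 (\<lambda>y. \<psi> y j / lform n w (\<psi> y))"
      by (intro continuous_on_divide lcont continuous_on_product_then_coordinatewise[OF \<psi>cont]) (auto simp: O1_def)
  qed
  have o1: "open O1" unfolding O1_def by (intro open_Collect_less lcont continuous_intros)
  have o2: "open O2"
  proof -
    have "O2 = (\<Inter>a\<in>S. {y. 0 < lform n a (\<psi> y)})" by (auto simp: O2_def)
    thus ?thesis using finS by (auto intro!: open_INT open_Collect_less lcont continuous_intros)
  qed
  define O3 where "O3 = O1 \<inter> nr -` T"
  have o3: "open O3" unfolding O3_def by (rule continuous_open_preimage[OF nrc o1 T(1)])
  have "z \<in> O2 \<inter> O3" using T(2) wz \<psi>z by (auto simp: O2_def O3_def O1_def S_def nr_def)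
  moreover have "open (O2 \<inter> O3)" using o2 o3 by blast
  ultimately obtain N \<epsilon> where e: "\<epsilon> > 0" and box: "\<And>y. (\<forall>j<N. \<bar>y j - z j\<bar> < \<epsilon>) \<Longrightarrow> y \<in> O2 \<inter> O3"
    using open_fun_box[of "O2 \<inter> O3" z] by metis
  let ?r = "crk z"
  obtain \<beta> where \<beta>: "bij_betw \<beta> {..<?r} I"
    using ex_bij_betw_nat_finite[OF fin] cI by (auto simp: atLeast0LessThan)
  define \<gamma> where "\<gamma> = inv_into {..<?r} \<beta>"
  have \<gamma>: "\<gamma> i < ?r" "\<beta> (\<gamma> i) = i" if "i \<in> I" for i
    using that \<beta> bij_betw_inv_into_right[OF \<beta>] bij_betwE[OF bij_betw_inv_into[OF \<beta>]] by (auto simp: \<gamma>_def)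
  have \<gamma>\<beta>: "\<gamma> (\<beta> k) = k" "\<beta> k \<in> I" if "k < ?r" for k
    using that \<beta> bij_betw_inv_into_left[OF \<beta>] by (auto simp: \<gamma>_def bij_betw_def)
  \<comment> \<open>A copy of the simplex, scaled by \<open>\<epsilon> / 2\<close> and based at
    \<open>z\<close>, in the parameters \<open>I\<close>; the factor keeps it inside the box of
    radius \<open>\<epsilon>\<close>.\<close>
  define pt where "pt s = (\<lambda>i. z i + (if i \<in> I then \<epsilon> / 2 * s (\<gamma> i) else 0))" for s :: "nat \<Rightarrow> real"
  let ?\<Delta> = "std_simplex ?r"
  have ptO: "pt s \<in> O2 \<inter> O3" if s: "s \<in> ?\<Delta>" for s
  proof (rule box, intro allI impI)
    fix j
    have "0 \<le> s k \<and> s k \<le> 1" for k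
      using s std_simplex_subset_cube[of ?r] by (cases "k < ?r") (auto simp: std_simplex_def unit_cube_of_def)
    hence "\<bar>\<epsilon> / 2 * s (\<gamma> j)\<bar> \<le> \<epsilon> / 2 * 1" using e by (subst abs_mult) (intro mult_mono, auto)
    thus "\<bar>pt s j - z j\<bar> < \<epsilon>" using e by (auto simp: pt_def)
  qed
  have ptc: "continuous_on A pt" for A
  proof (rule continuous_on_coordinatewise_then_product)
    fix i show "continuous_on A (\<lambda>s. pt s i)" unfolding pt_def
      by (cases "i \<in> I") (auto intro!: continuous_intros)
  qed
  define f where "f s = nr (pt s)" for s
  have fc: "continuous_on ?\<Delta> f" unfolding f_def
    by (rule continuous_on_compose2[OF nrc ptc]) (use ptO in \<open>auto simp: O3_def\<close>)
  have fsig: "f s \<in> polyh \<inter> T \<and> sig (f s) = sig z" if s: "s \<in> ?\<Delta>" for s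
  proof -
    have o: "pt s \<in> O2" "pt s \<in> O3" using ptO[OF s] by auto
    have l: "0 < lform n w (\<psi> (pt s))" using o by (auto simp: O3_def O1_def)
    have "\<psi> (pt s) \<in> cell z" unfolding cell_iff using p2 o(1) by (auto simp: \<psi>_def O2_def S_def)
    hence c: "f s \<in> cell z" unfolding f_def nr_def using cell_divide[OF l] by blast
    hence "reval (f s) ut = lform n w (f s)" unfolding w_def using val_u_on_closure[of z "f s"] by (simp add: cell_def)
    also have "\<dots> = 1" unfolding f_def nr_def lform_divide using l by simp
    finally have "f s \<in> polyh" using cell_cone[OF zc] c by (auto simp: polyh_def)
    thus ?thesis using c o(2) by (auto simp: cell_def O3_def f_def)
  qed
  have inj: "inj_on f ?\<Delta>"
  proof (rule inj_onI)
    fix s t assume s: "s \<in> ?\<Delta>" and t: "t \<in> ?\<Delta>" and eq: "f s = f t"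
    define a b where "a = lform n w (\<psi> (pt s))" and "b = lform n w (\<psi> (pt t))"
    have a: "a > 0" and b: "b > 0" using ptO[OF s] ptO[OF t] by (auto simp: O3_def O1_def a_def b_def)
    have pi: "pt s i / a = pt t i / b" if "i \<in> I" for i
    proof -
      have "f s i = f t i" using eq by simp
      thus ?thesis using p3[OF that] by (simp add: f_def nr_def a_def b_def \<psi>_def)
    qed
    \<comment> \<open>The sum of the parameters is constant and positive on the simplex, so no ray
      from the origin meets it twice; this makes the central projection injective.\<close>
    have sumpt: "(\<Sum>i\<in>I. pt s i) = (\<Sum>i\<in>I. z i) + \<epsilon> / 2" if "s \<in> ?\<Delta>" for s
    proof -
      have "(\<Sum>i\<in>I. s (\<gamma> i)) = (\<Sum>k<?r. s (\<gamma> (\<beta> k)))" by (rule sum.reindex_bij_betw[OF \<beta>, symmetric])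
      also have "\<dots> = (\<Sum>k<?r. s k)" by (intro sum.cong) (auto simp: \<gamma>\<beta>)
      finally have "(\<Sum>i\<in>I. s (\<gamma> i)) = 1" using that by (simp add: std_simplex_def)
      hence "(\<Sum>i\<in>I. \<epsilon> / 2 * s (\<gamma> i)) = \<epsilon> / 2 * 1" by (simp only: sum_distrib_left[symmetric])
      thus ?thesis by (simp add: pt_def sum.distrib)
    qed
    have "(\<Sum>i\<in>I. pt s i) / a = (\<Sum>i\<in>I. pt t i) / b" unfolding sum_divide_distrib using pi by (intro sum.cong) auto
    hence "((\<Sum>i\<in>I. z i) + \<epsilon> / 2) / a = ((\<Sum>i\<in>I. z i) + \<epsilon> / 2) / b" using sumpt s t by simp
    moreover have "0 \<le> z i" for i using zc by (cases "i < n") (auto simp: cone_def)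
    hence "(\<Sum>i\<in>I. z i) + \<epsilon> / 2 > 0" using e by (intro add_nonneg_pos sum_nonneg) auto
    ultimately have "a = b" using a b by (simp add: frac_eq_eq)
    hence pts: "pt s i = pt t i" if "i \<in> I" for i using pi[OF that] a by simp
    have "s k = t k" for k
    proof (cases "k < ?r")
      case True
      thus ?thesis using pts[OF \<gamma>\<beta>(2)[OF True]] \<gamma>\<beta>[OF True] e by (simp add: pt_def)
    next
      case False thus ?thesis using s t by (simp add: std_simplex_def)
    qed
    thus "s = t" by blast
  qed
  obtain g where h: "homeomorphism ?\<Delta> (f ` ?\<Delta>) f g"
    using homeomorphism_compact[OF compact_std_simplex fc HOL.refl inj] by blast
  hence hom: "top_of_set ?\<Delta> homeomorphic_space top_of_set (f ` ?\<Delta>)"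
    unfolding homeomorphic_space_def homeomorphic_maps_def using h
    by (intro exI[of _ f] exI[of _ g]) (auto simp: homeomorphism_def continuous_map_in_subtopology)
  have "int (crk z) - 1 \<le> m" if "top_of_set (f ` ?\<Delta>) dim_le m" for m
  proof -
    have "top_of_set ?\<Delta> dim_le m" using that hom homeomorphic_space_dimension_le by blast
    hence "cover_multiplicity_le ?\<Delta> (nat (m + 1))" using dim_le_imp_cover_multiplicity_le compact_std_simplex by blast
    \<comment> \<open>Multiplicity counts one more than dimension, and the simplex with
      \<open>crk z\<close> vertices does not admit a multiplicity below
      \<open>crk z\<close>.\<close>
    hence "\<not> nat (m + 1) < crk z" using std_simplex_not_cover_multiplicity_le by blast
    thus ?thesis using dimension_le_bound[OF that] by arith
  qed
  thus ?thesis using that[of "f ` ?\<Delta>"] fsig by blast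
qed

text \<open>At every positive time on the segment from \<open>p\<close> to \<open>y\<close> each
  form has the sign it has at \<open>y\<close>, since at \<open>p\<close> it has the same sign or
  vanishes. Small times stay close to \<open>p\<close>.\<close>

lemma segment_towards_cell:
  assumes y: "y \<in> polyh" and p: "p \<in> polyh" and yp: "sig y \<subseteq> sig p" and T: "open T" "p \<in> T"
  obtains z where "z \<in> polyh" "z \<in> T" "sig z = sig y"
proof -
  define sg where "sg t = (\<lambda>i. (1 - t) * p i + t * y i)" for t :: real
  have lsg: "lform n a (sg t) = (1 - t) * lform n a p + t * lform n a y" for a t
    by (simp add: lform_def sg_def sum.distrib sum_subtractf sum_distrib_left algebra_simps)
  have sgP: "sg t \<in> polyh \<and> sig (sg t) = sig y" if t: "0 < t" "t \<le> 1" for t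
  proof -
    have "0 \<le> lform n a (sg t) \<longleftrightarrow> 0 \<le> lform n a y" if a: "a \<in> forms" for a
    proof (cases "0 \<le> lform n a y")
      case True
      hence "0 \<le> lform n a p" by (rule sig_closure_nonneg[OF yp a])
      thus ?thesis using True t by (simp add: lsg)
    next
      case False
      hence "lform n a p \<le> 0" using sig_closure_nonpos[OF yp a] by simp
      hence "(1 - t) * lform n a p \<le> 0" using t by (simp add: mult_nonneg_nonpos)
      moreover have "t * lform n a y < 0" using False t by (simp add: mult_pos_neg)
      ultimately show ?thesis using False by (simp add: lsg)
    qed
    hence sig: "sig (sg t) = sig y" unfolding sig_def by auto
    have "\<forall>i\<ge>n. sg t i = 0" using y p by (simp add: sg_def polyh_def cone_def)
    hence "sg t \<in> cone" using cone_closed_under_closure[of y "sg t"] y sig by (auto simp: polyh_def)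
    moreover have "reval (sg t) ut = 1"
    proof -
      have "reval (sg t) ut = lform n (uform y) (sg t)" using val_u_on_closure[of y "sg t"] sig by simp
      also have "\<dots> = (1 - t) * reval p ut + t * reval y ut"
        using val_u_on_closure[OF yp] val_u_on_closure[of y y] by (simp add: lsg)
      finally show ?thesis using y p by (simp add: polyh_def)
    qed
    ultimately show ?thesis using sig by (simp add: polyh_def)
  qed
  have cont: "continuous_on UNIV sg"
    unfolding sg_def by (intro continuous_on_coordinatewise_then_product continuous_intros)
  have "open (sg -` T)" using cont T(1) by (simp add: continuous_on_open_vimage)
  moreover have "0 \<in> sg -` T" using T(2) by (simp add: sg_def)
  ultimately obtain \<delta> where d: "\<delta> > 0" "ball 0 \<delta> \<subseteq> sg -` T" by (meson openE)
  define t where "t = min 1 (\<delta> / 2)"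
  have t: "0 < t" "t \<le> 1" "t \<in> ball 0 \<delta>" using d(1) by (auto simp: t_def)
  have "sg t \<in> T" using subsetD[OF d(2) t(3)] by simp
  thus ?thesis using that[of "sg t"] sgP[OF t(1,2)] by blast
qed

text \<open>Every neighbourhood of \<open>p\<close> meets a cell of largest rank with
  \<open>p\<close> in its closure, and inside that cell it contains a simplex of dimension one less
  than the rank.\<close>

lemma dim_le_neighbourhood_bound:
  assumes p: "p \<in> polyh" and U: "openin (top_of_set polyh) U" "p \<in> U" "top_of_set U dim_le m"
  shows "int (mrk p) - 1 \<le> m"
proof -
  obtain T where T: "open T" "U = polyh \<inter> T" using U(1) by (auto simp: openin_open)
  obtain y where y: "y \<in> polyh" "sig y \<subseteq> sig p" "crk y = mrk p" using mrk_attained[OF p] by blast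
  obtain z where z: "z \<in> polyh" "z \<in> T" "sig z = sig y"
    using segment_towards_cell[OF y(1) p y(2) T(1)] U(2) T(2) by blast
  obtain D where D: "D \<subseteq> polyh \<inter> T" "\<And>m. top_of_set D dim_le m \<Longrightarrow> int (crk z) - 1 \<le> m"
    by (rule simplex_in_cell[OF z(1) T(1) z(2)]) blast
  have "top_of_set D dim_le m" using dimension_le_subtopologies[OF U(3)] D(1) T(2) by blast
  thus ?thesis using D(2) crk_cong[OF z(3)] y(3) by simp
qed

definition star :: "(nat \<Rightarrow> real) \<Rightarrow> (nat \<Rightarrow> real) set" where
  "star p = {y\<in>polyh. sig y \<subseteq> sig p}"

text \<open>Finitely many strict inequalities cut out \<open>star p\<close>: the forms negative at
  \<open>p\<close> stay negative.\<close>

lemma openin_star: "openin (top_of_set polyh) (star p)"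
proof -
  let ?T = "{y. \<forall>a\<in>{a\<in>forms. lform n a p < 0}. lform n a y < 0}"
  have "?T = (\<Inter>a\<in>{a\<in>forms. lform n a p < 0}. {y. lform n a y < 0})" by auto
  hence "open ?T" using finite_forms
    by (auto intro!: open_INT open_Collect_less continuous_on_lform continuous_intros)
  moreover have "star p = polyh \<inter> ?T" by (fastforce simp: star_def sig_def not_le)
  ultimately show ?thesis by (simp add: openin_open_Int)
qed

text \<open>The star of \<open>p\<close> gives the bound from above, the simplices inside every
  neighbourhood give it from below.\<close>

lemma local_dim_polyh:
  assumes p: "p \<in> polyh"
  shows "local_dim (top_of_set polyh) p = int (mrk p) - 1"
  unfolding local_dim_def
proof (rule Least_equality)
  have sub: "subtopology (top_of_set polyh) U = top_of_set U" if "openin (top_of_set polyh) U" for U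
    using openin_subset[OF that] by (simp add: subtopology_subtopology Int_absorb1)
  have "top_of_set (star p) dim_le (int (mrk p) - 1)"
    by (rule dim_le_of_crk_bound) (auto simp: star_def intro: mrk_ge)
  thus "\<exists>U. openin (top_of_set polyh) U \<and> p \<in> U \<and> subtopology (top_of_set polyh) U dim_le int (mrk p) - 1"
    using openin_star[of p] sub p by (intro exI[of _ "star p"]) (auto simp: star_def)
  fix m assume "\<exists>U. openin (top_of_set polyh) U \<and> p \<in> U \<and> subtopology (top_of_set polyh) U dim_le m"
  thus "int (mrk p) - 1 \<le> m" using dim_le_neighbourhood_bound[OF p] sub by metis
qed

text \<open>A topological comparison: a simplex inside the cell of \<open>z\<close> lies in the flat
  that contains the closed cell of \<open>y\<close>, and the dimension of this flat bounds that of
  the simplex.\<close>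

lemma crk_mono:
  assumes z: "z \<in> polyh" and y: "y \<in> polyh" and yz: "sig y \<subseteq> sig z"
  shows "crk z \<le> crk y"
proof -
  obtain D where D: "D \<subseteq> polyh \<inter> UNIV" "\<And>w. w \<in> D \<Longrightarrow> sig w = sig z"
      "\<And>m. top_of_set D dim_le m \<Longrightarrow> int (crk z) - 1 \<le> m"
    by (rule simplex_in_cell[OF z, of UNIV]) auto
  obtain I c M where F: "affine_coords {w\<in>polyh. sig y \<subseteq> sig w} I c M" "card I < crk y"
    using closed_cell_flat[OF y] by blast
  have "top_of_set D dim_le (int (crk y) - 1)"
    by (rule dim_le_finite_union_flats[where \<F> = "{{w\<in>polyh. sig y \<subseteq> sig w}}"]) (use F D yz in auto)
  thus ?thesis using D(3) by force
qed

text \<open>Take a cell of largest rank with \<open>p\<close> in its closure. Cells having it in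
  their closure have at least its rank, and by maximality no more, so \<open>mrk\<close> is constant
  on its star. This supplies the open subset of a stratum.\<close>

lemma star_subset_stratum:
  assumes p: "p \<in> polyh"
  obtains z where "z \<in> polyh" "mrk z = mrk p" "crk z = mrk p" "\<And>y. y \<in> star z \<Longrightarrow> mrk y = mrk p"
proof -
  obtain y where y: "y \<in> polyh" "sig y \<subseteq> sig p" "crk y = mrk p" using mrk_attained[OF p] by blast
  have my: "mrk y = mrk p" by (rule mrk_eq[OF y(1,2) p y(3)])
  have "mrk w = mrk p" if w: "w \<in> star y" for w
  proof -
    have wP: "w \<in> polyh" "sig w \<subseteq> sig y" using w by (auto simp: star_def)
    have "crk w \<le> mrk p" using mrk_ge[OF wP(1)] wP(2) y(2) by blast
    hence "crk w = mrk y" using crk_mono[OF y(1) wP] y(3) my by simp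
    from mrk_eq[OF wP y(1) this] show ?thesis using my by simp
  qed
  thus ?thesis using that y(1,3) my by blast
qed

lemma top_dim_polyh:
  assumes ne: "polyh \<noteq> {}"
  shows "\<exists>p\<in>polyh. top_dim (top_of_set polyh) = int (mrk p) - 1"
    "\<And>p. p \<in> polyh \<Longrightarrow> int (mrk p) - 1 \<le> top_dim (top_of_set polyh)"
proof -
  define r where "r = Max (crk ` polyh)"
  have "r \<in> crk ` polyh" unfolding r_def using ne finite_crk_image by (intro Max_in) auto
  then obtain p where p: "p \<in> polyh" "crk p = r" by auto
  have le: "crk x \<le> r" if "x \<in> polyh" for x unfolding r_def using that finite_crk_image by (intro Max_ge) auto
  have mr: "mrk q \<le> r" if "q \<in> polyh" for q using mrk_attained[OF that] le by metis
  have mp: "mrk p = r" using mr[OF p(1)] mrk_ge[OF p(1) subset_refl] p(2) by simp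
  have td: "top_dim (top_of_set polyh) = int r - 1"
    unfolding top_dim_def
  proof (rule Least_equality)
    show "top_of_set polyh dim_le int r - 1" by (rule dim_le_of_crk_bound[OF subset_refl le])
    fix m assume "top_of_set polyh dim_le m"
    from dim_le_neighbourhood_bound[OF p(1) _ p(1) this] show "int r - 1 \<le> m" using mp by simp
  qed
  show "\<exists>p\<in>polyh. top_dim (top_of_set polyh) = int (mrk p) - 1" using td p(1) mp by metis
  show "int (mrk p) - 1 \<le> top_dim (top_of_set polyh)" if "p \<in> polyh" for p using mr[OF that] td by linarith
qed

end

section \<open>Averages along enumerations by denominator\<close>

text \<open>Elements are ordered by \<open>den\<close>, with ties broken by an arbitrary injection
  into the naturals. Each has finitely many predecessors, and their number serves as an injective
  key.\<close>

lemma monotone_enumeration_exists: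
  fixes D :: "'e set" and den :: "'e \<Rightarrow> nat"
  assumes fin: "\<And>m. finite {e\<in>D. den e \<le> m}"
  defines "I \<equiv> (if finite D then {1..card D} else {1..})"
  shows "\<exists>e. bij_betw e I D \<and> (\<forall>s\<in>I. \<forall>t\<in>I. s \<le> t \<longrightarrow> den (e s) \<le> den (e t))"
proof -
  have "countable (\<Union>m::nat. {e\<in>D. den e \<le> m})"
    using fin by (intro countable_UN countableI_type) (auto intro: countable_finite)
  moreover have "(\<Union>m. {e\<in>D. den e \<le> m}) = D" by auto
  ultimately have "countable D" by simp
  then obtain \<iota> :: "'e \<Rightarrow> nat" where \<iota>: "inj_on \<iota> D" by (auto simp: countable_def)
  define lt where "lt x y \<longleftrightarrow> den x < den y \<or> (den x = den y \<and> \<iota> x < \<iota> y)" for x y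
  define below where "below x = {y\<in>D. lt y x}" for x
  define key where "key x = card (below x)" for x
  have finb: "finite (below x)" for x
    by (rule finite_subset[OF _ fin[of "den x"]]) (auto simp: below_def lt_def)
  have keylt: "key x < key y" if "lt x y" "x \<in> D" for x y
    unfolding key_def using that by (intro psubset_card_mono finb) (auto simp: below_def lt_def)
  have tot: "lt x y \<or> lt y x" if "x \<in> D" "y \<in> D" "x \<noteq> y" for x y
    using that \<iota> unfolding lt_def inj_on_def by (metis linorder_neqE_nat)
  have inj: "inj_on key D"
    by (rule inj_onI) (metis keylt tot less_irrefl)
  have mono: "den x \<le> den y" if "x \<in> D" "y \<in> D" "key x \<le> key y" for x y
  proof (rule ccontr)
    assume "\<not> ?thesis"
    hence "lt y x" by (simp add: lt_def)
    thus False using keylt[of y x] that by simp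
  qed
  define S where "S = key ` D"
  have bijk: "bij_betw (inv_into D key) S D" unfolding S_def using inj by (simp add: inj_on_imp_bij_betw bij_betw_inv_into)
  define J where "J = (if finite D then {..<card D} else UNIV)"
  have finS: "finite S \<longleftrightarrow> finite D" unfolding S_def using inj finite_image_iff by blast
  have cardS: "card S = card D" unfolding S_def using inj by (rule card_image)
  have bije: "bij_betw (enumerate S) J S"
    using finite_bij_enumerate[of S] bij_enumerate[of S] finS cardS by (auto simp: J_def)
  have bijm: "bij_betw (\<lambda>t. t - 1) I J"
  proof (rule bij_betw_byWitness[where f' = Suc])
    show "(\<lambda>t. t - 1) ` I \<subseteq> J" unfolding I_def J_def by (auto split: if_splits)
    show "Suc ` J \<subseteq> I" unfolding I_def J_def by (auto split: if_splits)
  qed (auto simp: I_def J_def split: if_splits)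
  define e where "e = (\<lambda>t. inv_into D key (enumerate S (t - 1)))"
  have "bij_betw e I D"
    using bij_betw_trans[OF bij_betw_trans[OF bijm bije] bijk] by (simp add: e_def o_def)
  moreover have "den (e s) \<le> den (e t)" if st: "s \<in> I" "t \<in> I" "s \<le> t" for s t
  proof (rule mono)
    have J: "s - 1 \<in> J" "t - 1 \<in> J" using bijm st bij_betwE by blast+
    have "enumerate S (s - 1) \<le> enumerate S (t - 1)"
    proof (cases "s - 1 = t - 1")
      case False
      hence l: "s - 1 < t - 1" using st(3) by simp
      show ?thesis
      proof (cases "finite D")
        case True
        hence "t - 1 < card S" using J cardS by (simp add: J_def)
        hence "enumerate S (s - 1) < enumerate S (t - 1)" using finite_enumerate_mono[OF l] finS True by blast
        thus ?thesis by simp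
      next
        case False
        thus ?thesis using enumerate_mono[OF l, of S] finS by (simp add: less_imp_le)
      qed
    qed simp
    moreover have "key (e x) = enumerate S (x - 1)" if "x - 1 \<in> J" for x
    proof -
      have "enumerate S (x - 1) \<in> S" using bije that bij_betwE by blast
      thus ?thesis unfolding e_def S_def by (rule f_inv_into_f)
    qed
    ultimately show "key (e s) \<le> key (e t)" using J by simp
    show "e s \<in> D" "e t \<in> D" using \<open>bij_betw e I D\<close> st bij_betwE by blast+
  qed
  ultimately show ?thesis by blast
qed

text \<open>Subtracting the expected mean turns convergence into the smallness of a sum. It then
  remains to compare a partial enumeration with a full set \<open>Dm M\<close>: they differ by
  elements of a single denominator, whose number is also negligible.\<close>

lemma averages_converge:
  fixes D :: "'e set" and den :: "'e \<Rightarrow> nat" and f :: "'e \<Rightarrow> real"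
  assumes fin: "\<And>m. finite {e\<in>D. den e \<le> m}" and pos: "\<And>e. e \<in> D \<Longrightarrow> 1 \<le> den e"
    and bd: "\<And>e. e \<in> D \<Longrightarrow> \<bar>f e\<bar> \<le> B" and r: "r \<ge> 2"
    and Gf: "(\<lambda>N. (\<Sum>k=1..N. \<Sum>e\<in>{e\<in>D. den e \<le> N div k}. f e) / real N ^ r) \<longlonglongrightarrow> Cf"
    and G1: "(\<lambda>N. (\<Sum>k=1..N. real (card {e\<in>D. den e \<le> N div k})) / real N ^ r) \<longlonglongrightarrow> C1" and C1: "C1 > 0"
  shows "infinite D"
    "\<And>e :: nat \<Rightarrow> 'e. bij_betw e {1..} D \<Longrightarrow> (\<forall>s\<in>{1..}. \<forall>t\<in>{1..}. s \<le> t \<longrightarrow> den (e s) \<le> den (e t)) \<Longrightarrow>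
       (\<lambda>k. 1 / real k * (\<Sum>t=1..k. f (e t))) \<longlonglongrightarrow> Cf / C1"
proof -
  define Dm where "Dm m = {e\<in>D. den e \<le> m}" for m
  define a where "a m = real (card (Dm m))" for m
  define g where "g N = (\<Sum>k=1..N. a (N div k))" for N
  define lam where "lam = Cf / C1"
  define B' where "B' = \<bar>B\<bar> + \<bar>lam\<bar>"
  have finD: "finite (Dm m)" for m unfolding Dm_def by (rule fin)
  have a0: "a 0 = 0"
  proof -
    have "Dm 0 = {}" using pos by (force simp: Dm_def)
    thus ?thesis by (simp add: a_def)
  qed
  have ann: "0 \<le> a m" for m by (simp add: a_def)
  have amono: "a m \<le> a m'" if "m \<le> m'" for m m'
    unfolding a_def of_nat_le_iff by (rule card_mono[OF finD]) (use that in \<open>auto simp: Dm_def\<close>)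
  have g1: "(\<lambda>N. g N / real N ^ r) \<longlonglongrightarrow> C1" using G1 by (simp add: g_def a_def Dm_def)
  have ag: "a N \<le> g N" for N
  proof (cases "N = 0")
    case True thus ?thesis using a0 by (simp add: g_def)
  next
    case False
    have "a N = a (N div 1)" by simp
    also have "\<dots> \<le> g N" unfolding g_def by (rule member_le_sum) (use False ann in auto)
    finally show ?thesis .
  qed
  obtain K where K: "\<And>N. g N / real N ^ r \<le> K"
  proof -
    have "Bseq (\<lambda>N. g N / real N ^ r)" using g1 convergent_imp_Bseq convergentI by blast
    then obtain K where "\<And>N. norm (g N / real N ^ r) \<le> K" by (auto simp: Bseq_def)
    thus ?thesis using that[of K] by (metis abs_le_D1 real_norm_def)
  qed
  have aK: "a N \<le> K * real N ^ r" for N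
  proof (cases "N = 0")
    case True thus ?thesis using a0 r by (cases r) auto
  next
    case False
    hence "g N \<le> K * real N ^ r" using K[of N] by (simp add: divide_le_eq)
    thus ?thesis using ag[of N] by linarith
  qed
  obtain c where c: "c > 0" "\<forall>\<^sub>F N in sequentially. c * real N ^ r \<le> a N"
    using divisor_sum_lower_bound[OF r ann C1 g1[unfolded g_def]] by blast
  show inf: "infinite D"
  proof
    assume fD: "finite D"
    have b: "a N \<le> real (card D)" for N
      unfolding a_def of_nat_le_iff by (rule card_mono[OF fD]) (auto simp: Dm_def)
    have "\<forall>\<^sub>F N in sequentially. c * real N ^ r > real (card D)"
    proof -
      have "filterlim (\<lambda>N::nat. c * real N ^ r) at_top sequentially"
        using c(1) r by (intro filterlim_tendsto_pos_mult_at_top[OF tendsto_const c(1)] filterlim_pow_at_top filterlim_real_sequentially) auto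
      thus ?thesis by (simp add: filterlim_at_top_dense)
    qed
    with c(2) have "\<forall>\<^sub>F N in sequentially. False"
    proof eventually_elim
      case (elim N) thus ?case using b[of N] by linarith
    qed
    thus False by simp
  qed
  define Q where "Q m = (\<Sum>e\<in>Dm m. f e - lam)" for m
  have Qa: "Q m = (\<Sum>e\<in>Dm m. f e) - lam * a m" for m by (simp add: Q_def a_def sum_subtractf)
  have B'0: "B' \<ge> 0" by (simp add: B'_def)
  have fB: "\<bar>f e - lam\<bar> \<le> B'" if "e \<in> D" for e using bd[OF that] unfolding B'_def by linarith
  have QB: "\<bar>Q m\<bar> \<le> (B' * K) * real m ^ r" for m
  proof -
    have "\<bar>Q m\<bar> \<le> (\<Sum>e\<in>Dm m. \<bar>f e - lam\<bar>)" unfolding Q_def by (rule sum_abs)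
    also have "\<dots> \<le> (\<Sum>e\<in>Dm m. B')" by (rule sum_mono) (use fB in \<open>auto simp: Dm_def\<close>)
    also have "\<dots> = B' * a m" by (simp add: a_def)
    also have "\<dots> \<le> B' * (K * real m ^ r)" using aK B'0 by (intro mult_left_mono)
    finally show ?thesis by (simp add: mult.assoc)
  qed
  have Qlim: "(\<lambda>N. Q N / real N ^ r) \<longlonglongrightarrow> 0"
  proof (rule divisor_sum_negligible[OF r QB])
    have "(\<lambda>N. (\<Sum>k=1..N. \<Sum>e\<in>{e\<in>D. den e \<le> N div k}. f e) / real N ^ r - lam * (g N / real N ^ r)) \<longlonglongrightarrow> Cf - lam * C1"
      by (intro tendsto_diff Gf tendsto_mult_left g1)
    moreover have "(\<Sum>k=1..N. \<Sum>e\<in>{e\<in>D. den e \<le> N div k}. f e) / real N ^ r - lam * (g N / real N ^ r) = (\<Sum>k=1..N. Q (N div k)) / real N ^ r" for N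
      by (simp add: Qa g_def sum_subtractf sum_distrib_left diff_divide_distrib Dm_def)
    moreover have "Cf - lam * C1 = 0" using C1 by (simp add: lam_def)
    ultimately show "(\<lambda>N. (\<Sum>k=1..N. Q (N div k)) / real N ^ r) \<longlonglongrightarrow> 0" by simp
  qed
  define J where "J M = a (Suc M) - a M" for M
  have J0: "J M \<ge> 0" for M using amono[of M "Suc M"] by (simp add: J_def)
  \<comment> \<open>Every summand \<open>a (N div k)\<close> is nondecreasing in \<open>N\<close>,
    so the increase of the first one is at most that of the whole sum. Since
    \<open>g M / M ^ r\<close> converges, the increases of \<open>g\<close> are of smaller order
    than \<open>M ^ r\<close>.\<close>
  have Jg: "J M \<le> g (Suc M) - g M" for M
  proof (cases "M = 0")
    case True thus ?thesis using a0 by (simp add: J_def g_def)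
  next
    case False
    have "J M = (\<lambda>k. a (Suc M div k) - a (M div k)) 1" by (simp add: J_def)
    also have "\<dots> \<le> (\<Sum>k=1..M. a (Suc M div k) - a (M div k))"
    proof (rule member_le_sum)
      fix k assume "k \<in> {1..M} - {1}"
      have "M div k \<le> Suc M div k" by (rule div_le_mono) simp
      thus "0 \<le> a (Suc M div k) - a (M div k)" using amono by simp
    qed (use False in auto)
    also have "\<dots> \<le> g (Suc M) - g M" using ann by (simp add: g_def sum_subtractf)
    finally show ?thesis .
  qed
  have ratio: "(\<lambda>M. real (Suc M) / real M) \<longlonglongrightarrow> 1"
  proof -
    have "(\<lambda>M. 1 + 1 / real M) \<longlonglongrightarrow> 1 + 0" by (intro tendsto_add tendsto_const lim_1_over_n)
    moreover have "\<forall>\<^sub>F M in sequentially. 1 + 1 / real M = real (Suc M) / real M"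
      by (rule eventually_sequentiallyI[of 1]) (simp add: field_simps)
    ultimately show ?thesis using Lim_transform_eventually by fastforce
  qed
  have Jlim: "(\<lambda>M. J M / real M ^ r) \<longlonglongrightarrow> 0"
  proof (rule tendsto_sandwich[of "\<lambda>_. 0"])
    show "\<forall>\<^sub>F M in sequentially. 0 \<le> J M / real M ^ r" using J0 by simp
    show "\<forall>\<^sub>F M in sequentially. J M / real M ^ r \<le> g (Suc M) / real (Suc M) ^ r * (real (Suc M) / real M) ^ r - g M / real M ^ r"
    proof (rule eventually_sequentiallyI[of 1])
      fix M :: nat assume M: "1 \<le> M"
      have "g (Suc M) / real (Suc M) ^ r * (real (Suc M) / real M) ^ r = g (Suc M) / real M ^ r"
        by (simp add: power_divide del: of_nat_Suc)
      thus "J M / real M ^ r \<le> g (Suc M) / real (Suc M) ^ r * (real (Suc M) / real M) ^ r - g M / real M ^ r"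
        using Jg[of M] M by (simp add: diff_divide_distrib[symmetric] divide_right_mono)
    qed
    have "(\<lambda>M. g (Suc M) / real (Suc M) ^ r * (real (Suc M) / real M) ^ r - g M / real M ^ r) \<longlonglongrightarrow> C1 * 1 ^ r - C1"
      by (intro tendsto_diff tendsto_mult tendsto_power ratio g1 LIMSEQ_Suc[OF g1])
    thus "(\<lambda>M. g (Suc M) / real (Suc M) ^ r * (real (Suc M) / real M) ^ r - g M / real M ^ r) \<longlonglongrightarrow> 0" by simp
  qed simp
  define R where "R M = (\<bar>Q M\<bar> + B' * J M) / a M" for M
  have Rlim: "R \<longlonglongrightarrow> 0"
  proof (rule Lim_null_comparison)
    have "(\<lambda>M. (\<bar>Q M / real M ^ r\<bar> + B' * (J M / real M ^ r)) / c) \<longlonglongrightarrow> (\<bar>0\<bar> + B' * 0) / c"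
      using c(1) by (intro tendsto_divide tendsto_add tendsto_rabs tendsto_mult_left Qlim Jlim tendsto_const) auto
    thus "(\<lambda>M. (\<bar>Q M / real M ^ r\<bar> + B' * (J M / real M ^ r)) / c) \<longlonglongrightarrow> 0" by simp
    show "\<forall>\<^sub>F M in sequentially. norm (R M) \<le> (\<bar>Q M / real M ^ r\<bar> + B' * (J M / real M ^ r)) / c"
      using c(2) eventually_ge_at_top[of 1]
    proof eventually_elim
      case (elim M)
      have p: "real M ^ r > 0" using elim by simp
      have ap: "0 < c * real M ^ r" using p c(1) by simp
      have num: "0 \<le> \<bar>Q M\<bar> + B' * J M" using B'0 J0[of M] by simp
      have "norm (R M) = (\<bar>Q M\<bar> + B' * J M) / a M" using num ann by (simp add: R_def)
      also have "\<dots> \<le> (\<bar>Q M\<bar> + B' * J M) / (c * real M ^ r)"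
        using elim(1) ap num by (intro divide_left_mono) auto
      also have "\<dots> = (\<bar>Q M / real M ^ r\<bar> + B' * (J M / real M ^ r)) / c"
        using p c(1) by (simp add: field_simps)
      finally show ?case .
    qed
  qed
  fix e :: "nat \<Rightarrow> 'e" assume e: "bij_betw e {1..} D" and mono: "\<forall>s\<in>{1..}. \<forall>t\<in>{1..}. s \<le> t \<longrightarrow> den (e s) \<le> den (e t)"
  have eD: "e t \<in> D" if "t \<ge> 1" for t using e that bij_betwE by fastforce
  have einj: "inj_on e {1..}" using e by (rule bij_betw_imp_inj_on)
  \<comment> \<open>The first \<open>k\<close> terms contain all elements of denominator at most
    \<open>M k\<close>, and every other term among them has denominator exactly
    \<open>M k + 1\<close>.\<close>
  define M where "M k = den (e k) - 1" for k
  have key: "\<bar>(\<Sum>t=1..k. f (e t) - lam)\<bar> \<le> \<bar>Q (M k)\<bar> + B' * J (M k) \<and> a (M k) \<le> real k" if k: "k \<ge> 1" for k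
  proof -
    define T1 where "T1 = {t\<in>{1..}. den (e t) \<le> M k}"
    have dk: "den (e k) = Suc (M k)" using pos[OF eD[OF k]] by (simp add: M_def)
    have T1k: "T1 \<subseteq> {1..k}"
    proof
      fix t assume t: "t \<in> T1"
      have "t \<le> k"
      proof (rule ccontr)
        assume "\<not> t \<le> k"
        hence "den (e k) \<le> den (e t)" using mono k t by (auto simp: T1_def)
        thus False using t dk by (simp add: T1_def)
      qed
      thus "t \<in> {1..k}" using t by (simp add: T1_def)
    qed
    have bij1: "bij_betw e T1 (Dm (M k))"
    proof -
      have "e ` T1 = Dm (M k)"
      proof
        show "e ` T1 \<subseteq> Dm (M k)" using eD by (auto simp: T1_def Dm_def)
        show "Dm (M k) \<subseteq> e ` T1"
        proof
          fix x assume x: "x \<in> Dm (M k)"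
          then obtain t where "t \<ge> 1" "x = e t" using e by (force simp: Dm_def bij_betw_def)
          thus "x \<in> e ` T1" using x by (auto simp: T1_def Dm_def)
        qed
      qed
      moreover have "inj_on e T1" by (rule inj_on_subset[OF einj]) (auto simp: T1_def)
      ultimately show ?thesis by (simp add: bij_betw_def)
    qed
    have s1: "(\<Sum>t\<in>T1. f (e t) - lam) = Q (M k)"
      unfolding Q_def by (rule sum.reindex_bij_betw[OF bij1])
    have c1: "card T1 = card (Dm (M k))" using bij1 by (rule bij_betw_same_card)
    have "card T1 \<le> card {1..k}" by (rule card_mono[OF _ T1k]) simp
    hence ak: "a (M k) \<le> real k" using c1 by (simp add: a_def)
    let ?T2 = "{1..k} - T1"
    have "e ` ?T2 \<subseteq> Dm (Suc (M k)) - Dm (M k)"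
    proof clarify
      fix t assume t: "t \<in> {1..k}" "t \<notin> T1"
      have "den (e t) \<le> den (e k)" using mono t k by auto
      thus "e t \<in> Dm (Suc (M k)) - Dm (M k)" using t eD[of t] dk by (auto simp: Dm_def T1_def)
    qed
    hence "card (e ` ?T2) \<le> card (Dm (Suc (M k)) - Dm (M k))" using finD by (intro card_mono) auto
    moreover have "card (e ` ?T2) = card ?T2" by (rule card_image, rule inj_on_subset[OF einj]) auto
    moreover have "real (card (Dm (Suc (M k)) - Dm (M k))) = J (M k)"
    proof -
      have s: "Dm (M k) \<subseteq> Dm (Suc (M k))" by (auto simp: Dm_def)
      have "card (Dm (M k)) \<le> card (Dm (Suc (M k)))" by (rule card_mono[OF finD s])
      thus ?thesis using card_Diff_subset[OF finD s] by (simp add: J_def a_def of_nat_diff)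
    qed
    ultimately have c2: "real (card ?T2) \<le> J (M k)" by (metis of_nat_le_iff)
    have "\<bar>\<Sum>t\<in>?T2. f (e t) - lam\<bar> \<le> (\<Sum>t\<in>?T2. \<bar>f (e t) - lam\<bar>)" by (rule sum_abs)
    also have "\<dots> \<le> (\<Sum>t\<in>?T2. B')" by (rule sum_mono) (use fB eD in auto)
    also have "\<dots> \<le> B' * J (M k)" using c2 B'0 by (simp add: mult.commute mult_left_mono)
    finally have s2: "\<bar>\<Sum>t\<in>?T2. f (e t) - lam\<bar> \<le> B' * J (M k)" .
    have "(\<Sum>t=1..k. f (e t) - lam) = (\<Sum>t\<in>?T2. f (e t) - lam) + (\<Sum>t\<in>T1. f (e t) - lam)"
      by (rule sum.subset_diff[OF T1k]) simp
    thus ?thesis using s1 s2 ak by linarith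
  qed
  have Mlim: "filterlim M at_top sequentially"
    unfolding filterlim_at_top
  proof
    fix m
    have "finite {t\<in>{1..}. den (e t) \<le> m}"
    proof (rule finite_imageD[of e])
      show "finite (e ` {t\<in>{1..}. den (e t) \<le> m})" by (rule finite_subset[OF _ finD[of m]]) (use eD in \<open>auto simp: Dm_def\<close>)
      show "inj_on e {t\<in>{1..}. den (e t) \<le> m}" by (rule inj_on_subset[OF einj]) auto
    qed
    then obtain k0 where k0: "\<forall>t\<in>{t\<in>{1..}. den (e t) \<le> m}. t < k0"
      unfolding finite_nat_set_iff_bounded by (elim exE)
    show "\<forall>\<^sub>F k in sequentially. m \<le> M k"
    proof (rule eventually_sequentiallyI[of "max 1 k0"])
      fix k assume k: "max 1 k0 \<le> k"
      hence "\<not> den (e k) \<le> m" using bspec[OF k0, of k] by auto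
      thus "m \<le> M k" by (simp add: M_def)
    qed
  qed
  have RM: "(\<lambda>k. R (M k)) \<longlonglongrightarrow> 0" using filterlim_compose[OF Rlim Mlim] .
  have apos: "\<forall>\<^sub>F k in sequentially. a (M k) > 0"
  proof -
    have "\<forall>\<^sub>F N in sequentially. a N > 0"
      using c(2) eventually_ge_at_top[of 1]
    proof eventually_elim
      case (elim N)
      have "0 < c * real N ^ r" using elim c(1) by simp
      thus ?case using elim by linarith
    qed
    thus ?thesis using Mlim by (rule eventually_compose_filterlim)
  qed
  have "(\<lambda>k. 1 / real k * (\<Sum>t=1..k. f (e t)) - lam) \<longlonglongrightarrow> 0"
  proof (rule Lim_null_comparison[OF _ RM])
    show "\<forall>\<^sub>F k in sequentially. norm (1 / real k * (\<Sum>t=1..k. f (e t)) - lam) \<le> R (M k)"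
      using apos eventually_ge_at_top[of 1]
    proof eventually_elim
      case (elim k)
      have kp: "real k > 0" using elim by simp
      have "1 / real k * (\<Sum>t=1..k. f (e t)) - lam = (\<Sum>t=1..k. f (e t) - lam) / real k"
        using kp by (simp add: sum_subtractf field_simps)
      hence "norm (1 / real k * (\<Sum>t=1..k. f (e t)) - lam) = \<bar>\<Sum>t=1..k. f (e t) - lam\<bar> / real k" by simp
      also have "\<dots> \<le> (\<bar>Q (M k)\<bar> + B' * J (M k)) / real k" using key[of k] elim kp by (intro divide_right_mono) auto
      also have "\<dots> \<le> R (M k)" unfolding R_def
        using key[of k] elim kp B'0 J0 by (intro divide_left_mono) auto
      finally show ?case .
    qed
  qed
  hence "(\<lambda>k. 1 / real k * (\<Sum>t=1..k. f (e t))) \<longlonglongrightarrow> lam" by (rule LIM_zero_cancel)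
  thus "(\<lambda>k. 1 / real k * (\<Sum>t=1..k. f (e t))) \<longlonglongrightarrow> Cf / C1" unfolding lam_def .
qed

section \<open>States with rational values and their means\<close>

lemma has_denominator_dvd:
  assumes "has_denominator e b" "has_denominator e b'"
  shows "b dvd b'"
proof -
  have b: "b \<ge> 1" "b' \<ge> 1" and r: "range (\<lambda>k::nat. real k / real b) = range (\<lambda>k::nat. real k / real b')"
    using assms by (auto simp: has_denominator_def)
  have "real 1 / real b \<in> range (\<lambda>k::nat. real k / real b)" by (rule rangeI)
  then obtain k :: nat where "real 1 / real b = real k / real b'" using r by auto
  hence "real b' = real (k * b)" using b by (simp add: field_simps)
  hence "b' = k * b" by (simp only: of_nat_eq_iff)
  thus ?thesis by simp
qed

lemma denominator_eq: "has_denominator e b \<Longrightarrow> denominator e = b"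
  unfolding denominator_def by (rule the_equality) (auto intro: dvd_antisym has_denominator_dvd)

lemma has_denominator_integral:
  assumes "has_denominator e b" "b dvd N"
  shows "real N * e h \<in> \<int>"
proof -
  obtain k :: nat where "e h = real k / real b" using assms(1) by (auto simp: has_denominator_def)
  moreover obtain c where "N = b * c" using assms(2) by (auto simp: dvd_def)
  moreover have "b \<ge> 1" using assms(1) by (simp add: has_denominator_def)
  ultimately have "real N * e h = of_nat (c * k)" by simp
  thus ?thesis by (metis Ints_of_nat)
qed

text \<open>The integers \<open>real N * e h\<close> are closed under sums and truncated
  differences, so they are the multiples of their least positive element \<open>d\<close>.
  \<open>N\<close> is among them because \<open>e u = 1\<close>, and the denominator is the quotient
  of \<open>N\<close> by \<open>d\<close>.\<close>

lemma integral_values_imp_denominator: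
  assumes e: "e \<in> extremal_states u" and N: "N \<ge> 1" and int: "\<And>h. real N * e h \<in> \<int>"
  shows "\<exists>b. has_denominator e b \<and> b dvd N"
proof -
  have enn: "0 \<le> e h" and eadd: "e (g + h) = e g + e h" and ezero: "e 0 = 0" and eu: "e u = 1" and ediff: "e (g - h) = max 0 (e g - e h)" for g h
    using e by (auto simp: extremal_states_def hoop_state_def)
  define S where "S = {k::nat. \<exists>h. real N * e h = real k}"
  have S0: "0 \<in> S" using ezero by (auto simp: S_def intro!: exI[of _ 0])
  have SN: "N \<in> S" using eu by (auto simp: S_def intro!: exI[of _ u])
  have Sadd: "k + l \<in> S" if kl: "k \<in> S" "l \<in> S" for k l
  proof -
    obtain g h where "real N * e g = real k" "real N * e h = real l" using kl by (auto simp: S_def)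
    hence "real N * e (g + h) = real (k + l)" by (simp add: eadd algebra_simps)
    thus ?thesis unfolding S_def by blast
  qed
  have Sdiff: "k - l \<in> S" if kl: "k \<in> S" "l \<in> S" and "l \<le> k" for k l
  proof -
    obtain g h where gh: "real N * e g = real k" "real N * e h = real l" using kl by (auto simp: S_def)
    have "real N * (e g - e h) = real (k - l)" using gh \<open>l \<le> k\<close> by (simp add: algebra_simps of_nat_diff)
    moreover have "e g - e h \<ge> 0"
    proof -
      have "real N * e h \<le> real N * e g" using gh \<open>l \<le> k\<close> by simp
      thus ?thesis using N by simp
    qed
    ultimately have "real N * e (g - h) = real (k - l)" by (simp add: ediff)
    thus ?thesis unfolding S_def by blast
  qed
  define d where "d = (LEAST k. k \<in> S \<and> k > 0)"
  have d: "d \<in> S \<and> d > 0" unfolding d_def by (rule LeastI[of _ N]) (use SN N in auto)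
  have dmin: "d \<le> k" if "k \<in> S" "k > 0" for k unfolding d_def by (rule Least_le) (use that in auto)
  have mult: "j * d \<in> S" for j by (induction j) (use S0 d Sadd in auto)
  have dvd: "d dvd k" if "k \<in> S" for k
  proof -
    have "k mod d \<in> S" using Sdiff[OF that mult[of "k div d"]] by (simp add: minus_div_mult_eq_mod)
    hence "k mod d = 0" using dmin[of "k mod d"] d by (metis mod_less_divisor not_less zero_less_iff_neq_zero)
    thus ?thesis by auto
  qed
  obtain b where b: "N = b * d" using dvd[OF SN] by (auto simp: dvd_def mult.commute)
  have b1: "b \<ge> 1" using b N by (cases b) auto
  have "range e = range (\<lambda>k::nat. real k / real b)"
  proof
    show "range e \<subseteq> range (\<lambda>k::nat. real k / real b)"
    proof clarify
      fix h
      obtain z where z: "real N * e h = of_int z" using int[of h] by (auto elim: Ints_cases)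
      have "real N * e h \<ge> 0" using enn by simp
      hence "z \<ge> 0" using z by simp
      hence "real N * e h = real (nat z)" using z by simp
      moreover from this have "nat z \<in> S" unfolding S_def by blast
      then obtain j where "nat z = d * j" using dvd by (auto simp: dvd_def)
      ultimately have "e h = real j / real b" using b b1 d by (simp add: field_simps)
      thus "e h \<in> range (\<lambda>k::nat. real k / real b)" by blast
    qed
    show "range (\<lambda>k::nat. real k / real b) \<subseteq> range e"
    proof clarify
      fix k :: nat
      obtain h where "real N * e h = real (k * d)" using mult[of k] by (auto simp: S_def)
      hence "e h = real k / real b" using b b1 d by (simp add: field_simps)
      thus "real k / real b \<in> range e" by (metis rangeI)
    qed
  qed
  thus ?thesis using b b1 by (intro exI[of _ b]) (simp add: has_denominator_def)
qed

lemma reval_Ints: "s \<in> hterms n \<Longrightarrow> (\<And>i. i < n \<Longrightarrow> x i \<in> \<int>) \<Longrightarrow> reval x s \<in> \<int>"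
  by (induction rule: hterms.induct) (auto simp: max_def)

text \<open>Lets one limit cover both cases: the sequence of averages is constant for finite
  \<open>D\<close>, and the shift by one avoids the empty average otherwise.\<close>

definition mean_index :: "('a::cancellative_hoop \<Rightarrow> real) set \<Rightarrow> nat \<Rightarrow> nat" where
  "mean_index D k = (if finite D then card D else Suc k)"

lemma has_mean_iff_tendsto:
  "has_mean D e h c \<longleftrightarrow> (\<lambda>k. cesaro_average e h (mean_index D k)) \<longlonglongrightarrow> c"
proof (cases "finite D")
  case True
  thus ?thesis by (auto simp: has_mean_def mean_index_def LIMSEQ_const_iff)
next
  case False
  thus ?thesis by (simp add: has_mean_def mean_index_def filterlim_sequentially_Suc)
qed

lemma mean_index_pos: "D \<noteq> {} \<Longrightarrow> mean_index D k \<ge> 1"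
  by (auto simp: mean_index_def Suc_le_eq card_gt_0_iff)

lemma enumeration_mem:
  assumes "denominator_enumeration D e" "t \<in> {1..mean_index D k}"
  shows "e t \<in> D"
proof -
  have "bij_betw e (if finite D then {1..card D} else {1..}) D"
    using assms(1) by (simp add: denominator_enumeration_def Let_def)
  moreover have "t \<in> (if finite D then {1..card D} else {1..})" using assms(2) by (auto simp: mean_index_def)
  ultimately show ?thesis using bij_betwE by blast
qed

lemma mean_is_state:
  assumes D: "D \<subseteq> {m. hoop_state u m}" "D \<noteq> {}" and e: "denominator_enumeration D e"
    and m: "\<And>h. has_mean D e h (m h)"
  shows "hoop_state u m"
proof -
  have lim: "(\<lambda>k. cesaro_average e h (mean_index D k)) \<longlonglongrightarrow> m h" for h
    using m has_mean_iff_tendsto by blast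
  have st: "hoop_state u (e t)" if "t \<in> {1..mean_index D k}" for t k
    using enumeration_mem[OF e that] D(1) by blast
  show ?thesis unfolding hoop_state_def
  proof (intro conjI allI)
    fix h
    have "0 \<le> cesaro_average e h (mean_index D k)" for k
    proof -
      have "0 \<le> e t h" if "t \<in> {1..mean_index D k}" for t using st[OF that] by (simp add: hoop_state_def)
      hence "0 \<le> (\<Sum>t=1..mean_index D k. e t h)" by (rule sum_nonneg)
      thus ?thesis by (simp add: cesaro_average_def)
    qed
    thus "0 \<le> m h" using LIMSEQ_le_const[OF lim] by blast
  next
    have "cesaro_average e 0 (mean_index D k) = 0" for k
    proof -
      have "e t 0 = 0" if "t \<in> {1..mean_index D k}" for t using st[OF that] by (simp add: hoop_state_def)
      thus ?thesis by (simp add: cesaro_average_def)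
    qed
    thus "m 0 = 0" using lim[of 0] by (simp add: LIMSEQ_const_iff)
  next
    fix g h
    have "cesaro_average e (g + h) (mean_index D k) = cesaro_average e g (mean_index D k) + cesaro_average e h (mean_index D k)" for k
    proof -
      have "e t (g + h) = e t g + e t h" if "t \<in> {1..mean_index D k}" for t using st[OF that] by (simp add: hoop_state_def)
      hence "(\<Sum>t=1..mean_index D k. e t (g + h)) = (\<Sum>t=1..mean_index D k. e t g + e t h)" by (rule sum.cong[OF HOL.refl])
      thus ?thesis by (simp add: cesaro_average_def sum.distrib add_divide_distrib)
    qed
    hence "(\<lambda>k. cesaro_average e g (mean_index D k) + cesaro_average e h (mean_index D k)) \<longlonglongrightarrow> m (g + h)"
      using lim[of "g + h"] by simp
    from LIMSEQ_unique[OF this tendsto_add[OF lim lim]] show "m (g + h) = m g + m h" .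
  next
    have "cesaro_average e u (mean_index D k) = 1" for k
    proof -
      have "e t u = 1" if "t \<in> {1..mean_index D k}" for t using st[OF that] by (simp add: hoop_state_def)
      thus ?thesis using mean_index_pos[OF D(2), of k] by (simp add: cesaro_average_def)
    qed
    thus "m u = 1" using lim[of u] by (simp add: LIMSEQ_const_iff)
  qed
qed

lemma mean_zero:
  assumes "denominator_enumeration D e" "has_mean D e h c" "\<And>e. e \<in> D \<Longrightarrow> e h = 0"
  shows "c = 0"
proof -
  have "cesaro_average e h (mean_index D k) = 0" for k
  proof -
    have "(\<Sum>t=1..mean_index D k. e t h) = 0"
      by (rule sum.neutral) (use enumeration_mem[OF assms(1)] assms(3) in blast)
    thus ?thesis by (simp add: cesaro_average_def)
  qed
  thus ?thesis using assms(2) unfolding has_mean_iff_tendsto by (simp add: LIMSEQ_const_iff)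
qed

lemma extremal_compose_automorphism:
  assumes s: "hoop_automorphism \<sigma>" "\<sigma> u = u" and e: "e \<in> extremal_states u"
  shows "e \<circ> \<sigma> \<in> extremal_states u"
  using assms unfolding extremal_states_def hoop_automorphism_def hoop_state_def by simp

lemma inverse_automorphism:
  assumes s: "hoop_automorphism \<sigma>" "\<sigma> u = u"
  shows "hoop_automorphism (inv \<sigma>)" "inv \<sigma> u = u"
proof -
  have b: "bij \<sigma>" using s by (simp add: hoop_automorphism_def)
  have i: "inv \<sigma> (\<sigma> x) = x" "\<sigma> (inv \<sigma> x) = x" for x using b by (simp_all add: bij_is_inj bij_is_surj surj_f_inv_f)
  have "inv \<sigma> (x + y) = inv \<sigma> x + inv \<sigma> y" for x y
  proof -
    have "\<sigma> (inv \<sigma> x + inv \<sigma> y) = x + y" using s(1) i by (simp add: hoop_automorphism_def)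
    thus ?thesis using i(1) by metis
  qed
  moreover have "inv \<sigma> (x - y) = inv \<sigma> x - inv \<sigma> y" for x y
  proof -
    have "\<sigma> (inv \<sigma> x - inv \<sigma> y) = x - y" using s(1) i by (simp add: hoop_automorphism_def)
    thus ?thesis using i(1) by metis
  qed
  moreover have "inv \<sigma> 0 = 0" using s(1) i(1)[of 0] by (simp add: hoop_automorphism_def)
  ultimately show "hoop_automorphism (inv \<sigma>)" using b by (simp add: hoop_automorphism_def bij_imp_bij_inv)
  show "inv \<sigma> u = u" using i(1)[of u] s(2) by simp
qed

lemma local_dim_compose_automorphism:
  assumes s: "hoop_automorphism \<sigma>" "\<sigma> u = u" and e: "e \<in> extremal_states u"
  shows "local_dim (extremal_space u) (e \<circ> \<sigma>) = local_dim (extremal_space u) e"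
proof -
  have cont: "continuous_map (extremal_space u) (extremal_space u) (\<lambda>e. e \<circ> \<tau>)"
    if t: "hoop_automorphism \<tau>" "\<tau> u = u" for \<tau>
  proof -
    have "continuous_map (extremal_space u) (powertop_real UNIV) (\<lambda>e. e \<circ> \<tau>)"
      unfolding continuous_map_componentwise_UNIV
    proof
      fix h
      have "continuous_map (powertop_real UNIV) euclidean (\<lambda>e. e (\<tau> h))"
        by (rule continuous_map_product_projection) simp
      thus "continuous_map (extremal_space u) euclideanreal (\<lambda>e. (e \<circ> \<tau>) h)"
        unfolding extremal_space_def by (simp add: continuous_map_from_subtopology)
    qed
    moreover have "(\<lambda>e. e \<circ> \<tau>) \<in> topspace (extremal_space u) \<rightarrow> extremal_states u"
      using extremal_compose_automorphism[OF t] by (auto simp: extremal_space_def)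
    ultimately show ?thesis unfolding extremal_space_def by (simp add: continuous_map_in_subtopology)
  qed
  have b: "bij \<sigma>" using s by (simp add: hoop_automorphism_def)
  have "homeomorphic_maps (extremal_space u) (extremal_space u) (\<lambda>e. e \<circ> \<sigma>) (\<lambda>e. e \<circ> inv \<sigma>)"
    unfolding homeomorphic_maps_def using cont[OF s] cont[OF inverse_automorphism[OF s]] b
    by (auto simp: fun_eq_iff bij_is_inj bij_is_surj surj_f_inv_f)
  hence "homeomorphic_map (extremal_space u) (extremal_space u) (\<lambda>e. e \<circ> \<sigma>)"
    using homeomorphic_maps_map by blast
  from local_dim_homeomorphic[OF this, of e] show ?thesis using e by (simp add: extremal_space_def)
qed

lemma has_denominator_compose: "surj \<sigma> \<Longrightarrow> has_denominator (e \<circ> \<sigma>) b \<longleftrightarrow> has_denominator e b"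
  unfolding has_denominator_def image_comp[symmetric] by simp

text \<open>Composition with \<open>\<sigma>\<close> permutes the discrete states of the stratum and
  preserves denominators. It turns one admissible enumeration into another, and the mean is the same
  for both.\<close>

lemma mean_automorphism_invariant:
  assumes e: "denominator_enumeration (discrete_stratum u l) e"
    and m: "\<And>e h. denominator_enumeration (discrete_stratum u l) e \<Longrightarrow> has_mean (discrete_stratum u l) e h (m h)"
    and s: "hoop_automorphism \<sigma>" "\<sigma> u = u"
  shows "m (\<sigma> h) = m h"
proof -
  let ?D = "discrete_stratum u l"
  have mem: "e \<circ> \<tau> \<in> ?D" if t: "hoop_automorphism \<tau>" "\<tau> u = u" and "e \<in> ?D" for \<tau> e
  proof -
    have "surj \<tau>" using t(1) by (simp add: hoop_automorphism_def bij_is_surj)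
    moreover have "e \<in> extremal_states u" using \<open>e \<in> ?D\<close> by (simp add: discrete_stratum_def extremal_stratum_def)
    ultimately show ?thesis
      using \<open>e \<in> ?D\<close> extremal_compose_automorphism[OF t] local_dim_compose_automorphism[OF t]
      by (auto simp: discrete_stratum_def extremal_stratum_def discrete_state_def has_denominator_compose)
  qed
  have b: "bij \<sigma>" using s by (simp add: hoop_automorphism_def)
  have bij: "bij_betw (\<lambda>e. e \<circ> \<sigma>) ?D ?D"
    by (rule bij_betw_byWitness[where f' = "\<lambda>e. e \<circ> inv \<sigma>"])
      (use mem[OF s] mem[OF inverse_automorphism[OF s]] b in \<open>auto simp: fun_eq_iff bij_is_inj bij_is_surj surj_f_inv_f\<close>)
  define e' where "e' = (\<lambda>t. e t \<circ> \<sigma>)"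
  have den: "denominator (e \<circ> \<sigma>) = denominator e" for e
  proof -
    have "has_denominator (e \<circ> \<sigma>) = has_denominator e"
      by (rule ext) (simp add: has_denominator_compose b bij_is_surj)
    thus ?thesis by (simp add: denominator_def)
  qed
  have e': "denominator_enumeration ?D e'"
  proof -
    have "bij_betw e' (if finite ?D then {1..card ?D} else {1..}) ?D"
      using bij_betw_trans[OF _ bij, of e] e unfolding denominator_enumeration_def e'_def Let_def by (simp add: o_def)
    moreover have "denominator (e' s) = denominator (e s)" for s by (simp add: e'_def den)
    ultimately show ?thesis using e unfolding denominator_enumeration_def Let_def by simp
  qed
  have "cesaro_average e' h k = cesaro_average e (\<sigma> h) k" for k by (simp add: cesaro_average_def e'_def)
  hence "(\<lambda>k. cesaro_average e (\<sigma> h) (mean_index ?D k)) \<longlonglongrightarrow> m h"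
    using m[OF e', of h] unfolding has_mean_iff_tendsto by simp
  moreover have "(\<lambda>k. cesaro_average e (\<sigma> h) (mean_index ?D k)) \<longlonglongrightarrow> m (\<sigma> h)"
    using m[OF e, of "\<sigma> h"] unfolding has_mean_iff_tendsto .
  ultimately show ?thesis using LIMSEQ_unique by blast
qed

section \<open>Discrete states of a stratum as lattice points on rays\<close>

context presented_hoop
begin

definition stratum_pts :: "nat \<Rightarrow> (nat \<Rightarrow> real) set" where
  "stratum_pts r = {p\<in>polyh. mrk p = r}"

definition rat_states :: "nat \<Rightarrow> ('a \<Rightarrow> real) set" where
  "rat_states r = {e\<in>extremal_states u. coords e \<in> stratum_pts r \<and> discrete_state e}"

lemma local_dim_extremal:
  assumes e: "e \<in> extremal_states u"
  shows "local_dim (extremal_space u) e = int (mrk (coords e)) - 1"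
proof -
  have "homeomorphic_map (extremal_space u) (top_of_set polyh) coords"
    using homeomorphic_maps_coords_val homeomorphic_maps_map by blast
  from local_dim_homeomorphic[OF this, of e] show ?thesis
    using e local_dim_polyh[OF coords_polyh[OF e]] by (simp add: extremal_space_def)
qed

lemma discrete_stratum_eq: "discrete_stratum u (int r - 1) = rat_states r"
  unfolding discrete_stratum_def extremal_stratum_def rat_states_def stratum_pts_def
  using local_dim_extremal coords_polyh by auto

lemma val_in_extremal_stratum:
  assumes p: "p \<in> polyh"
  shows "val p \<in> extremal_stratum u (int (mrk p) - 1)"
  using val_extremal[OF p] local_dim_extremal[OF val_extremal[OF p]] coords_val[of p] p
  by (simp add: extremal_stratum_def polyh_def)

lemma extremal_stratum_nonempty:
  assumes "extremal_stratum u (int r - 1) \<noteq> {}"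
  shows "stratum_pts r \<noteq> {}"
proof -
  obtain e where e: "e \<in> extremal_states u" "local_dim (extremal_space u) e = int r - 1"
    using assms by (auto simp: extremal_stratum_def)
  hence "mrk (coords e) = r" using local_dim_extremal[OF e(1)] by simp
  thus ?thesis using coords_polyh[OF e(1)] by (auto simp: stratum_pts_def)
qed

lemma sig_divide: "c > 0 \<Longrightarrow> sig (\<lambda>i. y i / c) = sig y"
  by (simp add: sig_def lform_divide zero_le_divide_iff)

definition stratum_lattice :: "nat \<Rightarrow> nat \<Rightarrow> (nat \<Rightarrow> real) set" where
  "stratum_lattice r N = {v\<in>cone. 0 < val v u \<and> val v u \<le> real N \<and> (\<forall>j. v j \<in> \<int>) \<and>
     (\<lambda>j. v j / val v u) \<in> stratum_pts r}"

definition rep :: "nat \<Rightarrow> (nat \<Rightarrow> int) set \<Rightarrow> nat \<Rightarrow> real" where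
  "rep r S = (SOME p. p \<in> stratum_pts r \<and> sig p = S)"

lemma rep: "S \<in> sig ` stratum_pts r \<Longrightarrow> rep r S \<in> stratum_pts r \<and> sig (rep r S) = S"
proof -
  assume "S \<in> sig ` stratum_pts r"
  hence "\<exists>p. p \<in> stratum_pts r \<and> sig p = S" by auto
  from someI_ex[OF this] show ?thesis unfolding rep_def .
qed

text \<open>Scaling does not change \<open>sig\<close>, and \<open>mrk\<close> depends on
  \<open>sig\<close> only, so the stratum is a union of cells and one representative per sign
  pattern suffices.\<close>

lemma stratum_lattice_cells: "stratum_lattice r N = (\<Union>S\<in>sig ` stratum_pts r. cell_lattice (rep r S) N)"
proof (intro equalityI subsetI)
  fix v assume v: "v \<in> stratum_lattice r N"
  have vc: "v \<in> cone" "0 < val v u" and p: "(\<lambda>j. v j / val v u) \<in> stratum_pts r"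
    using v by (auto simp: stratum_lattice_def)
  have sv: "sig v \<in> sig ` stratum_pts r" using p sig_divide[OF vc(2), of v] by (metis imageI)
  have "v \<in> cell (rep r (sig v))" using vc(1) rep[OF sv] by (simp add: cell_def cone_def)
  hence "v \<in> cell_lattice (rep r (sig v)) N" using v by (simp add: cell_lattice_def stratum_lattice_def)
  thus "v \<in> (\<Union>S\<in>sig ` stratum_pts r. cell_lattice (rep r S) N)" using sv by blast
next
  fix v assume "v \<in> (\<Union>S\<in>sig ` stratum_pts r. cell_lattice (rep r S) N)"
  then obtain S where S: "S \<in> sig ` stratum_pts r" "v \<in> cell_lattice (rep r S) N" by blast
  have R: "rep r S \<in> polyh" "mrk (rep r S) = r" using rep[OF S(1)] by (auto simp: stratum_pts_def)
  have vcell: "v \<in> cell (rep r S)" using S(2) by (simp add: cell_lattice_def)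
  have vc: "v \<in> cone" "val v u > 0" using cell_val_pos[OF _ _ vcell] R(1) by (auto simp: polyh_iff)
  have "sig (\<lambda>j. v j / val v u) = sig (rep r S)" using sig_divide[OF vc(2), of v] vcell by (simp add: cell_def)
  hence "mrk (\<lambda>j. v j / val v u) = r" using mrk_cong R(2) by metis
  hence "(\<lambda>j. v j / val v u) \<in> stratum_pts r" using normalise[OF vc] by (simp add: stratum_pts_def)
  thus "v \<in> stratum_lattice r N" using vc S(2) by (simp add: stratum_lattice_def cell_lattice_def)
qed

lemma finite_sig_stratum: "finite (sig ` stratum_pts r)"
  by (rule finite_subset[OF _ finite_sigs]) auto

lemma rep_cone: "S \<in> sig ` stratum_pts r \<Longrightarrow> rep r S \<in> cone \<and> val (rep r S) u > 0"
  using rep[of S r] by (auto simp: stratum_pts_def polyh_iff)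

lemma finite_stratum_lattice: "N \<ge> 1 \<Longrightarrow> finite (stratum_lattice r N)"
  unfolding stratum_lattice_cells
  using finite_sig_stratum rep_cone cell_lattice_asymptotics(1) by blast

lemma sum_stratum_lattice:
  assumes "N \<ge> 1"
  shows "(\<Sum>v\<in>stratum_lattice r N. f v) = (\<Sum>S\<in>sig ` stratum_pts r. \<Sum>v\<in>cell_lattice (rep r S) N. f v)"
  unfolding stratum_lattice_cells
proof (rule sum.UNION_disjoint)
  show "finite (sig ` stratum_pts r)" by (rule finite_sig_stratum)
  show "\<forall>S\<in>sig ` stratum_pts r. finite (cell_lattice (rep r S) N)"
    using rep_cone cell_lattice_asymptotics(1)[OF _ _ assms] by blast
  show "\<forall>S\<in>sig ` stratum_pts r. \<forall>T\<in>sig ` stratum_pts r. S \<noteq> T \<longrightarrow>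
      cell_lattice (rep r S) N \<inter> cell_lattice (rep r T) N = {}"
    using rep by (auto simp: cell_lattice_def cell_def)
qed

text \<open>Cells of rank below \<open>r\<close> contribute a smaller order. If \<open>h\<close> is
  positive at some \<open>p\<close> of the stratum, it is still positive at a nearby point of a rank
  \<open>r\<close> cell of the stratum, and the limit for that cell is positive.\<close>

lemma stratum_lattice_asymptotics:
  "\<exists>C\<ge>0. (\<lambda>N. (\<Sum>v\<in>stratum_lattice r N. val v h / val v u) / real N ^ r) \<longlonglongrightarrow> C \<and>
     ((\<exists>p\<in>stratum_pts r. val p h > 0) \<longrightarrow> C > 0)"
proof -
  let ?s = "\<lambda>x N. \<Sum>v\<in>cell_lattice x N. val v h / val v u"
  have cells: "\<exists>C\<ge>0. (\<lambda>N. ?s x N / real N ^ r) \<longlonglongrightarrow> C \<and> (crk x = r \<and> val x h > 0 \<longrightarrow> C > 0)"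
    if x: "x \<in> stratum_pts r" for x
  proof -
    have xc: "x \<in> cone" "val x u > 0" using x by (auto simp: stratum_pts_def polyh_iff)
    obtain C where C: "C \<ge> 0" "(\<lambda>N. ?s x N / real N ^ crk x) \<longlonglongrightarrow> C" "val x h > 0 \<longrightarrow> C > 0"
      using cell_lattice_asymptotics(2)[OF xc, of h] by blast
    have "crk x \<le> r" using mrk_ge[of x x] x by (simp add: stratum_pts_def)
    show ?thesis
    proof (cases "crk x = r")
      case True thus ?thesis using C by auto
    next
      case False
      define k where "k = r - crk x"
      have k: "r = crk x + k" "k > 0" using False \<open>crk x \<le> r\<close> by (auto simp: k_def)
      have "(\<lambda>N. (1 / real N) ^ k) \<longlonglongrightarrow> 0 ^ k" by (intro tendsto_power lim_1_over_n)
      hence "(\<lambda>N. ?s x N / real N ^ crk x * (1 / real N) ^ k) \<longlonglongrightarrow> C * 0 ^ k" by (intro tendsto_mult C(2))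
      moreover have "?s x N / real N ^ crk x * (1 / real N) ^ k = ?s x N / real N ^ r" for N
        by (simp add: k power_add power_divide)
      ultimately have "(\<lambda>N. ?s x N / real N ^ r) \<longlonglongrightarrow> 0" using k(2) by (simp add: zero_power)
      thus ?thesis using False by (intro exI[of _ 0]) simp
    qed
  qed
  have "\<exists>C. \<forall>S\<in>sig ` stratum_pts r. C S \<ge> 0 \<and> (\<lambda>N. ?s (rep r S) N / real N ^ r) \<longlonglongrightarrow> C S"
    using cells rep by (intro bchoice) blast
  then obtain C where C: "\<And>S. S \<in> sig ` stratum_pts r \<Longrightarrow> C S \<ge> 0 \<and> (\<lambda>N. ?s (rep r S) N / real N ^ r) \<longlonglongrightarrow> C S" by blast
  let ?C = "\<Sum>S\<in>sig ` stratum_pts r. C S"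
  have "(\<lambda>N. \<Sum>S\<in>sig ` stratum_pts r. ?s (rep r S) N / real N ^ r) \<longlonglongrightarrow> ?C"
    using C by (intro tendsto_sum) blast
  moreover have "\<forall>\<^sub>F N in sequentially. (\<Sum>S\<in>sig ` stratum_pts r. ?s (rep r S) N / real N ^ r) = (\<Sum>v\<in>stratum_lattice r N. val v h / val v u) / real N ^ r"
    by (rule eventually_sequentiallyI[of 1]) (simp add: sum_stratum_lattice sum_divide_distrib)
  ultimately have lim: "(\<lambda>N. (\<Sum>v\<in>stratum_lattice r N. val v h / val v u) / real N ^ r) \<longlonglongrightarrow> ?C"
    by (rule Lim_transform_eventually)
  have nn: "?C \<ge> 0" using C by (intro sum_nonneg) blast
  have "?C > 0" if p: "p \<in> stratum_pts r" "val p h > 0" for p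
  proof -
    have pP: "p \<in> polyh" "mrk p = r" using p(1) by (auto simp: stratum_pts_def)
    obtain y where y: "y \<in> polyh" "sig y \<subseteq> sig p" "crk y = mrk p" using mrk_attained[OF pP(1)] by blast
    have T: "open {x. 0 < reval x (tm h)}" by (intro open_Collect_less continuous_on_reval continuous_intros)
    obtain z where z: "z \<in> polyh" "0 < reval z (tm h)" "sig z = sig y"
      using segment_towards_cell[OF y(1) pP(1) y(2) T] p(2) by (auto simp: val_def)
    have cz: "crk z = r" using crk_cong[OF z(3)] y(3) pP(2) by simp
    have "mrk z = r" using mrk_eq[of z p] z y pP cz by simp
    hence zs: "z \<in> stratum_pts r" using z(1) by (simp add: stratum_pts_def)
    obtain C' where C': "(\<lambda>N. ?s z N / real N ^ r) \<longlonglongrightarrow> C'" "C' > 0"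
      using cells[OF zs] cz z(2) by (auto simp: val_def)
    have S: "sig z \<in> sig ` stratum_pts r" using zs by blast
    have "cell_lattice (rep r (sig z)) N = cell_lattice z N" for N
      using rep[OF S] by (simp add: cell_lattice_def cell_def)
    hence "C (sig z) = C'" using C[OF S] C'(1) LIMSEQ_unique by auto
    hence "0 < C (sig z)" using C'(2) by simp
    also have "\<dots> \<le> ?C" using S C finite_sig_stratum by (intro member_le_sum) auto
    finally show ?thesis .
  qed
  thus ?thesis using lim nn by blast
qed

abbreviation rat_upto :: "nat \<Rightarrow> nat \<Rightarrow> ('a \<Rightarrow> real) set" where
  "rat_upto r m \<equiv> {e\<in>rat_states r. denominator e \<le> m}"

lemma rat_state_denominator: "e \<in> rat_states r \<Longrightarrow> has_denominator e (denominator e)"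
  using denominator_eq by (auto simp: rat_states_def discrete_state_def)

lemma rat_state_denominator_pos: "e \<in> rat_states r \<Longrightarrow> 1 \<le> denominator e"
  using rat_state_denominator by (auto simp: has_denominator_def)

lemma scaled_coords:
  assumes e: "e \<in> rat_states r" and k: "k \<ge> 1"
  defines "v \<equiv> \<lambda>j. real (k * denominator e) * coords e j"
  shows "v \<in> cone" "val v h = real (k * denominator e) * e h" "val v u = real (k * denominator e)"
    "(\<lambda>j. v j / val v u) = coords e" "\<forall>j. v j \<in> \<int>"
proof -
  have ex: "e \<in> extremal_states u" using e by (simp add: rat_states_def)
  have cp: "coords e \<in> polyh" by (rule coords_polyh[OF ex])
  show "v \<in> cone" unfolding v_def using cp by (intro scale_cone) (auto simp: polyh_def)
  have vh: "val v h = real (k * denominator e) * e h" for h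
    unfolding v_def by (subst val_scale) (simp_all add: val_coords[OF ex])
  thus "val v h = real (k * denominator e) * e h" .
  show vu: "val v u = real (k * denominator e)" using vh[of u] ex by (simp add: extremal_states_def hoop_state_def)
  have "real (k * denominator e) \<noteq> 0" using k rat_state_denominator_pos[OF e] by simp
  thus "(\<lambda>j. v j / val v u) = coords e" unfolding vu by (simp add: v_def)
  show "\<forall>j. v j \<in> \<int>" unfolding v_def coords_def
    using has_denominator_integral[OF rat_state_denominator[OF e], of "k * denominator e"] by auto
qed

text \<open>The height of a lattice point is \<open>k\<close> times the denominator of its state, so
  the bound \<open>N\<close> on the height becomes
  \<open>denominator e \<le> N div k\<close>.\<close>

lemma rat_states_lattice_bij:
  "bij_betw (\<lambda>(k, e). \<lambda>j. real (k * denominator e) * coords e j) (SIGMA k:{1..N}. rat_upto r (N div k)) (stratum_lattice r N)"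
  (is "bij_betw ?F ?A ?B")
  unfolding bij_betw_def
proof
  show "inj_on ?F ?A"
  proof (rule inj_onI, clarify)
    fix k e k' e'
    assume h: "k \<in> {1..N}" "e \<in> rat_states r" "k' \<in> {1..N}" "e' \<in> rat_states r"
      and eq: "(\<lambda>j. real (k * denominator e) * coords e j) = (\<lambda>j. real (k' * denominator e') * coords e' j)"
    have k: "k \<ge> 1" "k' \<ge> 1" using h by auto
    have "coords e = coords e'"
      using scaled_coords(4)[OF h(2) k(1)] scaled_coords(4)[OF h(4) k(2)] eq by metis
    hence ee: "e = e'" using h(2,4) val_coords unfolding rat_states_def by (metis (no_types, lifting) mem_Collect_eq)
    have "real (k * denominator e) = real (k' * denominator e')"
      using scaled_coords(3)[OF h(2) k(1)] scaled_coords(3)[OF h(4) k(2)] eq by metis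
    hence "k * denominator e = k' * denominator e" using ee by (simp only: of_nat_eq_iff)
    thus "k = k' \<and> e = e'" using ee rat_state_denominator_pos[OF h(2)] by simp
  qed
next
  show "?F ` ?A = ?B"
  proof (intro equalityI subsetI)
    fix v assume "v \<in> ?F ` ?A"
    then obtain k e where h: "k \<in> {1..N}" "e \<in> rat_states r" "denominator e \<le> N div k"
      and v: "v = (\<lambda>j. real (k * denominator e) * coords e j)" by auto
    have k: "k \<ge> 1" using h by auto
    have "denominator e * k \<le> N" using h(3) k by (simp add: less_eq_div_iff_mult_less_eq)
    hence "real (k * denominator e) \<le> real N" by (simp only: of_nat_le_iff mult.commute)
    moreover have "0 < real (k * denominator e)" using k rat_state_denominator_pos[OF h(2)] by simp
    moreover have "coords e \<in> stratum_pts r" using h(2) by (simp add: rat_states_def)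
    moreover have vu: "val v u = real (k * denominator e)" unfolding v by (rule scaled_coords(3)[OF h(2) k])
    moreover have nrm: "(\<lambda>j. v j / val v u) = coords e" unfolding v by (rule scaled_coords(4)[OF h(2) k])
    moreover have "v \<in> cone" "\<forall>j. v j \<in> \<int>" unfolding v by (rule scaled_coords(1)[OF h(2) k], rule scaled_coords(5)[OF h(2) k])
    ultimately show "v \<in> ?B" unfolding stratum_lattice_def mem_Collect_eq nrm unfolding vu by blast
  next
    fix v assume v: "v \<in> ?B"
    define p where "p = (\<lambda>j. v j / val v u)"
    have vc: "v \<in> cone" "0 < val v u" "val v u \<le> real N" and vint: "\<And>j. v j \<in> \<int>" and p: "p \<in> stratum_pts r"
      using v by (auto simp: stratum_lattice_def p_def)
    have pP: "p \<in> polyh" using p by (simp add: stratum_pts_def)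
    have ex: "val p \<in> extremal_states u" by (rule val_extremal[OF pP])
    have cp: "coords (val p) = p" using coords_val pP by (simp add: polyh_def)
    have vi: "val v h \<in> \<int>" for h unfolding val_def by (rule reval_Ints[OF tm(1)]) (rule vint)
    obtain z where z: "val v u = of_int z" using vi[of u] by (auto elim: Ints_cases)
    define N0 where "N0 = nat z"
    have N0: "val v u = real N0" "N0 \<ge> 1" using z vc(2) by (auto simp: N0_def)
    have pv: "real N0 * val p h = val v h" for h
      unfolding p_def using val_scale[of "1 / val v u" v h] vc(2) N0(1) by simp
    \<comment> \<open>Terms at integral coordinates take integral values, so \<open>N0\<close>
      clears all values of the state and is a multiple of its denominator.\<close>
    obtain b where b: "has_denominator (val p) b" "b dvd N0"
      using integral_values_imp_denominator[OF ex N0(2)] pv vi by metis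
    have db: "denominator (val p) = b" by (rule denominator_eq[OF b(1)])
    have e: "val p \<in> rat_states r" using ex cp p b(1) by (auto simp: rat_states_def discrete_state_def)
    obtain k where k: "N0 = b * k" using b(2) by (auto simp: dvd_def)
    have k1: "k \<ge> 1" using k N0(2) by (cases k) auto
    have b1: "b \<ge> 1" using b(1) by (simp add: has_denominator_def)
    have "N0 \<le> N" using vc(3) N0(1) by simp
    hence bk: "b * k \<le> N" using k by simp
    have "1 * k \<le> b * k" using b1 by (rule mult_right_mono) simp
    hence "k \<le> N" using bk by linarith
    hence "k \<in> {1..N}" using k1 by simp
    moreover have "b \<le> N div k" using bk k1 by (simp add: less_eq_div_iff_mult_less_eq)
    moreover have "(\<lambda>j. real (k * b) * p j) = v"
      using N0 vc(2) k by (auto simp: p_def mult.commute fun_eq_iff)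
    ultimately show "v \<in> ?F ` ?A" using e db cp by (intro image_eqI[of _ _ "(k, val p)"]) auto
  qed
qed

lemma finite_rat_upto: "finite (rat_upto r m)"
proof (cases "m \<ge> 1")
  case True
  have "finite (SIGMA k:{1..m}. rat_upto r (m div k))"
    using bij_betw_finite[OF rat_states_lattice_bij[of m r]] finite_stratum_lattice[OF True] by blast
  hence "finite (snd ` (SIGMA k:{1..m}. rat_upto r (m div k)))" by (rule finite_imageI)
  moreover have "rat_upto r m \<subseteq> snd ` (SIGMA k:{1..m}. rat_upto r (m div k))"
    using True by (force intro!: image_eqI[of _ snd "(1, _)"])
  ultimately show ?thesis by (rule finite_subset[rotated])
next
  case False
  hence e: "rat_upto r m = {}" using rat_state_denominator_pos by fastforce
  show ?thesis unfolding e by (rule finite.emptyI)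
qed

text \<open>The weight \<open>val v h / val v u\<close> is the value at \<open>h\<close> of the
  state on the ray of \<open>v\<close>, whatever the multiple \<open>k\<close>.\<close>

lemma sum_rat_states:
  "(\<Sum>k=1..N. \<Sum>e\<in>rat_upto r (N div k). e h) = (\<Sum>v\<in>stratum_lattice r N. val v h / val v u)"
proof -
  have "(\<Sum>k=1..N. \<Sum>e\<in>rat_upto r (N div k). e h) = (\<Sum>(k, e)\<in>(SIGMA k:{1..N}. rat_upto r (N div k)). e h)"
    using finite_rat_upto by (subst sum.Sigma) auto
  also have "\<dots> = (\<Sum>x\<in>(SIGMA k:{1..N}. rat_upto r (N div k)).
      (\<lambda>v. val v h / val v u) ((\<lambda>(k, e). \<lambda>j. real (k * denominator e) * coords e j) x))"
  proof (intro sum.cong HOL.refl, clarify)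
    fix k e assume k: "k \<in> {1..N}" and e: "e \<in> rat_states r"
    have k1: "k \<ge> 1" using k by simp
    have "real (k * denominator e) \<noteq> 0" using k1 rat_state_denominator_pos[OF e] by simp
    thus "e h = val (\<lambda>j. real (k * denominator e) * coords e j) h / val (\<lambda>j. real (k * denominator e) * coords e j) u"
      unfolding scaled_coords(2)[OF e k1, of h] scaled_coords(3)[OF e k1] by simp
  qed
  also have "\<dots> = (\<Sum>v\<in>stratum_lattice r N. val v h / val v u)"
    by (rule sum.reindex_bij_betw[OF rat_states_lattice_bij])
  finally show ?thesis .
qed

text \<open>Cells of rank 1 lie in flats without free coordinates, that is, in single
  points.\<close>

lemma finite_stratum_one: "finite (stratum_pts 1)"
proof -
  have "finite {w\<in>polyh. S \<subseteq> sig w}" if S: "S \<in> sig ` stratum_pts 1" for S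
  proof -
    obtain y where y: "y \<in> polyh" "mrk y = 1" "S = sig y" using S by (auto simp: stratum_pts_def)
    have "crk y \<le> 1" using mrk_ge[OF y(1), of y] y(2) by simp
    then obtain I c M where "affine_coords {w\<in>polyh. S \<subseteq> sig w} I c M" "card I < 1"
      using closed_cell_flat[OF y(1)] y(3) by (metis less_le_trans)
    hence "\<forall>x\<in>{w\<in>polyh. S \<subseteq> sig w}. \<forall>j. x j = c j" by (auto simp: affine_coords_def)
    hence "{w\<in>polyh. S \<subseteq> sig w} \<subseteq> {c}" by (auto simp: fun_eq_iff)
    thus ?thesis using finite_subset by blast
  qed
  hence "finite (\<Union>S\<in>sig ` stratum_pts 1. {w\<in>polyh. S \<subseteq> sig w})" using finite_sig_stratum by blast
  moreover have "stratum_pts 1 \<subseteq> (\<Union>S\<in>sig ` stratum_pts 1. {w\<in>polyh. S \<subseteq> sig w})" by (auto simp: stratum_pts_def)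
  ultimately show ?thesis by (rule finite_subset[rotated])
qed

lemma inj_on_coords: "inj_on coords (extremal_states u)"
  by (rule inj_on_inverseI[where g = val]) (rule val_coords)

text \<open>If \<open>h\<close> vanished at all discrete states of the stratum, the lattice sums
  would be 0, against their positive limit; so the asymptotics also supply enough rational
  points.\<close>

lemma rat_state_pos:
  assumes p: "p \<in> stratum_pts r" "val p h > 0"
  shows "\<exists>e\<in>rat_states r. e h > 0"
proof (rule ccontr)
  assume "\<not> ?thesis"
  hence z: "e h = 0" if "e \<in> rat_states r" for e
    using that by (fastforce simp: rat_states_def extremal_states_def hoop_state_def not_less dest: order_antisym)
  have "(\<Sum>v\<in>stratum_lattice r N. val v h / val v u) = 0" for N
    unfolding sum_rat_states[symmetric] using z by (intro sum.neutral ballI) auto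
  moreover obtain C where "C > 0" "(\<lambda>N. (\<Sum>v\<in>stratum_lattice r N. val v h / val v u) / real N ^ r) \<longlonglongrightarrow> C"
    using stratum_lattice_asymptotics[where r = r and h = h] p by blast
  ultimately show False by (simp add: LIMSEQ_const_iff)
qed

lemma stratum_mean:
  assumes ne: "stratum_pts r \<noteq> {}"
  shows "rat_states r \<noteq> {}" "\<exists>e. denominator_enumeration (rat_states r) e"
    "\<exists>m. (\<forall>h e. denominator_enumeration (rat_states r) e \<longrightarrow> has_mean (rat_states r) e h (m h)) \<and>
       (\<forall>h. (\<exists>p\<in>stratum_pts r. val p h > 0) \<longrightarrow> m h > 0)"
proof -
  obtain p0 where p0: "p0 \<in> stratum_pts r" using ne by blast
  have p0P: "p0 \<in> polyh" "mrk p0 = r" using p0 by (auto simp: stratum_pts_def)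
  have p0u: "val p0 u > 0" using p0P by (simp add: polyh_iff)
  show neD: "rat_states r \<noteq> {}" using rat_state_pos[OF p0 p0u] by blast
  show "\<exists>e. denominator_enumeration (rat_states r) e"
    using monotone_enumeration_exists[where D = "rat_states r" and den = denominator, OF finite_rat_upto]
    unfolding denominator_enumeration_def Let_def .
  have r1: "r \<ge> 1" using crk_pos[OF p0P(1)] mrk_ge[OF p0P(1), of p0] p0P(2) by simp
  have enn: "0 \<le> e h" if "e \<in> rat_states r" for e h
    using that by (simp add: rat_states_def extremal_states_def hoop_state_def)
  show "\<exists>m. (\<forall>h e. denominator_enumeration (rat_states r) e \<longrightarrow> has_mean (rat_states r) e h (m h)) \<and>
       (\<forall>h. (\<exists>p\<in>stratum_pts r. val p h > 0) \<longrightarrow> m h > 0)"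
  \<comment> \<open>The contraction needs \<open>r \<ge> 2\<close>; for \<open>r = 1\<close> the
    stratum is finite and the mean is an ordinary average.\<close>
  proof (cases "r = 1")
    case True
    have "finite (coords ` rat_states r)"
      using finite_stratum_one True by (rule_tac finite_subset[of _ "stratum_pts 1"]) (auto simp: rat_states_def)
    hence fin: "finite (rat_states r)"
      by (rule finite_imageD) (rule inj_on_subset[OF inj_on_coords], auto simp: rat_states_def)
    define m where "m h = 1 / real (card (rat_states r)) * (\<Sum>e\<in>rat_states r. e h)" for h
    have "has_mean (rat_states r) e h (m h)" if "denominator_enumeration (rat_states r) e" for e h
    proof -
      have "bij_betw e {1..card (rat_states r)} (rat_states r)"
        using that fin by (simp add: denominator_enumeration_def Let_def)
      from sum.reindex_bij_betw[OF this, of "\<lambda>e. e h"] show ?thesis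
        using fin by (simp add: has_mean_def cesaro_average_def m_def)
    qed
    moreover have "m h > 0" if p: "p \<in> stratum_pts r" "val p h > 0" for p h
    proof -
      obtain e where e: "e \<in> rat_states r" "e h > 0" using rat_state_pos[OF p] by blast
      have "0 < (\<Sum>e\<in>rat_states r. e h)" by (rule sum_pos2[where f = "\<lambda>e. e h", OF fin e]) (rule enn)
      moreover have "card (rat_states r) > 0" using fin neD by (simp add: card_gt_0_iff)
      ultimately show ?thesis by (simp add: m_def)
    qed
    ultimately show ?thesis by blast
  next
    case False
    hence r2: "r \<ge> 2" using r1 by simp
    have "\<forall>h. \<exists>C\<ge>0. (\<lambda>N. (\<Sum>k=1..N. \<Sum>e\<in>rat_upto r (N div k). e h) / real N ^ r) \<longlonglongrightarrow> C \<and>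
     ((\<exists>p\<in>stratum_pts r. val p h > 0) \<longrightarrow> C > 0)"
      unfolding sum_rat_states using stratum_lattice_asymptotics by blast
    from choice[OF this] obtain C where C': "\<forall>h. C h \<ge> 0 \<and> (\<lambda>N. (\<Sum>k=1..N. \<Sum>e\<in>rat_upto r (N div k). e h) / real N ^ r) \<longlonglongrightarrow> C h \<and>
        ((\<exists>p\<in>stratum_pts r. val p h > 0) \<longrightarrow> C h > 0)" by (elim exE)
    hence C: "(\<lambda>N. (\<Sum>k=1..N. \<Sum>e\<in>rat_upto r (N div k). e h) / real N ^ r) \<longlonglongrightarrow> C h"
        "(\<exists>p\<in>stratum_pts r. val p h > 0) \<Longrightarrow> C h > 0" for h by blast+
    \<comment> \<open>Every state is 1 at \<open>u\<close>, so \<open>C u\<close> is the limit for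
      the plain count, and the mean will be \<open>C h / C u\<close>.\<close>
    have Cu: "C u > 0" using C(2) p0 p0u by blast
    have e1: "e u = 1" if "e \<in> rat_states r" for e
      using that by (simp add: rat_states_def extremal_states_def hoop_state_def)
    have "(\<lambda>N. (\<Sum>k=1..N. real (card (rat_upto r (N div k)))) / real N ^ r) \<longlonglongrightarrow> C u"
    proof -
      have "(\<Sum>e\<in>rat_upto r m. e u) = real (card (rat_upto r m))" for m
      proof -
        have "(\<Sum>e\<in>rat_upto r m. e u) = (\<Sum>e\<in>rat_upto r m. 1)"
          by (intro sum.cong HOL.refl) (rule e1, simp)
        thus ?thesis by simp
      qed
      thus ?thesis using C(1)[of u] by simp
    qed
    note G1 = this
    have bd: "\<exists>B. \<forall>e\<in>rat_states r. \<bar>e h\<bar> \<le> B" for h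
    proof -
      obtain k where k: "\<forall>x\<in>cone. val x h \<le> real (k::nat) * val x u" using val_bound by blast
      have "\<bar>e h\<bar> \<le> real k" if e: "e \<in> rat_states r" for e
      proof -
        have ex: "e \<in> extremal_states u" using e by (simp add: rat_states_def)
        have "coords e \<in> cone" using coords_polyh[OF ex] by (simp add: polyh_def)
        hence "val (coords e) h \<le> real k * val (coords e) u" using k by blast
        thus ?thesis using enn[OF e] e1[OF e] val_coords[OF ex] by simp
      qed
      thus ?thesis by blast
    qed
    have inf: "infinite (rat_states r)"
    proof -
      obtain B where B: "\<And>e. e \<in> rat_states r \<Longrightarrow> \<bar>e u\<bar> \<le> B" using bd by blast
      show ?thesis
        by (rule averages_converge(1)[where D = "rat_states r" and den = denominator and f = "\<lambda>e. e u" and B = B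
            and r = r and Cf = "C u" and ?C1.0 = "C u"])
          (rule finite_rat_upto r2 C(1) G1 Cu | erule rat_state_denominator_pos B)+
    qed
    have "has_mean (rat_states r) e h (C h / C u)" if e: "denominator_enumeration (rat_states r) e" for e h
    proof -
      obtain B where B: "\<And>e. e \<in> rat_states r \<Longrightarrow> \<bar>e h\<bar> \<le> B" using bd by blast
      have en: "bij_betw e {1..} (rat_states r)" "\<forall>s\<in>{1..}. \<forall>t\<in>{1..}. s \<le> t \<longrightarrow> denominator (e s) \<le> denominator (e t)"
        using e inf unfolding denominator_enumeration_def Let_def by simp_all
      have "(\<lambda>k. 1 / real k * (\<Sum>t=1..k. e t h)) \<longlonglongrightarrow> C h / C u"
        by (rule averages_converge(2)[where D = "rat_states r" and den = denominator and f = "\<lambda>e. e h" and B = B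
            and r = r and Cf = "C h" and ?C1.0 = "C u"])
          (rule finite_rat_upto r2 C(1) G1 Cu en | erule rat_state_denominator_pos B)+
      moreover have "cesaro_average e h = (\<lambda>k. 1 / real k * (\<Sum>t=1..k. e t h))"
        by (rule ext) (rule cesaro_average_def)
      ultimately show ?thesis using inf by (simp only: has_mean_def if_False)
    qed
    moreover have "C h / C u > 0" if "\<exists>p\<in>stratum_pts r. val p h > 0" for h using C(2)[OF that] Cu by simp
    ultimately show ?thesis by (intro exI[of _ "\<lambda>h. C h / C u"]) blast
  qed
qed

section \<open>Elements of the hoop supported in one stratum\<close>

definition meet :: "'a \<Rightarrow> 'a \<Rightarrow> 'a" where
  "meet a b = a - (a - b)"

lemma val_meet: "x \<in> cone \<Longrightarrow> val x (meet a b) = min (val x a) (val x b)"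
  using val_nonneg[of x a] val_nonneg[of x b] by (simp add: meet_def val_diff max_def min_def)

text \<open>A hat function of \<open>real Q * y j\<close>, positive exactly between
  \<open>P - 1\<close> and \<open>P + 1\<close>, can be written with hoop operations and multiples
  of \<open>u\<close>.\<close>

lemma coordinate_bump:
  assumes z: "z \<in> polyh" and j: "j < n" and \<epsilon>: "\<epsilon> > 0"
  shows "\<exists>h. val z h > 0 \<and> (\<forall>y\<in>polyh. val y h > 0 \<longrightarrow> \<bar>y j - z j\<bar> < \<epsilon>)"
proof -
  \<comment> \<open>The hat has width 2 in the scaled coordinate, so
    \<open>2 / \<epsilon> < real Q\<close> keeps its support within \<open>\<epsilon>\<close> of
    \<open>z j\<close>.\<close>
  obtain Q :: nat where Q: "2 / \<epsilon> < real Q" using reals_Archimedean2 by blast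
  have Q0: "real Q > 0" using Q \<epsilon> by (meson divide_pos_pos less_trans zero_less_numeral)
  have Qe: "2 < real Q * \<epsilon>" using Q \<epsilon> by (simp add: field_simps)
  define P where "P = nat \<lfloor>real Q * z j\<rfloor>"
  have zj: "z j \<ge> 0" using z j by (simp add: polyh_def cone_def)
  have P: "real P \<le> real Q * z j" "real Q * z j < real P + 1" using zj by (auto simp: P_def)
  define h where "h = meet (((\<Sum>i<Q. g j) + u) - (\<Sum>i<P. u)) ((\<Sum>i<Suc P. u) - (\<Sum>i<Q. g j))"
  have vh: "val y h = min (max 0 (real Q * y j + 1 - real P)) (max 0 (real P + 1 - real Q * y j))" if y: "y \<in> polyh" for y
  proof -
    have yc: "y \<in> cone" "val y u = 1" using y by (auto simp: polyh_iff)
    show ?thesis unfolding h_def by (simp add: val_meet val_diff val_add val_sum val_gen yc j del: sum.lessThan_Suc)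
  qed
  have "val z h > 0" using P vh[OF z] by simp
  moreover have "\<bar>y j - z j\<bar> < \<epsilon>" if y: "y \<in> polyh" "val y h > 0" for y
  proof -
    have "real P < real Q * y j + 1" "real Q * y j < real P + 1" using y(2) vh[OF y(1)] by (auto simp: max_def min_def split: if_splits)
    hence "real Q * (y j - z j) < real Q * \<epsilon>" "real Q * (z j - y j) < real Q * \<epsilon>"
      using P Qe by (simp_all add: algebra_simps)
    thus ?thesis using Q0 by (simp add: abs_less_iff)
  qed
  ultimately show ?thesis by blast
qed

lemma box_bump:
  assumes z: "z \<in> polyh" and \<epsilon>: "\<epsilon> > 0"
  shows "\<exists>h. val z h > 0 \<and> (\<forall>y\<in>polyh. val y h > 0 \<longrightarrow> (\<forall>j<k. \<bar>y j - z j\<bar> < \<epsilon>))"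
proof (induction k)
  case 0
  have "val z u > 0" using z by (simp add: polyh_iff)
  thus ?case by (intro exI[of _ u]) simp
next
  case (Suc k)
  obtain h where h: "val z h > 0" "\<forall>y\<in>polyh. val y h > 0 \<longrightarrow> (\<forall>j<k. \<bar>y j - z j\<bar> < \<epsilon>)" using Suc by blast
  have "\<exists>h. val z h > 0 \<and> (\<forall>y\<in>polyh. val y h > 0 \<longrightarrow> \<bar>y k - z k\<bar> < \<epsilon>)"
  proof (cases "k < n")
    case True thus ?thesis by (rule coordinate_bump[OF z _ \<epsilon>])
  next
    case False
    have "val z u > 0" using z by (simp add: polyh_iff)
    moreover have "y k = z k" if "y \<in> polyh" for y using that z False by (simp add: polyh_def cone_def)
    ultimately show ?thesis using \<epsilon> by (intro exI[of _ u]) simp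
  qed
  then obtain h' where h': "val z h' > 0" "\<forall>y\<in>polyh. val y h' > 0 \<longrightarrow> \<bar>y k - z k\<bar> < \<epsilon>" by blast
  have m: "val y (meet h h') = min (val y h) (val y h')" if "y \<in> polyh" for y
    using that by (simp add: val_meet polyh_def)
  show ?case
  proof (intro exI[of _ "meet h h'"] conjI ballI impI allI)
    show "val z (meet h h') > 0" using m[OF z] h(1) h'(1) by simp
    fix y j assume y: "y \<in> polyh" "val y (meet h h') > 0" "j < Suc k"
    hence "val y h > 0" "val y h' > 0" using m by auto
    thus "\<bar>y j - z j\<bar> < \<epsilon>" using h(2) h'(2) y by (auto simp: less_Suc_eq)
  qed
qed

text \<open>A bump supported in an open star inside the stratum vanishes on all other strata; it
  detects a zero weight in the criterion for faithfulness.\<close>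

lemma stratum_bump:
  assumes ne: "stratum_pts r \<noteq> {}"
  shows "\<exists>h. h \<noteq> 0 \<and> (\<forall>y\<in>polyh. mrk y \<noteq> r \<longrightarrow> val y h = 0)"
proof -
  obtain p where p: "p \<in> polyh" "mrk p = r" using ne by (auto simp: stratum_pts_def)
  obtain z where z: "z \<in> polyh" "\<And>y. y \<in> star z \<Longrightarrow> mrk y = r" using star_subset_stratum[OF p(1)] p(2) by metis
  obtain T where T: "open T" "star z = polyh \<inter> T" using openin_star[of z] by (auto simp: openin_open)
  have zT: "z \<in> T" using z(1) T(2) by (auto simp: star_def)
  obtain N \<epsilon> where e: "\<epsilon> > 0" "\<And>y. (\<forall>j<N. \<bar>y j - z j\<bar> < \<epsilon>) \<Longrightarrow> y \<in> T"
    using open_fun_box[OF T(1) zT] by metis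
  obtain h where h: "val z h > 0" "\<forall>y\<in>polyh. val y h > 0 \<longrightarrow> (\<forall>j<N. \<bar>y j - z j\<bar> < \<epsilon>)"
    using box_bump[OF z(1) e(1)] by blast
  have zc: "z \<in> cone" using z(1) by (simp add: polyh_def)
  have "h \<noteq> 0" using h(1) val_zero[OF zc] by auto
  moreover have "val y h = 0" if y: "y \<in> polyh" "mrk y \<noteq> r" for y
  proof (rule ccontr)
    assume "val y h \<noteq> 0"
    hence "val y h > 0" using val_nonneg[of y h] y(1) by (simp add: polyh_def less_le)
    hence "y \<in> T" using h(2) y(1) e(2) by blast
    thus False using y T(2) z(2) by blast
  qed
  ultimately show ?thesis by blast
qed

end

theorem theorem7p2:
  fixes u :: "'a::cancellative_hoop" and d :: int
    and q :: nat and l :: "nat \<Rightarrow> int" and p :: "nat \<Rightarrow> real"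
  assumes "finitely_presented TYPE('a)"
    and "hoop_unit u"
    and "d = top_dim (extremal_space u)"
    and "strict_mono_on {1..q} l"
    and "l ` {1..q} = {j. 0 \<le> j \<and> j \<le> d \<and> extremal_stratum u j \<noteq> {}}"
    and "\<forall>i\<in>{1..q}. 0 \<le> p i"
    and "(\<Sum>i=1..q. p i) = 1"
  shows "l q = d \<and>
    (\<forall>i\<in>{1..q}. \<exists>e. denominator_enumeration (discrete_stratum u (l i)) e) \<and>
    (\<exists>m :: nat \<Rightarrow> 'a \<Rightarrow> real.
      (\<forall>i\<in>{1..q}. \<forall>h. \<forall>e. denominator_enumeration (discrete_stratum u (l i)) e \<longrightarrow>
         has_mean (discrete_stratum u (l i)) e h (m i h)) \<and>
      (let mp = (\<lambda>h. \<Sum>i=1..q. p i * m i h) in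
         hoop_state u mp \<and> automorphism_invariant u mp \<and>
         (faithful mp \<longleftrightarrow> (\<forall>i\<in>{1..q}. 0 < p i))))"
proof -
  obtain n E and g :: "nat \<Rightarrow> 'a" where pres: "finite E" "E \<subseteq> hterms n \<times> hterms n" "heval g ` hterms n = UNIV"
      "\<forall>s\<in>hterms n. \<forall>t\<in>hterms n. heval g s = heval g t \<longleftrightarrow> hoop_cong n E s t"
    using assms(1) unfolding finitely_presented_def by blast
  have "u \<in> heval g ` hterms n" using pres(3) by simp
  then obtain ut where ut: "ut \<in> hterms n" "heval g ut = u" by auto
  interpret presented_hoop n E g u ut
    by unfold_locales (use pres ut assms(2) in auto)
  note strata = assms(5)
  have q1: "q \<ge> 1" using assms(7) by (cases q) auto
  have dim: "d = top_dim (top_of_set polyh)"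
    unfolding assms(3) using homeomorphic_maps_coords_val by (intro top_dim_homeomorphic) (auto simp: homeomorphic_space_def)
  \<comment> \<open>Ranks are those of cones and exceed the local dimensions by one.\<close>
  define r where "r i = nat (l i + 1)" for i
  have li: "l i = int (r i) - 1" and ri: "stratum_pts (r i) \<noteq> {}" if i: "i \<in> {1..q}" for i
  proof -
    have "l i \<in> l ` {1..q}" using i by (rule imageI)
    hence l0: "0 \<le> l i" and ne: "extremal_stratum u (l i) \<noteq> {}" unfolding strata by simp_all
    show *: "l i = int (r i) - 1" using l0 by (simp add: r_def)
    show "stratum_pts (r i) \<noteq> {}" by (rule extremal_stratum_nonempty) (use ne * in simp)
  qed
  have D: "discrete_stratum u (l i) = rat_states (r i)" if "i \<in> {1..q}" for i
    using li[OF that] discrete_stratum_eq[of "r i"] by simp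
  have "polyh \<noteq> {}" using ri[of q] q1 by (auto simp: stratum_pts_def)
  note td = top_dim_polyh[OF this]
  \<comment> \<open>The listed values exhaust the local dimensions, so every point of
    \<open>polyh\<close> lies in a listed stratum.\<close>
  have pts: "\<exists>i\<in>{1..q}. r i = mrk x" if x: "x \<in> polyh" for x
  proof -
    have "mrk x \<ge> 1" using crk_pos[OF x] mrk_ge[OF x, of x] by simp
    hence "int (mrk x) - 1 \<in> {j. 0 \<le> j \<and> j \<le> d \<and> extremal_stratum u j \<noteq> {}}"
      using td(2)[OF x] dim val_in_extremal_stratum[OF x] by auto
    hence "int (mrk x) - 1 \<in> l ` {1..q}" unfolding strata .
    then obtain i where i: "i \<in> {1..q}" "int (mrk x) - 1 = l i" by (elim imageE)
    hence "r i = mrk x" using li[OF i(1)] by simp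
    thus ?thesis using i(1) by blast
  qed
  have lq: "l q = d"
  proof -
    obtain x where x: "x \<in> polyh" "d = int (mrk x) - 1" using td(1) dim by auto
    obtain i where i: "i \<in> {1..q}" "r i = mrk x" using pts[OF x(1)] by blast
    have "l i = d" using li[OF i(1)] i(2) x(2) by simp
    moreover have "l i \<le> l q"
    proof (cases "i = q")
      case False
      hence "l i < l q" using assms(4) i(1) by (auto simp: strict_mono_on_def)
      thus ?thesis by simp
    qed simp
    moreover have "l q \<le> d"
    proof -
      have "l q \<in> l ` {1..q}" using q1 by (intro imageI) simp
      thus ?thesis unfolding strata by simp
    qed
    ultimately show ?thesis by simp
  qed
  have rinj: "r i \<noteq> r j" if "i \<in> {1..q}" "j \<in> {1..q}" "i \<noteq> j" for i j
  proof -
    have "l i \<noteq> l j" using assms(4) that strict_mono_on_imp_inj_on inj_onD by metis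
    thus ?thesis using li that by auto
  qed
  have "\<exists>m. \<forall>i\<in>{1..q}. (\<forall>h e. denominator_enumeration (rat_states (r i)) e \<longrightarrow> has_mean (rat_states (r i)) e h (m i h)) \<and>
       (\<forall>h. (\<exists>p\<in>stratum_pts (r i). val p h > 0) \<longrightarrow> m i h > 0)"
    using stratum_mean(3)[OF ri] by (intro bchoice) blast
  then obtain m where m: "\<And>i h e. i \<in> {1..q} \<Longrightarrow> denominator_enumeration (rat_states (r i)) e \<Longrightarrow> has_mean (rat_states (r i)) e h (m i h)"
    and mpos: "\<And>i h x. i \<in> {1..q} \<Longrightarrow> x \<in> stratum_pts (r i) \<Longrightarrow> val x h > 0 \<Longrightarrow> m i h > 0" by blast
  have enum: "\<exists>e. denominator_enumeration (rat_states (r i)) e" if "i \<in> {1..q}" for i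
    using stratum_mean(2)[OF ri[OF that]] .
  have mstate: "hoop_state u (m i)" if i: "i \<in> {1..q}" for i
  proof -
    obtain e where e: "denominator_enumeration (rat_states (r i)) e" using enum[OF i] by blast
    show ?thesis
    proof (rule mean_is_state[OF _ stratum_mean(1)[OF ri[OF i]] e])
      show "rat_states (r i) \<subseteq> {m. hoop_state u m}" by (auto simp: rat_states_def extremal_states_def)
      show "has_mean (rat_states (r i)) e h (m i h)" for h by (rule m[OF i e])
    qed
  qed
  have minv: "m i (\<sigma> h) = m i h" if i: "i \<in> {1..q}" and s: "hoop_automorphism \<sigma>" "\<sigma> u = u" for i \<sigma> h
  proof -
    obtain e where e: "denominator_enumeration (discrete_stratum u (l i)) e" using enum[OF i] D[OF i] by auto
    show ?thesis by (rule mean_automorphism_invariant[OF e _ s]) (use m[OF i] D[OF i] in simp)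
  qed
  define mp where "mp = (\<lambda>h. \<Sum>i=1..q. p i * m i h)"
  have mnn: "0 \<le> p i * m i h" if "i \<in> {1..q}" for i h
    using mstate[OF that] assms(6) that by (simp add: hoop_state_def)
  have "hoop_state u mp"
    unfolding hoop_state_def
  proof (intro conjI allI)
    show "0 \<le> mp h" for h unfolding mp_def by (rule sum_nonneg) (rule mnn)
    show "mp 0 = 0" unfolding mp_def using mstate by (intro sum.neutral) (auto simp: hoop_state_def)
    show "mp (g + h) = mp g + mp h" for g h
      unfolding mp_def sum.distrib[symmetric] using mstate by (intro sum.cong) (auto simp: hoop_state_def algebra_simps)
    have "mp u = (\<Sum>i=1..q. p i)" unfolding mp_def using mstate by (intro sum.cong) (auto simp: hoop_state_def)
    thus "mp u = 1" using assms(7) by simp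
  qed
  moreover have "automorphism_invariant u mp"
    unfolding automorphism_invariant_def mp_def using minv by (auto simp: fun_eq_iff intro!: sum.cong)
  moreover have "faithful mp \<longleftrightarrow> (\<forall>i\<in>{1..q}. 0 < p i)"
  proof
    assume f: "faithful mp"
    show "\<forall>i\<in>{1..q}. 0 < p i"
    proof (rule ccontr)
      assume "\<not> ?thesis"
      then obtain i where i: "i \<in> {1..q}" "p i = 0" using assms(6) by force
      \<comment> \<open>This element is invisible to all strata except the \<open>i\<close>-th,
        whose weight is 0.\<close>
      obtain h where h: "h \<noteq> 0" "\<And>y. y \<in> polyh \<Longrightarrow> mrk y \<noteq> r i \<Longrightarrow> val y h = 0"
        using stratum_bump[OF ri[OF i(1)]] by blast
      have "p j * m j h = 0" if j: "j \<in> {1..q}" for j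
      proof (cases "j = i")
        case True thus ?thesis using i by simp
      next
        case False
        obtain e where e: "denominator_enumeration (rat_states (r j)) e" using enum[OF j] by blast
        have "m j h = 0"
        proof (rule mean_zero[OF e m[OF j e]])
          fix e assume e: "e \<in> rat_states (r j)"
          hence ex: "e \<in> extremal_states u" "coords e \<in> polyh" "mrk (coords e) = r j"
            by (auto simp: rat_states_def stratum_pts_def)
          hence "val (coords e) h = 0" using h(2) rinj[OF j i(1) False] by simp
          thus "e h = 0" using val_coords[OF ex(1)] by simp
        qed
        thus ?thesis by simp
      qed
      hence "mp h = 0" unfolding mp_def by (intro sum.neutral) blast
      thus False using f h(1) by (simp add: faithful_def)
    qed
  next
    assume pp: "\<forall>i\<in>{1..q}. 0 < p i"
    show "faithful mp" unfolding faithful_def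
    proof (intro allI impI)
      fix h :: 'a assume "h \<noteq> 0"
      \<comment> \<open>The stratum of a point where \<open>h\<close> is positive has positive
        weight and a positive mean at \<open>h\<close>; the other summands are nonnegative.\<close>
      then obtain x where x: "x \<in> polyh" "val x h > 0" using exists_val_pos by blast
      obtain i where i: "i \<in> {1..q}" "r i = mrk x" using pts[OF x(1)] by blast
      have "m i h > 0" using mpos[OF i(1) _ x(2)] x(1) i(2) by (simp add: stratum_pts_def)
      hence "0 < p i * m i h" using pp i(1) by simp
      hence "0 < mp h" unfolding mp_def by (intro sum_pos2[OF _ i(1)]) (use mnn in auto)
      thus "mp h \<noteq> 0" by simp
    qed
  qed
  ultimately have "hoop_state u mp \<and> automorphism_invariant u mp \<and> (faithful mp \<longleftrightarrow> (\<forall>i\<in>{1..q}. 0 < p i))" by blast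
  moreover have "\<forall>i\<in>{1..q}. \<forall>h. \<forall>e. denominator_enumeration (discrete_stratum u (l i)) e \<longrightarrow>
         has_mean (discrete_stratum u (l i)) e h (m i h)"
    using m D by simp
  moreover have "\<forall>i\<in>{1..q}. \<exists>e. denominator_enumeration (discrete_stratum u (l i)) e"
    using enum D by simp
  ultimately show ?thesis using lq unfolding mp_def Let_def by blast
qed

end
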